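(* Let $G$ be a group and let $R$ be a $G$-graded ring. The following assertions are equivalent. (1) $R$ is graded Artinian (i.e., graded left Artinian and graded right Artinian), and it satisfies the double annihilator condition for graded right ideals, i.e., $\mathrm{ann}_r(\mathrm{ann}_\ell(A))=A$ for any graded right ideal $A$ of $R$, and for graded left ideals, i.e., $\mathrm{ann}_\ell(\mathrm{ann}_r(U))=U$ for any graded left ideal $U$ of $R$. (2) $R$ is graded left Noetherian and satisfies the double annihilator condition for graded right ideals and for graded left ideals. (3) $R$ is graded left Noetherian and graded left injective. (4) $R$ is graded right Noetherian and graded left injective.
   Context: Rings are associative with identity. A $G$-graded ring is a ring $R=\bigoplus_{g\in G}R_g$ (additive subgroups) with $R_gR_h\subset R_{gh}$. A graded left $R$-module is a left $R$-module $M=\bigoplus_{g\in G}M_g$ with $R_gM_h\subset M_{gh}$; $R-gr$ is the category of graded left $R$-modules, with morphisms the $R$-linear maps $f$ satisfying $f(M_g)\subset N_g$ for all $g$. A graded left (right) ideal is a left (right) ideal generated by homogeneous elements. $R$ is graded left (right) Noetherian, respectively Artinian, if it satisfies ACC, respectively DCC, on graded left (right) ideals. $R$ is graded left injective if it is an injective object of $R-gr$ when regarded as a graded left module over itself. For a subset $X\subset R$, $\mathrm{ann}_\ell(X)=\{r\in R: rX=0\}$ and $\mathrm{ann}_r(X)=\{r\in R: Xr=0\}$. *)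

theory Defs
  imports "HOL-Algebra.Module" "HOL-Algebra.Ideal"
begin

section \<open>Graded rings\<close>

text \<open>\<^term>\<open>internal_direct_sum I M C\<close> says that the additive group of \<^term>\<open>M\<close> is the internal
  direct sum of its subgroups \<^term>\<open>C i\<close>, where \<^term>\<open>i\<close> ranges over \<^term>\<open>I\<close>: each element is in
  exactly one way a finite sum of components. The values of \<^term>\<open>C\<close> outside \<^term>\<open>I\<close> are irrelevant.\<close>

definition internal_direct_sum ::
    "'i set \<Rightarrow> ('m, 'x) ring_scheme \<Rightarrow> ('i \<Rightarrow> 'm set) \<Rightarrow> bool" where
  "internal_direct_sum I M C \<longleftrightarrow>
     (\<forall>i\<in>I. additive_subgroup (C i) M) \<and>
     (\<forall>x\<in>carrier M. \<exists>!c. c \<in> (\<Pi>\<^sub>E i\<in>I. C i) \<and> finite {i \<in> I. c i \<noteq> \<zero>\<^bsub>M\<^esub>} \<and>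
        x = finsum M c {i \<in> I. c i \<noteq> \<zero>\<^bsub>M\<^esub>})"

locale graded_ring = G: group G + R: ring R
  for G :: "('g, 'x) monoid_scheme" (structure) and R :: "('r, 'y) ring_scheme" (structure) +
  fixes \<R> :: "'g \<Rightarrow> 'r set"
  assumes ring_decomposition: "internal_direct_sum (carrier G) R \<R>"
    and mult_degree:
      "\<lbrakk>g \<in> carrier G; h \<in> carrier G; a \<in> \<R> g; b \<in> \<R> h\<rbrakk> \<Longrightarrow> a \<otimes>\<^bsub>R\<^esub> b \<in> \<R> (g \<otimes>\<^bsub>G\<^esub> h)"

definition homogeneous :: "('g, 'x) monoid_scheme \<Rightarrow> ('g \<Rightarrow> 'r set) \<Rightarrow> 'r set" where
  "homogeneous G \<R> = (\<Union>g\<in>carrier G. \<R> g)"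


section \<open>Graded one-sided ideals\<close>

locale left_ideal = additive_subgroup I R + ring R for I and R (structure) +
  assumes l_closed: "\<lbrakk>a \<in> I; x \<in> carrier R\<rbrakk> \<Longrightarrow> x \<otimes> a \<in> I"

locale right_ideal = additive_subgroup I R + ring R for I and R (structure) +
  assumes r_closed: "\<lbrakk>a \<in> I; x \<in> carrier R\<rbrakk> \<Longrightarrow> a \<otimes> x \<in> I"

definition gen_left_ideal :: "('r, 'y) ring_scheme \<Rightarrow> 'r set \<Rightarrow> 'r set" where
  "gen_left_ideal R S = \<Inter>{I. left_ideal I R \<and> S \<subseteq> I}"

definition gen_right_ideal :: "('r, 'y) ring_scheme \<Rightarrow> 'r set \<Rightarrow> 'r set" where
  "gen_right_ideal R S = \<Inter>{I. right_ideal I R \<and> S \<subseteq> I}"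

definition graded_left_ideals ::
    "('g, 'x) monoid_scheme \<Rightarrow> ('r, 'y) ring_scheme \<Rightarrow> ('g \<Rightarrow> 'r set) \<Rightarrow> 'r set set" where
  "graded_left_ideals G R \<R> = {gen_left_ideal R S | S. S \<subseteq> homogeneous G \<R>}"

definition graded_right_ideals ::
    "('g, 'x) monoid_scheme \<Rightarrow> ('r, 'y) ring_scheme \<Rightarrow> ('g \<Rightarrow> 'r set) \<Rightarrow> 'r set set" where
  "graded_right_ideals G R \<R> = {gen_right_ideal R S | S. S \<subseteq> homogeneous G \<R>}"


section \<open>Chain conditions\<close>

definition satisfies_ACC :: "'a set set \<Rightarrow> bool" where
  "satisfies_ACC \<F> \<longleftrightarrow>
     (\<forall>I :: nat \<Rightarrow> 'a set. (\<forall>n. I n \<in> \<F>) \<and> (\<forall>n. I n \<subseteq> I (Suc n)) \<longrightarrow> (\<exists>N. \<forall>n\<ge>N. I n = I N))"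

definition satisfies_DCC :: "'a set set \<Rightarrow> bool" where
  "satisfies_DCC \<F> \<longleftrightarrow>
     (\<forall>I :: nat \<Rightarrow> 'a set. (\<forall>n. I n \<in> \<F>) \<and> (\<forall>n. I (Suc n) \<subseteq> I n) \<longrightarrow> (\<exists>N. \<forall>n\<ge>N. I n = I N))"

definition graded_left_Noetherian ::
    "('g, 'x) monoid_scheme \<Rightarrow> ('r, 'y) ring_scheme \<Rightarrow> ('g \<Rightarrow> 'r set) \<Rightarrow> bool" where
  "graded_left_Noetherian G R \<R> \<longleftrightarrow> satisfies_ACC (graded_left_ideals G R \<R>)"

definition graded_right_Noetherian ::
    "('g, 'x) monoid_scheme \<Rightarrow> ('r, 'y) ring_scheme \<Rightarrow> ('g \<Rightarrow> 'r set) \<Rightarrow> bool" where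
  "graded_right_Noetherian G R \<R> \<longleftrightarrow> satisfies_ACC (graded_right_ideals G R \<R>)"

definition graded_left_Artinian ::
    "('g, 'x) monoid_scheme \<Rightarrow> ('r, 'y) ring_scheme \<Rightarrow> ('g \<Rightarrow> 'r set) \<Rightarrow> bool" where
  "graded_left_Artinian G R \<R> \<longleftrightarrow> satisfies_DCC (graded_left_ideals G R \<R>)"

definition graded_right_Artinian ::
    "('g, 'x) monoid_scheme \<Rightarrow> ('r, 'y) ring_scheme \<Rightarrow> ('g \<Rightarrow> 'r set) \<Rightarrow> bool" where
  "graded_right_Artinian G R \<R> \<longleftrightarrow> satisfies_DCC (graded_right_ideals G R \<R>)"


section \<open>Annihilators\<close>

definition ann_l :: "('r, 'y) ring_scheme \<Rightarrow> 'r set \<Rightarrow> 'r set" where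
  "ann_l R X = {r \<in> carrier R. \<forall>x\<in>X. r \<otimes>\<^bsub>R\<^esub> x = \<zero>\<^bsub>R\<^esub>}"

definition ann_r :: "('r, 'y) ring_scheme \<Rightarrow> 'r set \<Rightarrow> 'r set" where
  "ann_r R X = {r \<in> carrier R. \<forall>x\<in>X. x \<otimes>\<^bsub>R\<^esub> r = \<zero>\<^bsub>R\<^esub>}"

definition double_annihilator_right ::
    "('g, 'x) monoid_scheme \<Rightarrow> ('r, 'y) ring_scheme \<Rightarrow> ('g \<Rightarrow> 'r set) \<Rightarrow> bool" where
  "double_annihilator_right G R \<R> \<longleftrightarrow>
     (\<forall>A \<in> graded_right_ideals G R \<R>. ann_r R (ann_l R A) = A)"

definition double_annihilator_left ::
    "('g, 'x) monoid_scheme \<Rightarrow> ('r, 'y) ring_scheme \<Rightarrow> ('g \<Rightarrow> 'r set) \<Rightarrow> bool" where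
  "double_annihilator_left G R \<R> \<longleftrightarrow>
     (\<forall>U \<in> graded_left_ideals G R \<R>. ann_l R (ann_r R U) = U)"


section \<open>The category of graded left modules\<close>

text \<open>The locale \<^locale>\<open>module\<close> requires a commutative ring of scalars. As there, the fields
  \<^term>\<open>mult M\<close> and \<^term>\<open>one M\<close> of the module record play no role.\<close>

locale left_module = R: ring R + M: abelian_group M
  for R :: "('r, 'y) ring_scheme" (structure) and M :: "('r, 'm, 'z) module_scheme" (structure) +
  assumes smult_closed:
      "\<lbrakk>a \<in> carrier R; x \<in> carrier M\<rbrakk> \<Longrightarrow> a \<odot>\<^bsub>M\<^esub> x \<in> carrier M"
    and smult_l_distr:
      "\<lbrakk>a \<in> carrier R; b \<in> carrier R; x \<in> carrier M\<rbrakk> \<Longrightarrow>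
        (a \<oplus>\<^bsub>R\<^esub> b) \<odot>\<^bsub>M\<^esub> x = a \<odot>\<^bsub>M\<^esub> x \<oplus>\<^bsub>M\<^esub> b \<odot>\<^bsub>M\<^esub> x"
    and smult_r_distr:
      "\<lbrakk>a \<in> carrier R; x \<in> carrier M; y \<in> carrier M\<rbrakk> \<Longrightarrow>
        a \<odot>\<^bsub>M\<^esub> (x \<oplus>\<^bsub>M\<^esub> y) = a \<odot>\<^bsub>M\<^esub> x \<oplus>\<^bsub>M\<^esub> a \<odot>\<^bsub>M\<^esub> y"
    and smult_assoc:
      "\<lbrakk>a \<in> carrier R; b \<in> carrier R; x \<in> carrier M\<rbrakk> \<Longrightarrow>
        (a \<otimes>\<^bsub>R\<^esub> b) \<odot>\<^bsub>M\<^esub> x = a \<odot>\<^bsub>M\<^esub> (b \<odot>\<^bsub>M\<^esub> x)"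
    and smult_one: "x \<in> carrier M \<Longrightarrow> \<one>\<^bsub>R\<^esub> \<odot>\<^bsub>M\<^esub> x = x"

locale graded_left_module = graded_ring G R \<R> + left_module R M
  for G :: "('g, 'x) monoid_scheme" (structure) and R :: "('r, 'y) ring_scheme" (structure)
    and \<R> :: "'g \<Rightarrow> 'r set" and M :: "('r, 'm, 'z) module_scheme" (structure) +
  fixes \<M> :: "'g \<Rightarrow> 'm set"
  assumes module_decomposition: "internal_direct_sum (carrier G) M \<M>"
    and smult_degree:
      "\<lbrakk>g \<in> carrier G; h \<in> carrier G; a \<in> \<R> g; x \<in> \<M> h\<rbrakk> \<Longrightarrow> a \<odot>\<^bsub>M\<^esub> x \<in> \<M> (g \<otimes>\<^bsub>G\<^esub> h)"

text \<open>Morphisms are represented by functions of which only the values on the carrier of the source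
  matter; two of them represent the same morphism iff they agree there.\<close>

definition gr_hom ::
    "('g, 'x) monoid_scheme \<Rightarrow> ('r, 'y) ring_scheme \<Rightarrow>
     ('r, 'm, 'z) module_scheme \<Rightarrow> ('g \<Rightarrow> 'm set) \<Rightarrow>
     ('r, 'n, 'w) module_scheme \<Rightarrow> ('g \<Rightarrow> 'n set) \<Rightarrow> ('m \<Rightarrow> 'n) set" where
  "gr_hom G R M \<M> N \<N> =
     {f \<in> carrier M \<rightarrow> carrier N.
        (\<forall>x\<in>carrier M. \<forall>y\<in>carrier M. f (x \<oplus>\<^bsub>M\<^esub> y) = f x \<oplus>\<^bsub>N\<^esub> f y) \<and>
        (\<forall>a\<in>carrier R. \<forall>x\<in>carrier M. f (a \<odot>\<^bsub>M\<^esub> x) = a \<odot>\<^bsub>N\<^esub> f x) \<and>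
        (\<forall>g\<in>carrier G. f ` \<M> g \<subseteq> \<N> g)}"

text \<open>Monomorphisms in the categorical sense. The test objects have elements in the same type as the
  source of the morphism, which suffices since its kernel is among them.\<close>

definition gr_mono ::
    "('g, 'x) monoid_scheme \<Rightarrow> ('r, 'y) ring_scheme \<Rightarrow> ('g \<Rightarrow> 'r set) \<Rightarrow>
     ('r, 'm) module \<Rightarrow> ('g \<Rightarrow> 'm set) \<Rightarrow>
     ('r, 'n) module \<Rightarrow> ('g \<Rightarrow> 'n set) \<Rightarrow> ('m \<Rightarrow> 'n) \<Rightarrow> bool" where
  "gr_mono G R \<R> M \<M> N \<N> i \<longleftrightarrow>
     i \<in> gr_hom G R M \<M> N \<N> \<and>
     (\<forall>(K :: ('r, 'm) module) \<K> u v.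
        graded_left_module G R \<R> K \<K> \<and>
        u \<in> gr_hom G R K \<K> M \<M> \<and> v \<in> gr_hom G R K \<K> M \<M> \<and>
        (\<forall>x\<in>carrier K. i (u x) = i (v x)) \<longrightarrow>
        (\<forall>x\<in>carrier K. u x = v x))"

text \<open>Injectivity of the graded module \<^term>\<open>Q\<close>, tested on the graded modules \<^term>\<open>M\<close>, \<^term>\<open>N\<close>
  whose elements lie in the type \<^typ>\<open>'m\<close>. HOL cannot quantify over types inside a formula, so this
  universe is a parameter.\<close>

definition gr_injective ::
    "'m itself \<Rightarrow> ('g, 'x) monoid_scheme \<Rightarrow> ('r, 'y) ring_scheme \<Rightarrow> ('g \<Rightarrow> 'r set) \<Rightarrow>
     ('r, 'q) module \<Rightarrow> ('g \<Rightarrow> 'q set) \<Rightarrow> bool" where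
  "gr_injective (_ :: 'm itself) G R \<R> Q \<Q> \<longleftrightarrow>
     graded_left_module G R \<R> Q \<Q> \<and>
     (\<forall>(M :: ('r, 'm) module) \<M> (N :: ('r, 'm) module) \<N> i f.
        graded_left_module G R \<R> M \<M> \<and> graded_left_module G R \<R> N \<N> \<and>
        gr_mono G R \<R> M \<M> N \<N> i \<and> f \<in> gr_hom G R M \<M> Q \<Q> \<longrightarrow>
        (\<exists>h \<in> gr_hom G R N \<N> Q \<Q>. \<forall>x\<in>carrier M. h (i x) = f x))"

definition regular_left_module :: "('r, 'y) ring_scheme \<Rightarrow> ('r, 'r) module" where
  "regular_left_module R =
     \<lparr>carrier = carrier R, mult = mult R, one = one R, zero = zero R, add = add R, smult = mult R\<rparr>"

text \<open>The universe is \<^typ>\<open>'r + 'm\<close>, with \<^typ>\<open>'m\<close> arbitrary: it contains a copy of every graded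
  module on the type \<^typ>\<open>'m\<close>, and of the ring itself with all its shifts and graded left ideals.
  The second summand makes a theorem that is polymorphic in \<^typ>\<open>'m\<close> cover all graded modules, the
  first excludes universes that are too small to detect injectivity.\<close>

definition graded_left_injective ::
    "'m itself \<Rightarrow> ('g, 'x) monoid_scheme \<Rightarrow> ('r, 'y) ring_scheme \<Rightarrow> ('g \<Rightarrow> 'r set) \<Rightarrow> bool" where
  "graded_left_injective (_ :: 'm itself) G R \<R> \<longleftrightarrow>
     gr_injective TYPE('r + 'm) G R \<R> (regular_left_module R) \<R>"

end

theory Submission
  imports Defs "HOL-Algebra.QuotRing"
begin

text \<open>Everything is expressed through homogeneous elements, for which self-injectivity is the Baer
  condition: every homomorphism of degree \<open>d\<close> from a graded left ideal to the ring is right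
  multiplication by an element of degree \<open>d\<close>. This condition gives \<open>ann_r (ann_l A) = A\<close> for finitely
  generated graded right ideals \<open>A\<close>, and conversely follows from the two double annihilator conditions
  one generator at a time.

  A self-injective ring that is Noetherian on either side has, modulo each graded prime \<open>Q\<close>, idempotents
  generating minimal one-sided ideals. If it is left Noetherian, this comes from minimality of principal
  right ideals, the left annihilators being subject to the ascending chain condition; if it is right
  Noetherian, from the ring being von Neumann regular modulo its singular ideal, which lies in \<open>Q\<close>. Looking at
  associated primes, one concludes that the ring is Artinian on that side, and then right Noetherian in
  both cases.

  The remaining point is that every maximal graded left ideal \<open>M\<close> has a nonzero right annihilator, which by
  self-injectivity yields \<open>ann_l (ann_r U) = U\<close>. Each graded prime is maximal and is \<open>ann_r N\<close> for a
  minimal two-sided graded ideal \<open>N\<close>, while \<open>N\<close> is determined by the prime \<open>ann_l N\<close>. There are finitely many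
  primes, so the prime core of \<open>M\<close> is also \<open>ann_l N\<close> for some \<open>N\<close>, and \<open>N\<close> contains elements killed by \<open>M\<close>.\<close>

section \<open>Homogeneous components\<close>

text \<open>Only left injectivity is assumed, and it treats the two double annihilator conditions
  differently. Extending maps one generator at a time handles right ideals. The condition for left
  ideals amounts to the ring being a cogenerator: each simple graded left module has to embed, up to
  a shift, into the ring. No such embedding is visible directly, which is why primes are counted. A
  graded prime together with its minimal idempotents takes the place of semisimple structure theory:
  it supplies the simple modules, both for the chain conditions and for the embedding. Morphisms of
  the category preserve degrees, whereas the Baer condition has to cover maps of every degree;
  shifts of the grading bridge this gap. Left and right are exchanged by passing to the opposite
  ring graded by the opposite group. Injectivity is not symmetric, so only statements free of it are
  transported in this way.\<close>

definition component ::
    "'i set \<Rightarrow> ('m, 'x) ring_scheme \<Rightarrow> ('i \<Rightarrow> 'm set) \<Rightarrow> 'm \<Rightarrow> 'i \<Rightarrow> 'm" where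
  "component I M C x = (THE c. c \<in> (\<Pi>\<^sub>E i\<in>I. C i) \<and> finite {i \<in> I. c i \<noteq> \<zero>\<^bsub>M\<^esub>} \<and>
        x = finsum M c {i \<in> I. c i \<noteq> \<zero>\<^bsub>M\<^esub>})"

text \<open>Only the additive structure enters, so the ring and every graded module share one theory
  of components.\<close>

locale decomposed_group = abelian_group M for M (structure) +
  fixes I :: "'i set" and C :: "'i \<Rightarrow> 'a set"
  assumes decomposition: "internal_direct_sum I M C"
begin

abbreviation cmp where "cmp \<equiv> component I M C"

abbreviation support where "support x \<equiv> {i \<in> I. cmp x i \<noteq> \<zero>}"

lemma summand_subgroup: "i \<in> I \<Longrightarrow> additive_subgroup (C i) M"
  using decomposition by (simp add: internal_direct_sum_def)

lemma summand_carrier: "x \<in> C i \<Longrightarrow> i \<in> I \<Longrightarrow> x \<in> carrier M"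
  by (metis additive_subgroup.a_Hcarr summand_subgroup)

lemma summand_zero: "i \<in> I \<Longrightarrow> \<zero> \<in> C i"
  by (metis additive_subgroup.zero_closed summand_subgroup)

lemma summand_add: "i \<in> I \<Longrightarrow> x \<in> C i \<Longrightarrow> y \<in> C i \<Longrightarrow> x \<oplus> y \<in> C i"
  by (metis additive_subgroup.a_closed summand_subgroup)

lemma summand_neg: "i \<in> I \<Longrightarrow> x \<in> C i \<Longrightarrow> \<ominus> x \<in> C i"
  by (rule subgroup.m_inv_closed[OF additive_subgroup.a_subgroup[OF summand_subgroup],
        folded a_inv_def])

lemma component_spec:
  assumes "x \<in> carrier M"
  shows "cmp x \<in> (\<Pi>\<^sub>E i\<in>I. C i) \<and> finite (support x) \<and> x = finsum M (cmp x) (support x)"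
proof -
  have "\<exists>!c. c \<in> (\<Pi>\<^sub>E i\<in>I. C i) \<and> finite {i \<in> I. c i \<noteq> \<zero>} \<and> x = finsum M c {i \<in> I. c i \<noteq> \<zero>}"
    using decomposition assms by (simp add: internal_direct_sum_def)
  from theI'[OF this] show ?thesis unfolding component_def .
qed

lemma component_in: "x \<in> carrier M \<Longrightarrow> i \<in> I \<Longrightarrow> cmp x i \<in> C i"
  using component_spec by blast

lemma component_carrier: "x \<in> carrier M \<Longrightarrow> i \<in> I \<Longrightarrow> cmp x i \<in> carrier M"
  using component_in summand_carrier by blast

lemma finite_support: "x \<in> carrier M \<Longrightarrow> finite (support x)"
  using component_spec by blast

lemma sum_components:
  assumes "x \<in> carrier M" "finite F" "support x \<subseteq> F" "F \<subseteq> I"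
  shows "finsum M (cmp x) F = x"
proof -
  have "finsum M (cmp x) (support x) = finsum M (cmp x) F"
    using assms by (intro add.finprod_mono_neutral_cong_left) (auto intro: component_carrier)
  then show ?thesis using component_spec[OF assms(1)] by simp
qed

lemma component_finsum:
  assumes F: "finite F" "F \<subseteq> I" and c: "\<And>i. i \<in> F \<Longrightarrow> c i \<in> C i" and i: "i \<in> I"
  shows "cmp (finsum M c F) i = (if i \<in> F then c i else \<zero>)"
proof -
  \<comment> \<open>Extension of \<open>c\<close> by zero to all of \<open>I\<close>. It is an
    admissible family for the same sum, so uniqueness identifies it with the family of
    components.\<close>
  define c' where "c' = restrict (\<lambda>i. if i \<in> F then c i else \<zero>) I"
  have supp: "{i \<in> I. c' i \<noteq> \<zero>} \<subseteq> F" by (auto simp: c'_def)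
  have cF: "c \<in> F \<rightarrow> carrier M" using c F summand_carrier by blast
  have x: "finsum M c F \<in> carrier M" using cF by (rule finsum_closed)
  have "finsum M c' {i \<in> I. c' i \<noteq> \<zero>} = finsum M c F"
    using F supp cF by (intro add.finprod_mono_neutral_cong_left) (auto simp: c'_def)
  then have "c' \<in> (\<Pi>\<^sub>E i\<in>I. C i) \<and> finite {i \<in> I. c' i \<noteq> \<zero>} \<and>
      finsum M c F = finsum M c' {i \<in> I. c' i \<noteq> \<zero>}"
    using c F finite_subset[OF supp] summand_zero by (auto simp: c'_def)
  then have "cmp (finsum M c F) = c'"
    using decomposition x component_spec[OF x] unfolding internal_direct_sum_def by blast
  then show ?thesis using i by (simp add: c'_def)
qed

lemma component_summand:
  assumes "j \<in> I" "x \<in> C j" "i \<in> I"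
  shows "cmp x i = (if i = j then x else \<zero>)"
proof -
  have "finsum M (\<lambda>_. x) {j} = x" using assms summand_carrier by simp
  then show ?thesis using component_finsum[of "{j}" "\<lambda>_. x" i] assms by simp
qed

lemma component_zero: "i \<in> I \<Longrightarrow> cmp \<zero> i = \<zero>"
  using component_summand[of i \<zero> i] summand_zero by simp

lemma component_add:
  assumes "x \<in> carrier M" "y \<in> carrier M" "i \<in> I"
  shows "cmp (x \<oplus> y) i = cmp x i \<oplus> cmp y i"
proof -
  let ?F = "support x \<union> support y"
  have F: "finite ?F" "?F \<subseteq> I" using assms finite_support by auto
  have "finsum M (\<lambda>i. cmp x i \<oplus> cmp y i) ?F = finsum M (cmp x) ?F \<oplus> finsum M (cmp y) ?F"
    using assms F by (intro finsum_addf) (auto intro: component_carrier)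
  also have "\<dots> = x \<oplus> y" using sum_components[of _ ?F] assms F by simp
  finally have sum: "finsum M (\<lambda>i. cmp x i \<oplus> cmp y i) ?F = x \<oplus> y" .
  have "cmp x i \<oplus> cmp y i \<in> C i" if "i \<in> ?F" for i
    using assms that by (auto intro: component_in summand_add)
  then have "cmp (x \<oplus> y) i = (if i \<in> ?F then cmp x i \<oplus> cmp y i else \<zero>)"
    using component_finsum[OF F, of "\<lambda>i. cmp x i \<oplus> cmp y i" i] assms unfolding sum by blast
  then show ?thesis using assms by (simp split: if_splits)
qed

lemma component_eqI:
  assumes "x \<in> carrier M" "y \<in> carrier M" "\<And>i. i \<in> I \<Longrightarrow> cmp x i = cmp y i"
  shows "x = y"
proof -
  have "support x = support y" using assms(3) by auto
  then have "finsum M (cmp x) (support x) = finsum M (cmp y) (support y)"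
    using assms by (intro finsum_cong') (auto intro: component_carrier)
  then show ?thesis
    using component_spec[OF assms(1)] component_spec[OF assms(2)] by argo
qed

lemma finsum_closed_under:
  assumes "finite F" "\<And>i. i \<in> F \<Longrightarrow> c i \<in> carrier M" "\<And>i. i \<in> F \<Longrightarrow> P (c i)" "P \<zero>"
    and add: "\<And>x y. x \<in> carrier M \<Longrightarrow> y \<in> carrier M \<Longrightarrow> P x \<Longrightarrow> P y \<Longrightarrow> P (x \<oplus> y)"
  shows "P (finsum M c F)"
  using assms(1-3)
proof (induction F)
  case (insert i F)
  then have "c \<in> F \<rightarrow> carrier M" by auto
  then show ?case using insert add by simp
qed (use assms(4) in simp)

text \<open>An element is the finite sum of its components, so properties stable under addition are
  decided on homogeneous elements.\<close>

lemma component_induct [consumes 1, case_names zero summand add]: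
  assumes x: "x \<in> carrier M"
    and zero: "P \<zero>"
    and P: "\<And>i x. i \<in> I \<Longrightarrow> x \<in> C i \<Longrightarrow> P x"
    and add: "\<And>x y. x \<in> carrier M \<Longrightarrow> y \<in> carrier M \<Longrightarrow> P x \<Longrightarrow> P y \<Longrightarrow> P (x \<oplus> y)"
  shows "P x"
proof -
  have "P (finsum M (cmp x) (support x))"
    by (rule finsum_closed_under[where P = P])
      (use x finite_support zero add in \<open>auto intro: component_carrier P component_in\<close>)
  then show ?thesis using component_spec[OF x] by simp
qed

text \<open>The universal property of the direct sum. Maps known only on homogeneous elements,
  typically through values chosen from a graph, become additive maps on the whole group
  here.\<close>

lemma extend_from_summands:
  assumes N: "abelian_group N"
    and closed: "\<And>i x. i \<in> I \<Longrightarrow> x \<in> C i \<Longrightarrow> \<psi> i x \<in> carrier N"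
    and additive: "\<And>i x y. i \<in> I \<Longrightarrow> x \<in> C i \<Longrightarrow> y \<in> C i \<Longrightarrow> \<psi> i (x \<oplus> y) = \<psi> i x \<oplus>\<^bsub>N\<^esub> \<psi> i y"
  obtains f where "f \<in> carrier M \<rightarrow> carrier N"
    and "\<And>x y. x \<in> carrier M \<Longrightarrow> y \<in> carrier M \<Longrightarrow> f (x \<oplus> y) = f x \<oplus>\<^bsub>N\<^esub> f y"
    and "\<And>i x. i \<in> I \<Longrightarrow> x \<in> C i \<Longrightarrow> f x = \<psi> i x"
proof -
  interpret N: abelian_group N by (rule N)
  define f where "f x = finsum N (\<lambda>i. \<psi> i (cmp x i)) (support x)" for x
  have \<psi>0: "\<psi> i \<zero> = \<zero>\<^bsub>N\<^esub>" if "i \<in> I" for i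
    using additive[of i \<zero> \<zero>] closed[of i \<zero>] summand_zero[of i] that
    by (metis N.add.r_cancel_one' add.one_closed add.r_one)
  have \<psi>c: "\<psi> i (cmp x i) \<in> carrier N" if "x \<in> carrier M" "i \<in> I" for x i
    using that closed component_in by blast
  \<comment> \<open>The sum may run over any finite set containing the support, since every
    \<open>\<psi> i\<close> vanishes at zero; \<open>x\<close>, \<open>y\<close> and
    \<open>x \<oplus> y\<close> then share one index set.\<close>
  have f: "f x = finsum N (\<lambda>i. \<psi> i (cmp x i)) F"
    if "x \<in> carrier M" "finite F" "support x \<subseteq> F" "F \<subseteq> I" for x F
    unfolding f_def
    using that \<psi>0 \<psi>c by (intro N.add.finprod_mono_neutral_cong_left) auto
  show thesis
  proof
    show "f \<in> carrier M \<rightarrow> carrier N"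
      using \<psi>c by (auto simp: f_def intro!: N.finsum_closed)
    fix x y assume xy: "x \<in> carrier M" "y \<in> carrier M"
    let ?F = "support x \<union> support y"
    have F: "finite ?F" "?F \<subseteq> I" "support x \<subseteq> ?F" "support y \<subseteq> ?F" using xy finite_support by auto
    have "support (x \<oplus> y) \<subseteq> ?F" using xy component_add by auto
    then have "f (x \<oplus> y) = finsum N (\<lambda>i. \<psi> i (cmp (x \<oplus> y) i)) ?F"
      using F xy by (intro f) auto
    also have "\<dots> = finsum N (\<lambda>i. \<psi> i (cmp x i) \<oplus>\<^bsub>N\<^esub> \<psi> i (cmp y i)) ?F"
      using F xy \<psi>c by (intro N.finsum_cong') (auto simp: component_add additive component_in)
    also have "\<dots> = finsum N (\<lambda>i. \<psi> i (cmp x i)) ?F \<oplus>\<^bsub>N\<^esub> finsum N (\<lambda>i. \<psi> i (cmp y i)) ?F"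
      using F xy \<psi>c by (intro N.finsum_addf) auto
    also have "\<dots> = f x \<oplus>\<^bsub>N\<^esub> f y"
      by (simp only: f[OF xy(1) F(1,3,2)] f[OF xy(2) F(1,4,2)])
    finally show "f (x \<oplus> y) = f x \<oplus>\<^bsub>N\<^esub> f y" .
  next
    fix i x assume i: "i \<in> I" "x \<in> C i"
    have "support x \<subseteq> {i}" using i by (auto simp: component_summand split: if_splits)
    then have "f x = finsum N (\<lambda>i. \<psi> i (cmp x i)) {i}"
      using i summand_carrier by (intro f) auto
    also have "\<dots> = \<psi> i (cmp x i)"
      using i \<psi>c summand_carrier by simp
    finally show "f x = \<psi> i x" using i component_summand by simp
  qed
qed

end

section \<open>Homogeneous ideals\<close>

text \<open>Reversing the product of a graded ring turns the degree \<open>g h\<close> into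
  \<open>h g\<close>, so the group has to be reversed along with the ring. Right-sided statements
  are then left-sided ones for the opposite pair.\<close>

definition op_group :: "('g, 'x) monoid_scheme \<Rightarrow> ('g, 'x) monoid_scheme" where
  "op_group G = G\<lparr>mult := \<lambda>x y. y \<otimes>\<^bsub>G\<^esub> x\<rparr>"

definition op_ring :: "('r, 'y) ring_scheme \<Rightarrow> ('r, 'y) ring_scheme" where
  "op_ring R = R\<lparr>mult := \<lambda>x y. y \<otimes>\<^bsub>R\<^esub> x\<rparr>"

lemma op_group_simps [simp]:
  "carrier (op_group G) = carrier G" "x \<otimes>\<^bsub>op_group G\<^esub> y = y \<otimes>\<^bsub>G\<^esub> x" "\<one>\<^bsub>op_group G\<^esub> = \<one>\<^bsub>G\<^esub>"
  by (simp_all add: op_group_def)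

lemma op_ring_simps [simp]:
  "carrier (op_ring R) = carrier R" "x \<otimes>\<^bsub>op_ring R\<^esub> y = y \<otimes>\<^bsub>R\<^esub> x" "\<one>\<^bsub>op_ring R\<^esub> = \<one>\<^bsub>R\<^esub>"
  "\<zero>\<^bsub>op_ring R\<^esub> = \<zero>\<^bsub>R\<^esub>" "add (op_ring R) = add R"
  by (simp_all add: op_ring_def)

lemma op_ring_additive [simp]:
  "finsum (op_ring R) = finsum R" "a_inv (op_ring R) = a_inv R"
  by (simp_all add: fun_eq_iff finsum_def a_inv_def)

lemma additive_subgroup_op [simp]: "additive_subgroup H (op_ring R) \<longleftrightarrow> additive_subgroup H R"
  by (simp add: additive_subgroup_def)

lemma component_op [simp]: "component I (op_ring R) C = component I R C"
  by (simp add: fun_eq_iff component_def)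

lemma homogeneous_op [simp]: "homogeneous (op_group G) \<R> = homogeneous G \<R>"
  by (simp add: homogeneous_def)

lemma group_op: "group G \<Longrightarrow> group (op_group G)"
proof (rule groupI)
  fix x assume "group G" "x \<in> carrier (op_group G)"
  then show "\<exists>y\<in>carrier (op_group G). y \<otimes>\<^bsub>op_group G\<^esub> x = \<one>\<^bsub>op_group G\<^esub>"
    by (intro bexI[of _ "inv\<^bsub>G\<^esub> x"]) (simp_all add: group.r_inv)
qed (simp_all add: group_def monoid.m_closed monoid.one_closed monoid.m_assoc monoid.r_one)

lemma ring_op: "ring R \<Longrightarrow> ring (op_ring R)"
proof -
  assume "ring R"
  then interpret ring R .
  show ?thesis
  proof (rule ringI)
    show "abelian_group (op_ring R)"
      by (rule abelian_groupI) (auto simp: a_ac intro: l_neg)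
    show "monoid (op_ring R)" by (rule monoidI) (auto simp: m_assoc)
  qed (auto simp: l_distr r_distr)
qed

text \<open>A graded ideal is encoded by the set of pairs of a degree and a homogeneous element of
  that degree in the ideal. The zero element occurs in every degree.\<close>

definition hleft ::
    "('g, 'x) monoid_scheme \<Rightarrow> ('r, 'y) ring_scheme \<Rightarrow> ('g \<Rightarrow> 'r set) \<Rightarrow> ('g \<times> 'r) set \<Rightarrow> bool" where
  "hleft G R \<R> U \<longleftrightarrow> U \<subseteq> Sigma (carrier G) \<R> \<and> (\<forall>g\<in>carrier G. (g, \<zero>\<^bsub>R\<^esub>) \<in> U) \<and>
     (\<forall>g x y. (g, x) \<in> U \<longrightarrow> (g, y) \<in> U \<longrightarrow> (g, x \<oplus>\<^bsub>R\<^esub> y) \<in> U) \<and>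
     (\<forall>h\<in>carrier G. \<forall>r\<in>\<R> h. \<forall>g x. (g, x) \<in> U \<longrightarrow> (h \<otimes>\<^bsub>G\<^esub> g, r \<otimes>\<^bsub>R\<^esub> x) \<in> U)"

text \<open>Taken from the opposite pair, so that facts about \<open>hleft\<close> have right-handed
  versions without a second proof.\<close>

definition hright ::
    "('g, 'x) monoid_scheme \<Rightarrow> ('r, 'y) ring_scheme \<Rightarrow> ('g \<Rightarrow> 'r set) \<Rightarrow> ('g \<times> 'r) set \<Rightarrow> bool" where
  "hright G R \<R> U \<longleftrightarrow> hleft (op_group G) (op_ring R) \<R> U"

lemma hright_iff:
  "hright G R \<R> U \<longleftrightarrow> U \<subseteq> Sigma (carrier G) \<R> \<and> (\<forall>g\<in>carrier G. (g, \<zero>\<^bsub>R\<^esub>) \<in> U) \<and>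
     (\<forall>g x y. (g, x) \<in> U \<longrightarrow> (g, y) \<in> U \<longrightarrow> (g, x \<oplus>\<^bsub>R\<^esub> y) \<in> U) \<and>
     (\<forall>h\<in>carrier G. \<forall>r\<in>\<R> h. \<forall>g x. (g, x) \<in> U \<longrightarrow> (g \<otimes>\<^bsub>G\<^esub> h, x \<otimes>\<^bsub>R\<^esub> r) \<in> U)"
  by (simp add: hright_def hleft_def)

definition hann_l ::
    "('g, 'x) monoid_scheme \<Rightarrow> ('r, 'y) ring_scheme \<Rightarrow> ('g \<Rightarrow> 'r set) \<Rightarrow> ('g \<times> 'r) set \<Rightarrow> ('g \<times> 'r) set" where
  "hann_l G R \<R> X = {(h, r) \<in> Sigma (carrier G) \<R>. \<forall>(g, x)\<in>X. r \<otimes>\<^bsub>R\<^esub> x = \<zero>\<^bsub>R\<^esub>}"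

definition hann_r ::
    "('g, 'x) monoid_scheme \<Rightarrow> ('r, 'y) ring_scheme \<Rightarrow> ('g \<Rightarrow> 'r set) \<Rightarrow> ('g \<times> 'r) set \<Rightarrow> ('g \<times> 'r) set" where
  "hann_r G R \<R> X = {(h, r) \<in> Sigma (carrier G) \<R>. \<forall>(g, x)\<in>X. x \<otimes>\<^bsub>R\<^esub> r = \<zero>\<^bsub>R\<^esub>}"

text \<open>The subset of the ring encoded by \<open>U\<close>. Membership is tested on components
  instead of forming sums, so the formula is the same for left and right ideals.\<close>

definition gspan ::
    "('g, 'x) monoid_scheme \<Rightarrow> ('r, 'y) ring_scheme \<Rightarrow> ('g \<Rightarrow> 'r set) \<Rightarrow> ('g \<times> 'r) set \<Rightarrow> 'r set" where
  "gspan G R \<R> U = {x \<in> carrier R. \<forall>g\<in>carrier G. (g, component (carrier G) R \<R> x g) \<in> U}"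

lemma gspan_op [simp]: "gspan (op_group G) (op_ring R) \<R> = gspan G R \<R>"
  by (simp add: gspan_def fun_eq_iff)

lemma hann_op [simp]:
  "hann_l (op_group G) (op_ring R) \<R> = hann_r G R \<R>" "hann_r (op_group G) (op_ring R) \<R> = hann_l G R \<R>"
  by (simp_all add: hann_l_def hann_r_def fun_eq_iff)

sublocale graded_ring \<subseteq> dec: decomposed_group R "carrier G" \<R>
  by unfold_locales (rule ring_decomposition)

context graded_ring
begin

abbreviation rmult (infixl "\<cdot>" 70) where "x \<cdot> y \<equiv> x \<otimes>\<^bsub>R\<^esub> y"
abbreviation radd (infixl "\<boxplus>" 65) where "x \<boxplus> y \<equiv> x \<oplus>\<^bsub>R\<^esub> y"
abbreviation rminus (infixl "\<boxminus>" 65) where "x \<boxminus> y \<equiv> x \<ominus>\<^bsub>R\<^esub> y"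
abbreviation E where "E \<equiv> Sigma (carrier G) \<R>"
abbreviation lid where "lid \<equiv> hleft G R \<R>"
abbreviation rid where "rid \<equiv> hright G R \<R>"
abbreviation annl where "annl \<equiv> hann_l G R \<R>"
abbreviation annr where "annr \<equiv> hann_r G R \<R>"
abbreviation span where "span \<equiv> gspan G R \<R>"

lemma graded_ring_op: "graded_ring (op_group G) (op_ring R) \<R>"
proof (intro graded_ring.intro graded_ring_axioms.intro)
  show "internal_direct_sum (carrier (op_group G)) (op_ring R) \<R>"
    using ring_decomposition by (simp add: internal_direct_sum_def)
qed (auto simp: mult_degree intro: group_op ring_op G.group_axioms R.ring_axioms)

lemma deg_minus: "g \<in> carrier G \<Longrightarrow> x \<in> \<R> g \<Longrightarrow> y \<in> \<R> g \<Longrightarrow> x \<boxminus> y \<in> \<R> g"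
  by (simp add: R.minus_eq dec.summand_add dec.summand_neg)

text \<open>Both sides are additive in \<open>x\<close>; for homogeneous \<open>x\<close> the claim
  is that left translation by \<open>h\<close> is injective on degrees.\<close>

lemma component_mult_left:
  assumes "h \<in> carrier G" "a \<in> \<R> h" "g \<in> carrier G" "x \<in> carrier R"
  shows "dec.cmp (a \<cdot> x) (h \<otimes> g) = a \<cdot> dec.cmp x g"
  using assms(4)
proof (induction x rule: dec.component_induct)
  case zero
  then show ?case using assms by (simp add: dec.component_zero dec.summand_carrier)
next
  case (summand k x)
  then have "a \<cdot> x \<in> \<R> (h \<otimes> k)" using assms mult_degree by blast
  then show ?case
    using assms summand dec.component_summand[of k x g] dec.component_summand[of "h \<otimes> k" "a \<cdot> x" "h \<otimes> g"]
    by (auto simp: dec.summand_carrier)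
next
  case (add x y)
  then show ?case
    using assms by (simp add: R.r_distr dec.component_add dec.component_carrier dec.summand_carrier)
qed

lemma component_mult_right:
  assumes "h \<in> carrier G" "a \<in> \<R> h" "g \<in> carrier G" "x \<in> carrier R"
  shows "dec.cmp (x \<cdot> a) (g \<otimes> h) = dec.cmp x g \<cdot> a"
proof -
  interpret op: graded_ring "op_group G" "op_ring R" \<R> by (rule graded_ring_op)
  show ?thesis using op.component_mult_left[of h a g x] assms by simp
qed

text \<open>Let \<open>u\<close> be the component of 1 in the neutral degree. For \<open>x\<close>
  of degree \<open>h\<close>, comparing components of degree \<open>h\<close> in
  \<open>1 x = x\<close> gives \<open>u x = x\<close>, so \<open>u\<close> is a left identity and
  equals 1.\<close>

lemma deg_one: "\<one>\<^bsub>R\<^esub> \<in> \<R> \<one>"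
proof -
  let ?u = "dec.cmp \<one>\<^bsub>R\<^esub> \<one>"
  have u: "?u \<in> carrier R" by (simp add: dec.component_carrier)
  have "?u \<cdot> x = x" if "x \<in> carrier R" for x
    using that
  proof (induction x rule: dec.component_induct)
    case (summand h x)
    then show ?case
      using component_mult_right[of h x \<one> "\<one>\<^bsub>R\<^esub>"] dec.component_summand[of h x h]
      by (simp add: dec.summand_carrier)
  qed (use u in \<open>simp_all add: R.r_distr\<close>)
  from this[of "\<one>\<^bsub>R\<^esub>"] have "?u = \<one>\<^bsub>R\<^esub>" using u by simp
  then show ?thesis using dec.component_in[of "\<one>\<^bsub>R\<^esub>" \<one>] by simp
qed

lemma lidI:
  assumes "\<And>g x. (g, x) \<in> U \<Longrightarrow> g \<in> carrier G \<and> x \<in> \<R> g" "\<And>g. g \<in> carrier G \<Longrightarrow> (g, \<zero>\<^bsub>R\<^esub>) \<in> U"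
    "\<And>g x y. (g, x) \<in> U \<Longrightarrow> (g, y) \<in> U \<Longrightarrow> (g, x \<boxplus> y) \<in> U"
    "\<And>h r g x. h \<in> carrier G \<Longrightarrow> r \<in> \<R> h \<Longrightarrow> (g, x) \<in> U \<Longrightarrow> (h \<otimes> g, r \<cdot> x) \<in> U"
  shows "lid U"
  unfolding hleft_def
proof (intro conjI allI impI ballI)
  show "U \<subseteq> E" using assms(1) by auto
qed (use assms(2-4) in simp_all)

lemma ridI:
  assumes "\<And>g x. (g, x) \<in> U \<Longrightarrow> g \<in> carrier G \<and> x \<in> \<R> g" "\<And>g. g \<in> carrier G \<Longrightarrow> (g, \<zero>\<^bsub>R\<^esub>) \<in> U"
    "\<And>g x y. (g, x) \<in> U \<Longrightarrow> (g, y) \<in> U \<Longrightarrow> (g, x \<boxplus> y) \<in> U"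
    "\<And>h r g x. h \<in> carrier G \<Longrightarrow> r \<in> \<R> h \<Longrightarrow> (g, x) \<in> U \<Longrightarrow> (g \<otimes> h, x \<cdot> r) \<in> U"
  shows "rid U"
  unfolding hright_iff
proof (intro conjI allI impI ballI)
  show "U \<subseteq> E" using assms(1) by auto
qed (use assms(2-4) in simp_all)

lemma lidD:
  assumes "lid U"
  shows lid_deg: "(g, x) \<in> U \<Longrightarrow> g \<in> carrier G" "(g, x) \<in> U \<Longrightarrow> x \<in> \<R> g"
    and lid_zero: "g \<in> carrier G \<Longrightarrow> (g, \<zero>\<^bsub>R\<^esub>) \<in> U"
    and lid_add: "(g, x) \<in> U \<Longrightarrow> (g, y) \<in> U \<Longrightarrow> (g, x \<boxplus> y) \<in> U"
    and lid_mult: "h \<in> carrier G \<Longrightarrow> r \<in> \<R> h \<Longrightarrow> (g, x) \<in> U \<Longrightarrow> (h \<otimes> g, r \<cdot> x) \<in> U"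
  using assms unfolding hleft_def by blast+

lemma ridD:
  assumes "rid U"
  shows rid_deg: "(g, x) \<in> U \<Longrightarrow> g \<in> carrier G" "(g, x) \<in> U \<Longrightarrow> x \<in> \<R> g"
    and rid_zero: "g \<in> carrier G \<Longrightarrow> (g, \<zero>\<^bsub>R\<^esub>) \<in> U"
    and rid_add: "(g, x) \<in> U \<Longrightarrow> (g, y) \<in> U \<Longrightarrow> (g, x \<boxplus> y) \<in> U"
    and rid_mult: "h \<in> carrier G \<Longrightarrow> r \<in> \<R> h \<Longrightarrow> (g, x) \<in> U \<Longrightarrow> (g \<otimes> h, x \<cdot> r) \<in> U"
  using assms unfolding hright_iff by blast+

lemma lid_neg: "lid U \<Longrightarrow> (g, x) \<in> U \<Longrightarrow> (g, \<ominus>\<^bsub>R\<^esub> x) \<in> U"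
  using lid_mult[of U \<one> "\<ominus>\<^bsub>R\<^esub> \<one>\<^bsub>R\<^esub>" g x] lid_deg[of U g x] deg_one
  by (simp add: dec.summand_neg R.l_minus dec.summand_carrier)

lemma lid_minus: "lid U \<Longrightarrow> (g, x) \<in> U \<Longrightarrow> (g, y) \<in> U \<Longrightarrow> (g, x \<boxminus> y) \<in> U"
  by (simp add: R.minus_eq lid_add lid_neg)

lemma span_carrier: "x \<in> span U \<Longrightarrow> x \<in> carrier R"
  by (simp add: gspan_def)

lemma span_homogeneous:
  assumes "lid U" "g \<in> carrier G" "x \<in> \<R> g"
  shows "x \<in> span U \<longleftrightarrow> (g, x) \<in> U"
  using assms
  by (auto simp: gspan_def dec.component_summand dec.summand_carrier lid_zero split: if_splits)

lemma span_add: "lid U \<Longrightarrow> x \<in> span U \<Longrightarrow> y \<in> span U \<Longrightarrow> x \<boxplus> y \<in> span U"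
  by (simp add: gspan_def dec.component_add lid_add)

lemma span_zero: "lid U \<Longrightarrow> \<zero>\<^bsub>R\<^esub> \<in> span U"
  by (simp add: gspan_def dec.component_zero lid_zero)

lemma span_mult:
  assumes U: "lid U" and x: "x \<in> span U" and a: "a \<in> carrier R"
  shows "a \<cdot> x \<in> span U"
  using a
proof (induction a rule: dec.component_induct)
  case zero
  then show ?case using assms span_carrier by (simp add: span_zero)
next
  case (summand h a)
  have "(g, dec.cmp (a \<cdot> x) g) \<in> U" if g: "g \<in> carrier G" for g
  proof -
    \<comment> \<open>The component of \<open>a x\<close> in degree \<open>g\<close> is
      \<open>a\<close> times the component of \<open>x\<close> in degree
      \<open>inv h \<otimes> g\<close>.\<close>
    have "h \<otimes> (inv h \<otimes> g) = g" using g summand by (simp add: G.m_assoc[symmetric])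
    then have "dec.cmp (a \<cdot> x) g = a \<cdot> dec.cmp x (inv h \<otimes> g)"
      using component_mult_left[of h a "inv h \<otimes> g" x] summand g x span_carrier by simp
    moreover have "(h \<otimes> (inv h \<otimes> g), a \<cdot> dec.cmp x (inv h \<otimes> g)) \<in> U"
      using lid_mult[OF U] summand g x by (simp add: gspan_def)
    ultimately show ?thesis using \<open>h \<otimes> (inv h \<otimes> g) = g\<close> by simp
  qed
  then show ?case using summand x by (simp add: gspan_def dec.summand_carrier)
next
  case (add a b)
  then show ?case using x by (simp add: R.l_distr span_add[OF U] span_carrier)
qed

lemma left_ideal_span: "lid U \<Longrightarrow> left_ideal (span U) R"
proof (intro left_ideal.intro left_ideal_axioms.intro additive_subgroup.intro)
  assume U: "lid U"
  have neg: "\<ominus>\<^bsub>R\<^esub> x \<in> span U" if "x \<in> span U" for x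
    using span_mult[OF U that, of "\<ominus>\<^bsub>R\<^esub> \<one>\<^bsub>R\<^esub>"] span_carrier[OF that] by (simp add: R.l_minus)
  show "subgroup (span U) (add_monoid R)"
    by (rule subgroup.intro)
      (use U neg in \<open>auto simp: span_zero span_add span_carrier a_inv_def[symmetric]\<close>)
  show "a \<in> span U \<Longrightarrow> x \<in> carrier R \<Longrightarrow> x \<cdot> a \<in> span U" for a x
    using U by (rule span_mult)
qed (rule R.ring_axioms)

text \<open>Asks only for an additive subgroup, so that it also applies to
  \<open>{x. r x = 0}\<close> in the comparison of annihilators.\<close>

lemma span_least:
  assumes I: "additive_subgroup I R" and U: "\<And>g x. (g, x) \<in> U \<Longrightarrow> x \<in> I"
  shows "span U \<subseteq> I"
proof
  interpret additive_subgroup I R by (rule I)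
  fix x assume x: "x \<in> span U"
  have "finsum R (dec.cmp x) (dec.support x) \<in> I"
    by (rule dec.finsum_closed_under)
      (use x U in \<open>auto simp: gspan_def dec.finite_support dec.component_carrier\<close>)
  then show "x \<in> I" using dec.component_spec[OF span_carrier[OF x]] by simp
qed

lemma span_subset_iff: "lid U \<Longrightarrow> lid V \<Longrightarrow> span U \<subseteq> span V \<longleftrightarrow> U \<subseteq> V"
proof
  assume U: "lid U" and V: "lid V"
  show "U \<subseteq> V \<Longrightarrow> span U \<subseteq> span V" by (auto simp: gspan_def)
  assume sub: "span U \<subseteq> span V"
  show "U \<subseteq> V"
  proof clarify
    fix g x assume gx: "(g, x) \<in> U"
    with span_homogeneous[OF U] span_homogeneous[OF V] lid_deg[OF U gx] sub
    show "(g, x) \<in> V" by blast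
  qed
qed

lemma gen_left_ideal_span: "lid U \<Longrightarrow> gen_left_ideal R (snd ` U) = span U"
proof
  assume U: "lid U"
  have "snd ` U \<subseteq> span U" using span_homogeneous[OF U] lid_deg[OF U] by (metis image_subsetI prod.collapse)
  then show "gen_left_ideal R (snd ` U) \<subseteq> span U"
    using left_ideal_span[OF U] by (auto simp: gen_left_ideal_def)
  show "span U \<subseteq> gen_left_ideal R (snd ` U)"
    unfolding gen_left_ideal_def
  proof (intro Inter_greatest span_least)
    fix I assume "I \<in> {I. left_ideal I R \<and> snd ` U \<subseteq> I}"
    then show "additive_subgroup I R" "\<And>g x. (g, x) \<in> U \<Longrightarrow> x \<in> I"
      by (force simp: left_ideal_def)+
  qed
qed

lemma gen_left_ideal_left_ideal: "S \<subseteq> carrier R \<Longrightarrow> left_ideal (gen_left_ideal R S) R"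
proof (intro left_ideal.intro left_ideal_axioms.intro additive_subgroup.intro)
  assume S: "S \<subseteq> carrier R"
  have c: "left_ideal (carrier R) R"
    by (intro left_ideal.intro left_ideal_axioms.intro additive_subgroup.intro R.add.subgroup_self)
      (auto simp: R.ring_axioms)
  show "subgroup (gen_left_ideal R S) (add_monoid R)"
    unfolding gen_left_ideal_def
    by (rule R.add.subgroups_Inter)
      (use S c in \<open>auto simp: left_ideal_def additive_subgroup_def\<close>)
  show "a \<in> gen_left_ideal R S \<Longrightarrow> x \<in> carrier R \<Longrightarrow> x \<cdot> a \<in> gen_left_ideal R S" for a x
    by (auto simp: gen_left_ideal_def left_ideal.l_closed)
qed (rule R.ring_axioms)

lemma lid_homogeneous_part: "left_ideal I R \<Longrightarrow> lid {(g, x) \<in> E. x \<in> I}"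
proof (rule lidI)
  assume "left_ideal I R"
  then interpret left_ideal I R .
  show "g \<in> carrier G \<Longrightarrow> (g, \<zero>\<^bsub>R\<^esub>) \<in> {(g, x) \<in> E. x \<in> I}" for g by (simp add: dec.summand_zero)
  show "(h \<otimes> g, r \<cdot> x) \<in> {(g, x) \<in> E. x \<in> I}"
    if "h \<in> carrier G" "r \<in> \<R> h" "(g, x) \<in> {(g, x) \<in> E. x \<in> I}" for h r g x
    using that mult_degree by (auto simp: l_closed dec.summand_carrier)
qed (auto simp: dec.summand_add left_ideal_def additive_subgroup.a_closed)

text \<open>Homogeneous generators lie in the homogeneous part of the ideal they generate, so such
  an ideal is spanned by that part. This is the bridge from the definition by generators to the
  encoding.\<close>

theorem graded_left_ideals_span: "graded_left_ideals G R \<R> = span ` Collect lid"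
proof
  show "span ` Collect lid \<subseteq> graded_left_ideals G R \<R>"
  proof clarify
    fix U assume U: "lid U"
    then have "snd ` U \<subseteq> homogeneous G \<R>" using lid_deg[OF U] by (force simp: homogeneous_def)
    then show "span U \<in> graded_left_ideals G R \<R>"
      unfolding graded_left_ideals_def using gen_left_ideal_span[OF U] by blast
  qed
  show "graded_left_ideals G R \<R> \<subseteq> span ` Collect lid"
  proof
    fix I assume "I \<in> graded_left_ideals G R \<R>"
    then obtain S where S: "S \<subseteq> homogeneous G \<R>" and I: "I = gen_left_ideal R S"
      by (auto simp: graded_left_ideals_def)
    have Sc: "S \<subseteq> carrier R" using S dec.summand_carrier by (auto simp: homogeneous_def)
    define U where "U = {(g, x) \<in> E. x \<in> I}"
    have lI: "left_ideal I R" unfolding I by (rule gen_left_ideal_left_ideal[OF Sc])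
    have U: "lid U" unfolding U_def by (rule lid_homogeneous_part[OF lI])
    have "span U \<subseteq> I" by (rule span_least) (use lI in \<open>auto simp: left_ideal_def U_def\<close>)
    moreover have "S \<subseteq> span U"
    proof
      fix s assume s: "s \<in> S"
      then obtain g where g: "g \<in> carrier G" "s \<in> \<R> g" using S by (auto simp: homogeneous_def)
      have "s \<in> I" using s by (auto simp: I gen_left_ideal_def)
      then show "s \<in> span U" using span_homogeneous[OF U g] g by (simp add: U_def)
    qed
    then have "I \<subseteq> span U" using left_ideal_span[OF U] by (auto simp: I gen_left_ideal_def)
    ultimately show "I \<in> span ` Collect lid" using U by blast
  qed
qed

end

section \<open>Chain conditions and annihilators\<close>

text \<open>An order embedding is injective by antisymmetry, so chains and their stabilisation can
  be carried in both directions.\<close>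

lemma satisfies_ACC_image:
  assumes "\<And>X Y. X \<in> A \<Longrightarrow> Y \<in> A \<Longrightarrow> f X \<subseteq> f Y \<longleftrightarrow> X \<subseteq> Y"
  shows "satisfies_ACC (f ` A) \<longleftrightarrow> satisfies_ACC A"
proof
  have eq: "f X = f Y \<longleftrightarrow> X = Y" if "X \<in> A" "Y \<in> A" for X Y
    using assms[of X Y] assms[of Y X] that by auto
  show "satisfies_ACC A" if acc: "satisfies_ACC (f ` A)"
    unfolding satisfies_ACC_def
  proof (intro allI impI, elim conjE)
    fix I :: "nat \<Rightarrow> _" assume I: "\<forall>n. I n \<in> A" "\<forall>n. I n \<subseteq> I (Suc n)"
    then have "(\<forall>n. f (I n) \<in> f ` A) \<and> (\<forall>n. f (I n) \<subseteq> f (I (Suc n)))" using assms by auto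
    with acc[unfolded satisfies_ACC_def, rule_format, of "\<lambda>n. f (I n)"]
    obtain N where "\<forall>n\<ge>N. f (I n) = f (I N)" by auto
    then show "\<exists>N. \<forall>n\<ge>N. I n = I N" using eq I by blast
  qed
  show "satisfies_ACC (f ` A)" if acc: "satisfies_ACC A"
    unfolding satisfies_ACC_def
  proof (intro allI impI, elim conjE)
    fix J :: "nat \<Rightarrow> _" assume J: "\<forall>n. J n \<in> f ` A" "\<forall>n. J n \<subseteq> J (Suc n)"
    then obtain I where I: "\<forall>n. I n \<in> A \<and> J n = f (I n)" unfolding image_iff by metis
    then have "(\<forall>n. I n \<in> A) \<and> (\<forall>n. I n \<subseteq> I (Suc n))" using assms J by auto
    with acc[unfolded satisfies_ACC_def, rule_format, of I]
    show "\<exists>N. \<forall>n\<ge>N. J n = J N" using I by metis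
  qed
qed

text \<open>Complements reverse inclusion; facts about descending chains are read off from ascending
  ones.\<close>

lemma satisfies_DCC_iff_ACC: "satisfies_DCC A \<longleftrightarrow> satisfies_ACC (uminus ` A)"
proof
  show "satisfies_ACC (uminus ` A)" if dcc: "satisfies_DCC A"
    unfolding satisfies_ACC_def
  proof (intro allI impI, elim conjE)
    fix J :: "nat \<Rightarrow> 'a set" assume J: "\<forall>n. J n \<in> uminus ` A" "\<forall>n. J n \<subseteq> J (Suc n)"
    then have "(\<forall>n. - J n \<in> A) \<and> (\<forall>n. - J (Suc n) \<subseteq> - J n)" by (auto simp: image_iff) (metis double_complement)
    with dcc[unfolded satisfies_DCC_def, rule_format, of "\<lambda>n. - J n"]
    show "\<exists>N. \<forall>n\<ge>N. J n = J N" by auto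
  qed
  show "satisfies_DCC A" if acc: "satisfies_ACC (uminus ` A)"
    unfolding satisfies_DCC_def
  proof (intro allI impI, elim conjE)
    fix J :: "nat \<Rightarrow> 'a set" assume J: "\<forall>n. J n \<in> A" "\<forall>n. J (Suc n) \<subseteq> J n"
    then have "(\<forall>n. - J n \<in> uminus ` A) \<and> (\<forall>n. - J n \<subseteq> - J (Suc n))" by auto
    with acc[unfolded satisfies_ACC_def, rule_format, of "\<lambda>n. - J n"]
    show "\<exists>N. \<forall>n\<ge>N. J n = J N" by auto
  qed
qed

lemma satisfies_DCC_image:
  assumes "\<And>X Y. X \<in> A \<Longrightarrow> Y \<in> A \<Longrightarrow> f X \<subseteq> f Y \<longleftrightarrow> X \<subseteq> Y"
  shows "satisfies_DCC (f ` A) \<longleftrightarrow> satisfies_DCC A"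
proof -
  have "satisfies_ACC ((\<lambda>X. - f (- X)) ` uminus ` A) \<longleftrightarrow> satisfies_ACC (uminus ` A)"
  proof (rule satisfies_ACC_image)
    fix X Y assume "X \<in> uminus ` A" "Y \<in> uminus ` A"
    then show "- f (- X) \<subseteq> - f (- Y) \<longleftrightarrow> X \<subseteq> Y" using assms[of "- Y" "- X"] by auto
  qed
  then show ?thesis by (simp add: satisfies_DCC_iff_ACC image_image)
qed

text \<open>Meant for annihilator maps \<open>f\<close> and \<open>g\<close> under a double
  annihilator condition: a descending chain becomes an ascending chain of annihilators, from which
  \<open>g\<close> recovers it.\<close>

lemma ACC_imp_DCC:
  assumes acc: "satisfies_ACC B" and f: "\<And>X. X \<in> A \<Longrightarrow> f X \<in> B"
    and anti: "\<And>X Y. X \<in> A \<Longrightarrow> Y \<in> A \<Longrightarrow> X \<subseteq> Y \<Longrightarrow> f Y \<subseteq> f X" and g: "\<And>X. X \<in> A \<Longrightarrow> g (f X) = X"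
  shows "satisfies_DCC A"
  unfolding satisfies_DCC_def
proof (intro allI impI, elim conjE)
  fix I :: "nat \<Rightarrow> _" assume I: "\<forall>n. I n \<in> A" "\<forall>n. I (Suc n) \<subseteq> I n"
  then have "(\<forall>n. f (I n) \<in> B) \<and> (\<forall>n. f (I n) \<subseteq> f (I (Suc n)))" using f anti by blast
  with acc[unfolded satisfies_ACC_def, rule_format, of "\<lambda>n. f (I n)"]
  obtain N where "\<forall>n\<ge>N. f (I n) = f (I N)" by auto
  then show "\<exists>N. \<forall>n\<ge>N. I n = I N" using g I by metis
qed

lemma DCC_imp_ACC:
  assumes dcc: "satisfies_DCC B" and f: "\<And>X. X \<in> A \<Longrightarrow> f X \<in> B"
    and anti: "\<And>X Y. X \<in> A \<Longrightarrow> Y \<in> A \<Longrightarrow> X \<subseteq> Y \<Longrightarrow> f Y \<subseteq> f X" and g: "\<And>X. X \<in> A \<Longrightarrow> g (f X) = X"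
  shows "satisfies_ACC A"
  unfolding satisfies_ACC_def
proof (intro allI impI, elim conjE)
  fix I :: "nat \<Rightarrow> _" assume I: "\<forall>n. I n \<in> A" "\<forall>n. I n \<subseteq> I (Suc n)"
  then have "(\<forall>n. f (I n) \<in> B) \<and> (\<forall>n. f (I (Suc n)) \<subseteq> f (I n))" using f anti by blast
  with dcc[unfolded satisfies_DCC_def, rule_format, of "\<lambda>n. f (I n)"]
  obtain N where "\<forall>n\<ge>N. f (I n) = f (I N)" by auto
  then show "\<exists>N. \<forall>n\<ge>N. I n = I N" using g I by metis
qed

text \<open>Without a maximal element above \<open>A\<close>, dependent choice would give a strictly
  ascending chain. A predicate is used because the families below record extra data, such as an
  element with a given annihilator.\<close>

lemma ACC_maximal:
  assumes acc: "satisfies_ACC F" and P: "\<And>X. P X \<Longrightarrow> X \<in> F" "P A"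
  shows "\<exists>M. P M \<and> A \<subseteq> M \<and> (\<forall>B. P B \<longrightarrow> M \<subseteq> B \<longrightarrow> B = M)"
proof (rule ccontr)
  assume none: "\<not> ?thesis"
  have step: "\<exists>B. (P B \<and> A \<subseteq> B) \<and> M \<subset> B" if "P M \<and> A \<subseteq> M" for M
    using none that by (metis psubsetI subset_trans)
  have "\<exists>I. \<forall>n. (P (I n) \<and> A \<subseteq> I n) \<and> I n \<subset> I (Suc n)"
  proof (rule dependent_nat_choice)
    show "\<exists>M. P M \<and> A \<subseteq> M" using P(2) by blast
    show "\<exists>B. (P B \<and> A \<subseteq> B) \<and> M \<subset> B" if "P M \<and> A \<subseteq> M" for M using step[OF that] .
  qed
  then obtain I where "\<forall>n::nat. P (I n) \<and> A \<subseteq> I n" and I: "\<forall>n. I n \<subset> I (Suc n)" by blast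
  then have "(\<forall>n. I n \<in> F) \<and> (\<forall>n. I n \<subseteq> I (Suc n))" using P(1) by blast
  with acc[unfolded satisfies_ACC_def, rule_format, of I]
  obtain N where "\<forall>n\<ge>N. I n = I N" by blast
  then have "I (Suc N) = I N" by (blast intro: le_SucI)
  then show False using I by blast
qed

lemma DCC_minimal:
  assumes dcc: "satisfies_DCC F" and P: "\<And>X. P X \<Longrightarrow> X \<in> F" "P A"
  shows "\<exists>M. P M \<and> M \<subseteq> A \<and> (\<forall>B. P B \<longrightarrow> B \<subseteq> M \<longrightarrow> B = M)"
proof -
  have "\<exists>M. P (- M) \<and> - A \<subseteq> M \<and> (\<forall>B. P (- B) \<longrightarrow> M \<subseteq> B \<longrightarrow> B = M)"
  proof (rule ACC_maximal[OF dcc[unfolded satisfies_DCC_iff_ACC]])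
    show "P (- X) \<Longrightarrow> X \<in> uminus ` F" for X using P(1) by (metis double_complement imageI)
  qed (use P(2) in simp)
  then obtain M where M: "P (- M)" "- A \<subseteq> M" "\<forall>B. P (- B) \<longrightarrow> M \<subseteq> B \<longrightarrow> B = M" by blast
  have "B = - M" if "P B" "B \<subseteq> - M" for B using M(3)[rule_format, of "- B"] that by auto
  then show ?thesis using M by (intro exI[of _ "- M"]) auto
qed

section \<open>Sums and principal graded ideals\<close>

definition hsum :: "('r, 'y) ring_scheme \<Rightarrow> ('g \<times> 'r) set \<Rightarrow> ('g \<times> 'r) set \<Rightarrow> ('g \<times> 'r) set" where
  "hsum R U V = {(g, u \<oplus>\<^bsub>R\<^esub> v) | g u v. (g, u) \<in> U \<and> (g, v) \<in> V}"

text \<open>Already closed under addition: by cancellation in the group, two multiples of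
  \<open>a\<close> in the same degree have cofactors of the same degree, which can be added.\<close>

definition hleft_gen ::
    "('g, 'x) monoid_scheme \<Rightarrow> ('r, 'y) ring_scheme \<Rightarrow> ('g \<Rightarrow> 'r set) \<Rightarrow> 'g \<Rightarrow> 'r \<Rightarrow> ('g \<times> 'r) set" where
  "hleft_gen G R \<R> k a = {(h \<otimes>\<^bsub>G\<^esub> k, r \<otimes>\<^bsub>R\<^esub> a) | h r. h \<in> carrier G \<and> r \<in> \<R> h}"

definition hright_gen ::
    "('g, 'x) monoid_scheme \<Rightarrow> ('r, 'y) ring_scheme \<Rightarrow> ('g \<Rightarrow> 'r set) \<Rightarrow> 'g \<Rightarrow> 'r \<Rightarrow> ('g \<times> 'r) set" where
  "hright_gen G R \<R> k a = {(k \<otimes>\<^bsub>G\<^esub> h, a \<otimes>\<^bsub>R\<^esub> r) | h r. h \<in> carrier G \<and> r \<in> \<R> h}"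

lemma hsum_op [simp]: "hsum (op_ring R) = hsum R"
  by (simp add: hsum_def fun_eq_iff)

lemma hleft_gen_op [simp]: "hleft_gen (op_group G) (op_ring R) \<R> = hright_gen G R \<R>"
  by (simp add: hleft_gen_def hright_gen_def fun_eq_iff)

lemma hright_op [simp]: "hright (op_group G) (op_ring R) \<R> = hleft G R \<R>"
  by (simp add: fun_eq_iff hright_iff hleft_def)

context graded_ring
begin

abbreviation hplus (infixl "\<boxplus>\<^sub>H" 65) where "U \<boxplus>\<^sub>H V \<equiv> hsum R U V"
abbreviation lgen where "lgen \<equiv> hleft_gen G R \<R>"
abbreviation rgen where "rgen \<equiv> hright_gen G R \<R>"
abbreviation hzero where "hzero \<equiv> carrier G \<times> {\<zero>\<^bsub>R\<^esub>}"

lemma span_homogeneous_right: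
  "rid U \<Longrightarrow> g \<in> carrier G \<Longrightarrow> x \<in> \<R> g \<Longrightarrow> x \<in> span U \<longleftrightarrow> (g, x) \<in> U"
  using graded_ring.span_homogeneous[OF graded_ring_op] by (simp add: hright_def)

lemma span_subset_iff_right: "rid U \<Longrightarrow> rid V \<Longrightarrow> span U \<subseteq> span V \<longleftrightarrow> U \<subseteq> V"
  using graded_ring.span_subset_iff[OF graded_ring_op] by (simp add: hright_def)

lemma gen_right_ideal_op: "gen_right_ideal R = gen_left_ideal (op_ring R)"
proof -
  have "right_ideal I R \<longleftrightarrow> left_ideal I (op_ring R)" for I
    using ring_op[OF R.ring_axioms] R.ring_axioms
    by (simp add: left_ideal_def right_ideal_def left_ideal_axioms_def right_ideal_axioms_def)
  then show ?thesis by (simp add: fun_eq_iff gen_right_ideal_def gen_left_ideal_def)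
qed

lemma graded_right_ideals_op:
  "graded_right_ideals G R \<R> = graded_left_ideals (op_group G) (op_ring R) \<R>"
  by (simp add: graded_right_ideals_def graded_left_ideals_def gen_right_ideal_op)

lemma graded_right_ideals_span: "graded_right_ideals G R \<R> = span ` Collect rid"
  using graded_ring.graded_left_ideals_span[OF graded_ring_op]
  by (simp add: graded_right_ideals_op hright_def[abs_def])

lemma graded_left_chain_conditions:
  "graded_left_Noetherian G R \<R> \<longleftrightarrow> satisfies_ACC (Collect lid)"
  "graded_left_Artinian G R \<R> \<longleftrightarrow> satisfies_DCC (Collect lid)"
  unfolding graded_left_Noetherian_def graded_left_Artinian_def graded_left_ideals_span
  by (rule satisfies_ACC_image satisfies_DCC_image; simp add: span_subset_iff)+

lemma graded_right_chain_conditions: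
  "graded_right_Noetherian G R \<R> \<longleftrightarrow> satisfies_ACC (Collect rid)"
  "graded_right_Artinian G R \<R> \<longleftrightarrow> satisfies_DCC (Collect rid)"
  unfolding graded_right_Noetherian_def graded_right_Artinian_def graded_right_ideals_span
  by (rule satisfies_ACC_image satisfies_DCC_image; simp add: span_subset_iff_right)+

section \<open>Annihilators of graded ideals\<close>

lemma annlI: "h \<in> carrier G \<Longrightarrow> r \<in> \<R> h \<Longrightarrow> (\<And>g x. (g, x) \<in> X \<Longrightarrow> r \<cdot> x = \<zero>\<^bsub>R\<^esub>) \<Longrightarrow> (h, r) \<in> annl X"
  by (auto simp: hann_l_def)

lemma annrI: "h \<in> carrier G \<Longrightarrow> r \<in> \<R> h \<Longrightarrow> (\<And>g x. (g, x) \<in> X \<Longrightarrow> x \<cdot> r = \<zero>\<^bsub>R\<^esub>) \<Longrightarrow> (h, r) \<in> annr X"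
  by (auto simp: hann_r_def)

lemma annlD: "(h, r) \<in> annl X \<Longrightarrow> (g, x) \<in> X \<Longrightarrow> r \<cdot> x = \<zero>\<^bsub>R\<^esub>"
  by (auto simp: hann_l_def)

lemma annrD: "(h, r) \<in> annr X \<Longrightarrow> (g, x) \<in> X \<Longrightarrow> x \<cdot> r = \<zero>\<^bsub>R\<^esub>"
  by (auto simp: hann_r_def)

lemma lid_annl:
  assumes "X \<subseteq> E"
  shows "lid (annl X)"
proof (rule lidI)
  have X: "x \<in> carrier R" if "(g, x) \<in> X" for g x using assms that dec.summand_carrier by blast
  show "(g, x) \<in> annl X \<Longrightarrow> g \<in> carrier G \<and> x \<in> \<R> g" for g x by (auto simp: hann_l_def)
  show "g \<in> carrier G \<Longrightarrow> (g, \<zero>\<^bsub>R\<^esub>) \<in> annl X" for g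
    using X by (intro annlI) (auto simp: dec.summand_zero)
  show "(g, x \<boxplus> y) \<in> annl X" if x: "(g, x) \<in> annl X" and y: "(g, y) \<in> annl X" for g x y
  proof (rule annlI)
    fix k z assume z: "(k, z) \<in> X"
    have "x \<in> carrier R" "y \<in> carrier R"
      using x y dec.summand_carrier by (auto simp: hann_l_def)
    then show "(x \<boxplus> y) \<cdot> z = \<zero>\<^bsub>R\<^esub>"
      using annlD[OF x z] annlD[OF y z] X[OF z] by (simp add: R.l_distr)
  qed (use x y dec.summand_add in \<open>auto simp: hann_l_def\<close>)
  show "(h \<otimes> g, r \<cdot> x) \<in> annl X" if "h \<in> carrier G" "r \<in> \<R> h" "(g, x) \<in> annl X" for h r g x
  proof (rule annlI)
    fix k y assume ky: "(k, y) \<in> X"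
    have "r \<cdot> x \<cdot> y = r \<cdot> (x \<cdot> y)"
      using that ky X by (intro R.m_assoc) (auto simp: hann_l_def dec.summand_carrier)
    then show "r \<cdot> x \<cdot> y = \<zero>\<^bsub>R\<^esub>"
      using annlD[OF that(3) ky] that by (simp add: dec.summand_carrier)
  qed (use that mult_degree in \<open>auto simp: hann_l_def\<close>)
qed

lemma rid_annl:
  assumes "lid X"
  shows "rid (annl X)"
proof (rule ridI)
  have XE: "X \<subseteq> E" using assms lid_deg by auto
  note l = lid_annl[OF XE]
  show "(g, x) \<in> annl X \<Longrightarrow> g \<in> carrier G \<and> x \<in> \<R> g" for g x using lid_deg[OF l] by blast
  show "(g \<otimes> h, x \<cdot> r) \<in> annl X" if "h \<in> carrier G" "r \<in> \<R> h" "(g, x) \<in> annl X" for h r g x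
  proof (rule annlI)
    fix k y assume ky: "(k, y) \<in> X"
    have "x \<cdot> r \<cdot> y = x \<cdot> (r \<cdot> y)"
      using that lid_deg[OF l that(3)] lid_deg[OF assms ky]
      by (intro R.m_assoc) (auto simp: dec.summand_carrier)
    then show "x \<cdot> r \<cdot> y = \<zero>\<^bsub>R\<^esub>"
      using annlD[OF that(3) lid_mult[OF assms that(1,2) ky]] by simp
  qed (use that lid_deg[OF l that(3)] mult_degree in auto)
  show "g \<in> carrier G \<Longrightarrow> (g, \<zero>\<^bsub>R\<^esub>) \<in> annl X" for g by (rule lid_zero[OF l])
  show "(g, x) \<in> annl X \<Longrightarrow> (g, y) \<in> annl X \<Longrightarrow> (g, x \<boxplus> y) \<in> annl X" for g x y by (rule lid_add[OF l])
qed

lemma rid_annr: "X \<subseteq> E \<Longrightarrow> rid (annr X)"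
  using graded_ring.lid_annl[OF graded_ring_op, of X] by (simp add: hright_def)

lemma lid_annr: "rid X \<Longrightarrow> lid (annr X)"
  using graded_ring.rid_annl[OF graded_ring_op, of X] by (simp add: hright_def[symmetric])

lemma lid_subset: "lid U \<Longrightarrow> U \<subseteq> E"
  using lid_deg by auto

lemma rid_subset: "rid U \<Longrightarrow> U \<subseteq> E"
  using rid_deg by auto

lemma ann_antimono: "X \<subseteq> Y \<Longrightarrow> annl Y \<subseteq> annl X" "X \<subseteq> Y \<Longrightarrow> annr Y \<subseteq> annr X"
  by (auto simp: hann_l_def hann_r_def)

lemma ann_ann: "X \<subseteq> E \<Longrightarrow> X \<subseteq> annr (annl X)" "X \<subseteq> E \<Longrightarrow> X \<subseteq> annl (annr X)"
  by (auto simp: hann_l_def hann_r_def)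

text \<open>For homogeneous \<open>x\<close> the products of the components of \<open>r\<close> with
  \<open>x\<close> lie in different degrees, so \<open>r x = 0\<close> forces each of them to
  vanish. Hence the annihilator of a graded ideal is graded.\<close>

lemma ann_l_span:
  assumes X: "rid X"
  shows "ann_l R (span X) = span (annl X)"
proof -
  have Xc: "x \<in> carrier R" if "(g, x) \<in> X" for g x
    using rid_deg[OF X that] dec.summand_carrier by blast
  have "r \<in> ann_l R (span X) \<longleftrightarrow> r \<in> span (annl X)" if r: "r \<in> carrier R" for r
  proof -
    have "r \<in> ann_l R (span X) \<longleftrightarrow> (\<forall>(g, x)\<in>X. r \<cdot> x = \<zero>\<^bsub>R\<^esub>)"
    proof
      assume "r \<in> ann_l R (span X)"
      then show "\<forall>(g, x)\<in>X. r \<cdot> x = \<zero>\<^bsub>R\<^esub>"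
        using span_homogeneous_right[OF X] rid_deg[OF X] by (auto simp: ann_l_def) blast
    next
      assume *: "\<forall>(g, x)\<in>X. r \<cdot> x = \<zero>\<^bsub>R\<^esub>"
      have "span X \<subseteq> {x \<in> carrier R. r \<cdot> x = \<zero>\<^bsub>R\<^esub>}"
      proof (rule span_least)
        show "additive_subgroup {x \<in> carrier R. r \<cdot> x = \<zero>\<^bsub>R\<^esub>} R"
        proof (intro additive_subgroup.intro subgroup.intro)
          fix x assume "x \<in> {x \<in> carrier R. r \<cdot> x = \<zero>\<^bsub>R\<^esub>}"
          then show "inv\<^bsub>add_monoid R\<^esub> x \<in> {x \<in> carrier R. r \<cdot> x = \<zero>\<^bsub>R\<^esub>}"
            using r by (simp add: a_inv_def[symmetric] R.r_minus)
        qed (use r in \<open>auto simp: R.r_distr\<close>)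
      qed (use * Xc in auto)
      then show "r \<in> ann_l R (span X)" using r by (auto simp: ann_l_def)
    qed
    also have "\<dots> \<longleftrightarrow> (\<forall>h\<in>carrier G. \<forall>(g, x)\<in>X. dec.cmp r h \<cdot> x = \<zero>\<^bsub>R\<^esub>)"
    proof
      assume *: "\<forall>(g, x)\<in>X. r \<cdot> x = \<zero>\<^bsub>R\<^esub>"
      show "\<forall>h\<in>carrier G. \<forall>(g, x)\<in>X. dec.cmp r h \<cdot> x = \<zero>\<^bsub>R\<^esub>"
      proof clarify
        fix h g x assume h: "h \<in> carrier G" and gx: "(g, x) \<in> X"
        have "dec.cmp r h \<cdot> x = dec.cmp (r \<cdot> x) (h \<otimes> g)"
          using component_mult_right[of g x h r] h r rid_deg[OF X gx] by simp
        then show "dec.cmp r h \<cdot> x = \<zero>\<^bsub>R\<^esub>"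
          using * gx h rid_deg[OF X gx] by (auto simp: dec.component_zero)
      qed
    next
      assume *: "\<forall>h\<in>carrier G. \<forall>(g, x)\<in>X. dec.cmp r h \<cdot> x = \<zero>\<^bsub>R\<^esub>"
      show "\<forall>(g, x)\<in>X. r \<cdot> x = \<zero>\<^bsub>R\<^esub>"
      proof clarify
        fix g x assume gx: "(g, x) \<in> X"
        note d = rid_deg[OF X gx]
        show "r \<cdot> x = \<zero>\<^bsub>R\<^esub>"
        proof (rule dec.component_eqI)
          fix k assume k: "k \<in> carrier G"
          have "k \<otimes> inv g \<otimes> g = k" using d k by (simp add: G.m_assoc)
          then have "dec.cmp (r \<cdot> x) k = dec.cmp r (k \<otimes> inv g) \<cdot> x"
            using component_mult_right[of g x "k \<otimes> inv g" r] k d r by simp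
          then show "dec.cmp (r \<cdot> x) k = dec.cmp \<zero>\<^bsub>R\<^esub> k"
            using * k d gx by (auto simp: dec.component_zero)
        qed (use r Xc[OF gx] in auto)
      qed
    qed
    also have "\<dots> \<longleftrightarrow> r \<in> span (annl X)"
      using r dec.component_in[OF r] by (auto simp: gspan_def hann_l_def)
    finally show ?thesis .
  qed
  then show ?thesis by (auto simp: ann_l_def gspan_def)
qed

lemma ann_r_span: "lid X \<Longrightarrow> ann_r R (span X) = span (annr X)"
proof -
  assume "lid X"
  moreover have "ann_l (op_ring R) = ann_r R"
    by (simp add: fun_eq_iff ann_l_def ann_r_def)
  ultimately show ?thesis
    using graded_ring.ann_l_span[OF graded_ring_op, of X] by simp
qed

lemma double_annihilator_right_iff:
  "double_annihilator_right G R \<R> \<longleftrightarrow> (\<forall>A. rid A \<longrightarrow> annr (annl A) = A)"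
proof -
  have "ann_r R (ann_l R (span A)) = span A \<longleftrightarrow> annr (annl A) = A" if A: "rid A" for A
  proof -
    have l: "lid (annl A)" using A by (intro lid_annl rid_subset)
    then have "rid (annr (annl A))" by (intro rid_annr lid_subset)
    then have "span (annr (annl A)) = span A \<longleftrightarrow> annr (annl A) = A"
      using span_subset_iff_right A by auto
    then show ?thesis using A l by (simp add: ann_l_span ann_r_span)
  qed
  then show ?thesis by (auto simp: double_annihilator_right_def graded_right_ideals_span)
qed

lemma double_annihilator_left_iff:
  "double_annihilator_left G R \<R> \<longleftrightarrow> (\<forall>U. lid U \<longrightarrow> annl (annr U) = U)"
proof -
  have "ann_l R (ann_r R (span A)) = span A \<longleftrightarrow> annl (annr A) = A" if A: "lid A" for A
  proof -
    have r: "rid (annr A)" using A by (intro rid_annr lid_subset)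
    then have "lid (annl (annr A))" by (intro lid_annl rid_subset)
    then have "span (annl (annr A)) = span A \<longleftrightarrow> annl (annr A) = A"
      using span_subset_iff A by auto
    then show ?thesis using A r by (simp add: ann_l_span ann_r_span)
  qed
  then show ?thesis by (auto simp: double_annihilator_left_def graded_left_ideals_span)
qed

lemma lid_E: "lid E"
  by (rule lidI) (auto simp: dec.summand_zero dec.summand_add mult_degree)

lemma rid_E: "rid E"
  by (rule ridI) (auto simp: dec.summand_zero dec.summand_add mult_degree)

lemma lid_hzero: "lid hzero"
  by (rule lidI) (auto simp: dec.summand_zero dec.summand_carrier)

lemma rid_hzero: "rid hzero"
  by (rule ridI) (auto simp: dec.summand_zero dec.summand_carrier)

lemma lid_Int: "lid U \<Longrightarrow> lid V \<Longrightarrow> lid (U \<inter> V)"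
  by (rule lidI) (auto dest: lid_deg lid_zero lid_add lid_mult)

lemma rid_Int: "rid U \<Longrightarrow> rid V \<Longrightarrow> rid (U \<inter> V)"
  by (rule ridI) (auto dest: rid_deg rid_zero rid_add rid_mult)

lemma lid_eq_E: "lid U \<Longrightarrow> (\<one>, \<one>\<^bsub>R\<^esub>) \<in> U \<Longrightarrow> U = E"
proof -
  assume U: "lid U" and 1: "(\<one>, \<one>\<^bsub>R\<^esub>) \<in> U"
  have "(g, x) \<in> U" if "g \<in> carrier G" "x \<in> \<R> g" for g x
    using lid_mult[OF U that 1] that by (simp add: dec.summand_carrier)
  then show ?thesis using lid_subset[OF U] by auto
qed

lemma hsumI: "(g, u) \<in> U \<Longrightarrow> (g, v) \<in> V \<Longrightarrow> (g, u \<boxplus> v) \<in> U \<boxplus>\<^sub>H V"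
  by (auto simp: hsum_def)

lemma hsumE:
  assumes "(g, x) \<in> U \<boxplus>\<^sub>H V"
  obtains u v where "(g, u) \<in> U" "(g, v) \<in> V" "x = u \<boxplus> v"
  using assms by (auto simp: hsum_def)

lemma lid_hsum:
  assumes U: "lid U" and V: "lid V"
  shows "lid (U \<boxplus>\<^sub>H V)"
proof (rule lidI)
  note UV = U V
  have c: "x \<in> carrier R" if "(g, x) \<in> U \<or> (g, x) \<in> V" for g x
    using that lid_deg[OF U] lid_deg[OF V] dec.summand_carrier by metis
  show "(g, x) \<in> U \<boxplus>\<^sub>H V \<Longrightarrow> g \<in> carrier G \<and> x \<in> \<R> g" for g x
    using lid_deg[OF U] lid_deg[OF V] dec.summand_add by (metis hsumE)
  show "g \<in> carrier G \<Longrightarrow> (g, \<zero>\<^bsub>R\<^esub>) \<in> U \<boxplus>\<^sub>H V" for g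
    using hsumI[OF lid_zero[OF U, of g] lid_zero[OF V, of g]] by simp
  show "(g, x \<boxplus> y) \<in> U \<boxplus>\<^sub>H V" if x: "(g, x) \<in> U \<boxplus>\<^sub>H V" and y: "(g, y) \<in> U \<boxplus>\<^sub>H V" for g x y
  proof -
    obtain u v where uv: "(g, u) \<in> U" "(g, v) \<in> V" "x = u \<boxplus> v" using x by (rule hsumE)
    obtain u' v' where uv': "(g, u') \<in> U" "(g, v') \<in> V" "y = u' \<boxplus> v'" using y by (rule hsumE)
    have "x \<boxplus> y = (u \<boxplus> u') \<boxplus> (v \<boxplus> v')"
      using uv uv' c[of g] by (simp add: R.a_ac)
    then show ?thesis using hsumI[OF lid_add[OF U uv(1) uv'(1)] lid_add[OF V uv(2) uv'(2)]] by simp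
  qed
  show "(h \<otimes> g, r \<cdot> x) \<in> U \<boxplus>\<^sub>H V"
    if h: "h \<in> carrier G" "r \<in> \<R> h" and x: "(g, x) \<in> U \<boxplus>\<^sub>H V" for h r g x
  proof -
    obtain u v where uv: "(g, u) \<in> U" "(g, v) \<in> V" "x = u \<boxplus> v" using x by (rule hsumE)
    have "r \<cdot> x = r \<cdot> u \<boxplus> r \<cdot> v"
      using uv c[of g] h by (simp add: R.r_distr dec.summand_carrier)
    then show ?thesis using hsumI[OF lid_mult[OF U h uv(1)] lid_mult[OF V h uv(2)]] by simp
  qed
qed

lemma rid_hsum: "rid U \<Longrightarrow> rid V \<Longrightarrow> rid (U \<boxplus>\<^sub>H V)"
  using graded_ring.lid_hsum[OF graded_ring_op, of U V] by (simp add: hright_def)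

lemma lid_hsum_upper:
  assumes "lid U" "lid V"
  shows "U \<subseteq> U \<boxplus>\<^sub>H V" "V \<subseteq> U \<boxplus>\<^sub>H V"
proof -
  show "U \<subseteq> U \<boxplus>\<^sub>H V"
  proof clarify
    fix g x assume "(g, x) \<in> U"
    then show "(g, x) \<in> U \<boxplus>\<^sub>H V"
      using hsumI[of g x U "\<zero>\<^bsub>R\<^esub>" V] lid_zero[OF assms(2)] lid_deg[OF assms(1), of g x]
      by (simp add: dec.summand_carrier)
  qed
  show "V \<subseteq> U \<boxplus>\<^sub>H V"
  proof clarify
    fix g x assume "(g, x) \<in> V"
    then show "(g, x) \<in> U \<boxplus>\<^sub>H V"
      using hsumI[of g "\<zero>\<^bsub>R\<^esub>" U x V] lid_zero[OF assms(1)] lid_deg[OF assms(2), of g x]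
      by (simp add: dec.summand_carrier)
  qed
qed

lemma rid_hsum_upper: "rid U \<Longrightarrow> rid V \<Longrightarrow> U \<subseteq> U \<boxplus>\<^sub>H V" "rid U \<Longrightarrow> rid V \<Longrightarrow> V \<subseteq> U \<boxplus>\<^sub>H V"
  using graded_ring.lid_hsum_upper[OF graded_ring_op, of U V] by (simp_all add: hright_def)

lemma rid_hsum_least: "rid W \<Longrightarrow> U \<subseteq> W \<Longrightarrow> V \<subseteq> W \<Longrightarrow> U \<boxplus>\<^sub>H V \<subseteq> W"
  by (auto elim!: hsumE intro: rid_add)

lemma lgenI: "h \<in> carrier G \<Longrightarrow> r \<in> \<R> h \<Longrightarrow> (h \<otimes> k, r \<cdot> a) \<in> lgen k a"
  by (auto simp: hleft_gen_def)

lemma lgenE: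
  assumes "(g, x) \<in> lgen k a"
  obtains h r where "h \<in> carrier G" "r \<in> \<R> h" "g = h \<otimes> k" "x = r \<cdot> a"
  using assms by (auto simp: hleft_gen_def)

lemma rgenI: "h \<in> carrier G \<Longrightarrow> r \<in> \<R> h \<Longrightarrow> (k \<otimes> h, a \<cdot> r) \<in> rgen k a"
  by (auto simp: hright_gen_def)

lemma rgenE:
  assumes "(g, x) \<in> rgen k a"
  obtains h r where "h \<in> carrier G" "r \<in> \<R> h" "g = k \<otimes> h" "x = a \<cdot> r"
  using assms by (auto simp: hright_gen_def)

lemma lid_lgen:
  assumes k: "k \<in> carrier G" "a \<in> \<R> k"
  shows "lid (lgen k a)"
proof (rule lidI)
  have a: "a \<in> carrier R" using k dec.summand_carrier by blast
  show "(g, x) \<in> lgen k a \<Longrightarrow> g \<in> carrier G \<and> x \<in> \<R> g" for g x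
    using k mult_degree by (auto elim!: lgenE)
  show "(g, \<zero>\<^bsub>R\<^esub>) \<in> lgen k a" if "g \<in> carrier G" for g
    using lgenI[of "g \<otimes> inv k" "\<zero>\<^bsub>R\<^esub>" k a] k a that by (simp add: dec.summand_zero G.m_assoc)
  show "(g, x \<boxplus> y) \<in> lgen k a" if x: "(g, x) \<in> lgen k a" and y: "(g, y) \<in> lgen k a" for g x y
  proof -
    obtain h r where r: "h \<in> carrier G" "r \<in> \<R> h" "g = h \<otimes> k" "x = r \<cdot> a" using x by (rule lgenE)
    obtain h' r' where r': "h' \<in> carrier G" "r' \<in> \<R> h'" "g = h' \<otimes> k" "y = r' \<cdot> a"
      using y by (rule lgenE)
    have "h' = h" using r r' k by simp
    then have "r \<boxplus> r' \<in> \<R> h" "x \<boxplus> y = (r \<boxplus> r') \<cdot> a"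
      using r r' a by (simp_all add: dec.summand_add R.l_distr dec.summand_carrier)
    then show ?thesis using lgenI[of h "r \<boxplus> r'" k a] r by simp
  qed
  show "(h \<otimes> g, r \<cdot> x) \<in> lgen k a"
    if h: "h \<in> carrier G" "r \<in> \<R> h" and x: "(g, x) \<in> lgen k a" for h r g x
  proof -
    obtain h' r' where r': "h' \<in> carrier G" "r' \<in> \<R> h'" "g = h' \<otimes> k" "x = r' \<cdot> a"
      using x by (rule lgenE)
    have "(h \<otimes> h' \<otimes> k, r \<cdot> r' \<cdot> a) \<in> lgen k a" using h r' by (intro lgenI mult_degree) auto
    then show ?thesis using h r' k a by (simp add: G.m_assoc R.m_assoc dec.summand_carrier)
  qed
qed

lemma rid_rgen: "k \<in> carrier G \<Longrightarrow> a \<in> \<R> k \<Longrightarrow> rid (rgen k a)"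
  using graded_ring.lid_lgen[OF graded_ring_op, of k a] by (simp add: hright_def)

lemma lgen_self: "k \<in> carrier G \<Longrightarrow> a \<in> \<R> k \<Longrightarrow> (k, a) \<in> lgen k a"
  using lgenI[of \<one> "\<one>\<^bsub>R\<^esub>" k a] deg_one by (simp add: dec.summand_carrier)

lemma rgen_self: "k \<in> carrier G \<Longrightarrow> a \<in> \<R> k \<Longrightarrow> (k, a) \<in> rgen k a"
  using rgenI[of \<one> "\<one>\<^bsub>R\<^esub>" k a] deg_one by (simp add: dec.summand_carrier)

lemma rgen_least: "rid U \<Longrightarrow> (k, a) \<in> U \<Longrightarrow> rgen k a \<subseteq> U"
  by (auto elim!: rgenE intro: rid_mult)

text \<open>The annihilator of the class of \<open>a\<close> modulo \<open>U\<close>. It is proper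
  if \<open>a\<close> is outside \<open>U\<close>, which is how maximal left ideals will be
  obtained.\<close>

lemma lid_colon:
  assumes U: "lid U" and k: "k \<in> carrier G" "a \<in> \<R> k"
  shows "lid {(h, r) \<in> E. (h \<otimes> k, r \<cdot> a) \<in> U}"
proof (rule lidI)
  have a: "a \<in> carrier R" using k dec.summand_carrier by blast
  show "(g, \<zero>\<^bsub>R\<^esub>) \<in> {(h, r) \<in> E. (h \<otimes> k, r \<cdot> a) \<in> U}" if "g \<in> carrier G" for g
    using that k a lid_zero[OF U] by (simp add: dec.summand_zero)
  show "(g, x \<boxplus> y) \<in> {(h, r) \<in> E. (h \<otimes> k, r \<cdot> a) \<in> U}"
    if "(g, x) \<in> {(h, r) \<in> E. (h \<otimes> k, r \<cdot> a) \<in> U}" "(g, y) \<in> {(h, r) \<in> E. (h \<otimes> k, r \<cdot> a) \<in> U}"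
    for g x y
    using that lid_add[OF U, of "g \<otimes> k" "x \<cdot> a" "y \<cdot> a"] a
    by (auto simp: dec.summand_add R.l_distr dec.summand_carrier)
  show "(h \<otimes> g, r \<cdot> x) \<in> {(h, r) \<in> E. (h \<otimes> k, r \<cdot> a) \<in> U}"
    if "h \<in> carrier G" "r \<in> \<R> h" "(g, x) \<in> {(h, r) \<in> E. (h \<otimes> k, r \<cdot> a) \<in> U}" for h r g x
    using that lid_mult[OF U, of h r "g \<otimes> k" "x \<cdot> a"] a k mult_degree
    by (auto simp: G.m_assoc R.m_assoc dec.summand_carrier)
qed auto

end

section \<open>Self-injectivity in terms of homogeneous elements\<close>

text \<open>Graph of a homomorphism of degree \<open>d\<close> from a graded left ideal to the ring.\<close>

definition hlinear ::
    "('g, 'x) monoid_scheme \<Rightarrow> ('r, 'y) ring_scheme \<Rightarrow> ('g \<Rightarrow> 'r set) \<Rightarrow> 'g \<Rightarrow> ('g \<times> 'r \<times> 'r) set \<Rightarrow> bool" where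
  "hlinear G R \<R> d \<Gamma> \<longleftrightarrow>
     (\<forall>g x y. (g, x, y) \<in> \<Gamma> \<longrightarrow> g \<in> carrier G \<and> x \<in> \<R> g \<and> y \<in> \<R> (g \<otimes>\<^bsub>G\<^esub> d)) \<and>
     (\<forall>g\<in>carrier G. (g, \<zero>\<^bsub>R\<^esub>, \<zero>\<^bsub>R\<^esub>) \<in> \<Gamma>) \<and>
     (\<forall>g x y x' y'. (g, x, y) \<in> \<Gamma> \<longrightarrow> (g, x', y') \<in> \<Gamma> \<longrightarrow> (g, x \<oplus>\<^bsub>R\<^esub> x', y \<oplus>\<^bsub>R\<^esub> y') \<in> \<Gamma>) \<and>
     (\<forall>h\<in>carrier G. \<forall>r\<in>\<R> h. \<forall>g x y. (g, x, y) \<in> \<Gamma> \<longrightarrow> (h \<otimes>\<^bsub>G\<^esub> g, r \<otimes>\<^bsub>R\<^esub> x, r \<otimes>\<^bsub>R\<^esub> y) \<in> \<Gamma>) \<and>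
     (\<forall>g y. (g, \<zero>\<^bsub>R\<^esub>, y) \<in> \<Gamma> \<longrightarrow> y = \<zero>\<^bsub>R\<^esub>)"

definition baer :: "('g, 'x) monoid_scheme \<Rightarrow> ('r, 'y) ring_scheme \<Rightarrow> ('g \<Rightarrow> 'r set) \<Rightarrow> bool" where
  "baer G R \<R> \<longleftrightarrow>
     (\<forall>d\<in>carrier G. \<forall>\<Gamma>. hlinear G R \<R> d \<Gamma> \<longrightarrow> (\<exists>c\<in>\<R> d. \<forall>(g, x, y)\<in>\<Gamma>. y = x \<otimes>\<^bsub>R\<^esub> c))"

context graded_ring
begin

lemma deg_carrier: "x \<in> \<R> g \<Longrightarrow> g \<in> carrier G \<Longrightarrow> x \<in> carrier R"
  by (rule dec.summand_carrier)

text \<open>The assignment \<open>u + w a |-> w b\<close> on the left ideal \<open>U + W a\<close>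
  is well defined because of \<open>ker\<close>; it has degree \<open>inv k \<otimes> m\<close> and
  is therefore right multiplication by some \<open>c\<close>. With \<open>U\<close> zero this gives
  divisibility, with \<open>a = 1\<close> it separates two left ideals, and with \<open>W\<close>
  everything it sends an element outside \<open>U\<close> to a prescribed one.\<close>

lemma baer_extend:
  assumes baer: "baer G R \<R>" and U: "lid U" and W: "lid W"
    and k: "k \<in> carrier G" "a \<in> \<R> k" and m: "m \<in> carrier G" "b \<in> \<R> m"
    and ker: "\<And>g w. (g, w) \<in> W \<Longrightarrow> (g \<otimes> k, w \<cdot> a) \<in> U \<Longrightarrow> w \<cdot> b = \<zero>\<^bsub>R\<^esub>"
  obtains c where "c \<in> \<R> (inv k \<otimes> m)" "\<And>g u. (g, u) \<in> U \<Longrightarrow> u \<cdot> c = \<zero>\<^bsub>R\<^esub>"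
    "\<And>g w. (g, w) \<in> W \<Longrightarrow> w \<cdot> a \<cdot> c = w \<cdot> b"
proof -
  define d where "d = inv k \<otimes> m"
  define \<Gamma> where "\<Gamma> = {(g \<otimes> k, u \<boxplus> w \<cdot> a, w \<cdot> b) | g u w. (g \<otimes> k, u) \<in> U \<and> (g, w) \<in> W}"
  have d: "d \<in> carrier G" using k m by (simp add: d_def)
  have a: "a \<in> carrier R" and b: "b \<in> carrier R" using k m deg_carrier by auto
  have Uc: "u \<in> carrier R" if "(g, u) \<in> U" for g u using lid_deg[OF U that] deg_carrier by blast
  have Wc: "w \<in> carrier R" if "(g, w) \<in> W" for g w using lid_deg[OF W that] deg_carrier by blast
  have I: "(g \<otimes> k, u \<boxplus> w \<cdot> a, w \<cdot> b) \<in> \<Gamma>" if "(g \<otimes> k, u) \<in> U" "(g, w) \<in> W" for g u w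
    using that by (auto simp: \<Gamma>_def)
  have gkd: "g \<otimes> k \<otimes> d = g \<otimes> m" if "g \<in> carrier G" for g
  proof -
    have "g \<otimes> k \<otimes> d = g \<otimes> (k \<otimes> inv k) \<otimes> m"
      using that k m by (simp only: d_def G.m_assoc G.inv_closed G.m_closed)
    then show ?thesis using that k by (simp only: G.r_inv G.r_one)
  qed
  have "hlinear G R \<R> d \<Gamma>"
    unfolding hlinear_def
  proof (intro conjI allI ballI impI)
    fix g x y assume "(g, x, y) \<in> \<Gamma>"
    then obtain h u w where *: "g = h \<otimes> k" "x = u \<boxplus> w \<cdot> a" "y = w \<cdot> b" "(h \<otimes> k, u) \<in> U" "(h, w) \<in> W"
      by (auto simp: \<Gamma>_def)
    note w = lid_deg[OF W *(5)]
    show "g \<in> carrier G" "x \<in> \<R> g"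
      using * w k lid_deg[OF U *(4)] by (auto intro: dec.summand_add mult_degree)
    show "y \<in> \<R> (g \<otimes> d)" using * w m gkd by (auto intro: mult_degree)
  next
    fix g assume g: "g \<in> carrier G"
    have "g \<otimes> inv k \<otimes> k = g" using g k by (simp add: G.m_assoc)
    then show "(g, \<zero>\<^bsub>R\<^esub>, \<zero>\<^bsub>R\<^esub>) \<in> \<Gamma>"
      using I[of "g \<otimes> inv k" "\<zero>\<^bsub>R\<^esub>" "\<zero>\<^bsub>R\<^esub>"] g k lid_zero[OF U] lid_zero[OF W] a b by simp
  next
    fix g x y x' y' assume xy: "(g, x, y) \<in> \<Gamma>" and xy': "(g, x', y') \<in> \<Gamma>"
    obtain h u w where
      *: "g = h \<otimes> k" "x = u \<boxplus> w \<cdot> a" "y = w \<cdot> b" "(h \<otimes> k, u) \<in> U" "(h, w) \<in> W"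
      using xy by (auto simp: \<Gamma>_def)
    obtain h' u' w' where
      **: "g = h' \<otimes> k" "x' = u' \<boxplus> w' \<cdot> a" "y' = w' \<cdot> b" "(h' \<otimes> k, u') \<in> U" "(h', w') \<in> W"
      using xy' by (auto simp: \<Gamma>_def)
    note c = Uc[OF *(4)] Uc[OF **(4)] Wc[OF *(5)] Wc[OF **(5)]
    \<comment> \<open>Cancelling \<open>k\<close> shows that both cofactors of \<open>a\<close> have
      the same degree, so they can be added.\<close>
    have "h' = h" using * ** k lid_deg[OF W *(5)] lid_deg[OF W **(5)] by simp
    with * ** have "(h \<otimes> k, (u \<boxplus> u') \<boxplus> (w \<boxplus> w') \<cdot> a, (w \<boxplus> w') \<cdot> b) \<in> \<Gamma>"
      by (intro I lid_add[OF U] lid_add[OF W]) auto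
    moreover have "(u \<boxplus> u') \<boxplus> (w \<boxplus> w') \<cdot> a = x \<boxplus> x'" "(w \<boxplus> w') \<cdot> b = y \<boxplus> y'"
      using c a b * ** by (simp_all add: R.l_distr R.a_ac)
    ultimately show "(g, x \<boxplus> x', y \<boxplus> y') \<in> \<Gamma>" using * by simp
  next
    fix h r g x y assume h: "h \<in> carrier G" "r \<in> \<R> h" and "(g, x, y) \<in> \<Gamma>"
    then obtain h' u w where *: "g = h' \<otimes> k" "x = u \<boxplus> w \<cdot> a" "y = w \<cdot> b" "(h' \<otimes> k, u) \<in> U" "(h', w) \<in> W"
      by (auto simp: \<Gamma>_def)
    note w = lid_deg[OF W *(5)]
    have r: "r \<in> carrier R" using h deg_carrier by blast
    have "(h \<otimes> h' \<otimes> k, r \<cdot> u) \<in> U" using lid_mult[OF U h *(4)] h w k by (simp add: G.m_assoc)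
    then have "(h \<otimes> h' \<otimes> k, r \<cdot> u \<boxplus> r \<cdot> w \<cdot> a, r \<cdot> w \<cdot> b) \<in> \<Gamma>"
      using lid_mult[OF W h *(5)] by (intro I)
    then show "(h \<otimes> g, r \<cdot> x, r \<cdot> y) \<in> \<Gamma>"
      using * h w k r a b Uc[OF *(4)] Wc[OF *(5)] by (simp add: G.m_assoc R.m_assoc R.r_distr)
  next
    fix g y assume "(g, \<zero>\<^bsub>R\<^esub>, y) \<in> \<Gamma>"
    then obtain h u w where *: "g = h \<otimes> k" "\<zero>\<^bsub>R\<^esub> = u \<boxplus> w \<cdot> a" "y = w \<cdot> b" "(h \<otimes> k, u) \<in> U" "(h, w) \<in> W"
      by (auto simp: \<Gamma>_def)
    have c: "u \<in> carrier R" "w \<in> carrier R" using Uc[OF *(4)] Wc[OF *(5)] .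
    then have "w \<cdot> a = \<ominus>\<^bsub>R\<^esub> u"
      using *(2) a by (metis R.a_comm R.m_closed R.minus_equality)
    then have "(h \<otimes> k, w \<cdot> a) \<in> U" using lid_neg[OF U *(4)] by simp
    then show "y = \<zero>\<^bsub>R\<^esub>" using ker *(3,5) by blast
  qed
  then obtain c where c: "c \<in> \<R> d" "\<forall>(g, x, y)\<in>\<Gamma>. y = x \<cdot> c"
    using baer d unfolding baer_def by blast
  have cc: "c \<in> carrier R" using c d deg_carrier by blast
  show thesis
  proof
    show "c \<in> \<R> (inv k \<otimes> m)" using c by (simp add: d_def)
    fix g u assume u: "(g, u) \<in> U"
    note gu = lid_deg[OF U u]
    have "g \<otimes> inv k \<otimes> k = g" using gu k by (simp add: G.m_assoc)
    then have "(g, u, \<zero>\<^bsub>R\<^esub>) \<in> \<Gamma>"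
      using I[of "g \<otimes> inv k" u "\<zero>\<^bsub>R\<^esub>"] u gu k lid_zero[OF W] a b Uc[OF u] by simp
    then show "u \<cdot> c = \<zero>\<^bsub>R\<^esub>" using c(2) by auto
  next
    fix g w assume w: "(g, w) \<in> W"
    note gw = lid_deg[OF W w]
    have "(g \<otimes> k, w \<cdot> a, w \<cdot> b) \<in> \<Gamma>"
      using I[of g "\<zero>\<^bsub>R\<^esub>" w] w gw k lid_zero[OF U] a b Wc[OF w] by simp
    then show "w \<cdot> a \<cdot> c = w \<cdot> b" using c(2) by auto
  qed
qed

text \<open>The inclusion of annihilators makes \<open>w a |-> w b\<close> well defined on
  \<open>R a\<close>. Since this map is right multiplication by some \<open>c\<close>, evaluation at
  \<open>w = 1\<close> gives \<open>b = a c\<close>.\<close>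

lemma baer_principal:
  assumes baer: "baer G R \<R>" and k: "k \<in> carrier G" "a \<in> \<R> k" and m: "m \<in> carrier G" "b \<in> \<R> m"
    and ann: "annl {(k, a)} \<subseteq> annl {(m, b)}"
  shows "(m, b) \<in> rgen k a"
proof -
  have ker: "w \<cdot> b = \<zero>\<^bsub>R\<^esub>" if "(g, w) \<in> E" "(g \<otimes> k, w \<cdot> a) \<in> hzero" for g w
  proof -
    have "(g, w) \<in> annl {(k, a)}" using that by (intro annlI) auto
    then show ?thesis using ann by (auto simp: hann_l_def)
  qed
  obtain c where c: "c \<in> \<R> (inv k \<otimes> m)" "\<And>g w. (g, w) \<in> E \<Longrightarrow> w \<cdot> a \<cdot> c = w \<cdot> b"
    by (rule baer_extend[OF baer lid_hzero lid_E k m], rule ker, assumption, assumption, rule that)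
  have "a \<cdot> c = b" using c(2)[of \<one> "\<one>\<^bsub>R\<^esub>"] deg_one k m by (simp add: deg_carrier)
  moreover have "k \<otimes> (inv k \<otimes> m) = m" using k m by (simp add: G.m_assoc[symmetric])
  ultimately show ?thesis using rgenI[of "inv k \<otimes> m" c k a] c k m by simp
qed

section \<open>Double annihilators of graded right ideals\<close>

lemma baer_annr_annl_principal:
  assumes "baer G R \<R>" "k \<in> carrier G" "a \<in> \<R> k"
  shows "annr (annl {(k, a)}) \<subseteq> rgen k a"
proof clarify
  fix m b assume b: "(m, b) \<in> annr (annl {(k, a)})"
  then have m: "m \<in> carrier G" "b \<in> \<R> m" by (auto simp: hann_r_def)
  have "annl {(k, a)} \<subseteq> annl {(m, b)}"
  proof clarify
    fix h r assume r: "(h, r) \<in> annl {(k, a)}"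
    then show "(h, r) \<in> annl {(m, b)}" using annrD[OF b r] by (auto simp: hann_l_def)
  qed
  with assms m show "(m, b) \<in> rgen k a" by (intro baer_principal)
qed

text \<open>Given \<open>x\<close> killed by \<open>U \<inter> V\<close>, extend the map that is
  zero on \<open>U\<close> and right multiplication by \<open>x\<close> on \<open>V\<close> to right
  multiplication by some \<open>c\<close>. Then \<open>c\<close> is killed by \<open>U\<close> and
  \<open>x - c\<close> by \<open>V\<close>.\<close>

lemma baer_annr_Int:
  assumes baer: "baer G R \<R>" and U: "lid U" and V: "lid V"
  shows "annr (U \<inter> V) \<subseteq> annr U \<boxplus>\<^sub>H annr V"
proof clarify
  fix d x assume x: "(d, x) \<in> annr (U \<inter> V)"
  then have d: "d \<in> carrier G" "x \<in> \<R> d" by (auto simp: hann_r_def)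
  have ker: "w \<cdot> x = \<zero>\<^bsub>R\<^esub>" if "(g, w) \<in> V" "(g \<otimes> \<one>, w \<cdot> \<one>\<^bsub>R\<^esub>) \<in> U" for g w
    using that lid_deg[OF V that(1)] annrD[OF x, of g w] by (simp add: deg_carrier)
  obtain c where c: "c \<in> \<R> (inv \<one> \<otimes> d)" "\<And>g u. (g, u) \<in> U \<Longrightarrow> u \<cdot> c = \<zero>\<^bsub>R\<^esub>"
    "\<And>g w. (g, w) \<in> V \<Longrightarrow> w \<cdot> \<one>\<^bsub>R\<^esub> \<cdot> c = w \<cdot> x"
    by (rule baer_extend[OF baer U V G.one_closed deg_one d], rule ker, assumption, assumption,
      rule that)
  have c1: "c \<in> \<R> d" using c d by simp
  then have cc: "c \<in> carrier R" "x \<in> carrier R" using d deg_carrier by auto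
  have "(d, c) \<in> annr U" using c1 c(2) d by (intro annrI)
  moreover have "(d, x \<boxminus> c) \<in> annr V"
  proof (rule annrI)
    fix g w assume w: "(g, w) \<in> V"
    have "w \<in> carrier R" using lid_deg[OF V w] deg_carrier by blast
    then show "w \<cdot> (x \<boxminus> c) = \<zero>\<^bsub>R\<^esub>"
      using c(3)[OF w] cc by (simp add: R.minus_eq R.r_distr R.r_minus R.r_neg)
  qed (use d c1 deg_minus in auto)
  ultimately have "(d, c \<boxplus> (x \<boxminus> c)) \<in> annr U \<boxplus>\<^sub>H annr V" by (rule hsumI)
  moreover have "c \<boxplus> (x \<boxminus> c) = x" using cc by (simp add: R.minus_eq R.a_lcomm[of c x] R.r_neg)
  ultimately show "(d, x) \<in> annr U \<boxplus>\<^sub>H annr V" by simp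
qed

lemma hsum_mono: "U \<subseteq> U' \<Longrightarrow> V \<subseteq> V' \<Longrightarrow> U \<boxplus>\<^sub>H V \<subseteq> U' \<boxplus>\<^sub>H V'"
  unfolding hsum_def by blast

text \<open>The left annihilator of \<open>A + a R\<close> is the intersection of those of
  \<open>A\<close> and \<open>a\<close>; taking right annihilators turns it back into a sum.\<close>

lemma baer_double_annihilator_step:
  assumes baer: "baer G R \<R>" and A: "rid A" "annr (annl A) = A"
    and k: "k \<in> carrier G" "a \<in> \<R> k"
  shows "annr (annl (A \<boxplus>\<^sub>H rgen k a)) = A \<boxplus>\<^sub>H rgen k a"
proof
  note B = rid_rgen[OF k]
  note AB = rid_hsum[OF A(1) B]
  have "annl A \<inter> annl {(k, a)} \<subseteq> annl (A \<boxplus>\<^sub>H rgen k a)"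
  proof clarify
    fix h r assume r: "(h, r) \<in> annl A" "(h, r) \<in> annl {(k, a)}"
    have h: "h \<in> carrier G" "r \<in> \<R> h" using r by (auto simp: hann_l_def)
    show "(h, r) \<in> annl (A \<boxplus>\<^sub>H rgen k a)"
    proof (rule annlI[OF h])
      fix g x assume "(g, x) \<in> A \<boxplus>\<^sub>H rgen k a"
      then obtain u v where u: "(g, u) \<in> A" "(g, v) \<in> rgen k a" "x = u \<boxplus> v" by (rule hsumE)
      obtain h' s where s: "h' \<in> carrier G" "s \<in> \<R> h'" "v = a \<cdot> s" using u(2) by (rule rgenE)
      have c: "u \<in> carrier R" "s \<in> carrier R" "r \<in> carrier R" "a \<in> carrier R"
        using rid_deg[OF A(1) u(1)] s h k deg_carrier by auto
      have "r \<cdot> a = \<zero>\<^bsub>R\<^esub>" using annlD[OF r(2), of k a] by simp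
      then have "r \<cdot> (a \<cdot> s) = \<zero>\<^bsub>R\<^esub>" using c by (simp add: R.m_assoc[symmetric])
      then show "r \<cdot> x = \<zero>\<^bsub>R\<^esub>" using annlD[OF r(1) u(1)] u s c by (simp add: R.r_distr)
    qed
  qed
  then have "annr (annl (A \<boxplus>\<^sub>H rgen k a)) \<subseteq> annr (annl A \<inter> annl {(k, a)})" by (rule ann_antimono)
  also have "\<dots> \<subseteq> annr (annl A) \<boxplus>\<^sub>H annr (annl {(k, a)})"
    using k by (intro baer_annr_Int baer lid_annl rid_subset[OF A(1)]) auto
  also have "\<dots> \<subseteq> A \<boxplus>\<^sub>H rgen k a"
    using A(2) baer_annr_annl_principal[OF baer k] by (intro hsum_mono) auto
  finally show "annr (annl (A \<boxplus>\<^sub>H rgen k a)) \<subseteq> A \<boxplus>\<^sub>H rgen k a" .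
  show "A \<boxplus>\<^sub>H rgen k a \<subseteq> annr (annl (A \<boxplus>\<^sub>H rgen k a))"
    by (rule ann_ann) (rule rid_subset[OF AB])
qed

lemma annr_annl_hzero: "annr (annl hzero) = hzero"
proof
  have "(\<one>, \<one>\<^bsub>R\<^esub>) \<in> annl hzero" using deg_one by (auto intro!: annlI)
  then show "annr (annl hzero) \<subseteq> hzero"
    by (auto simp: hann_r_def deg_carrier)
  show "hzero \<subseteq> annr (annl hzero)" by (rule ann_ann) (auto simp: dec.summand_zero)
qed

text \<open>Since one generator can always be added, a maximal subideal \<open>F\<close> satisfying
  the condition absorbs every homogeneous element of \<open>A\<close>. Each of the two chain
  conditions below supplies such an \<open>F\<close>.\<close>

lemma double_annihilator_right_maximal:
  assumes baer: "baer G R \<R>" and A: "rid A"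
    and F: "rid F" "F \<subseteq> A" "annr (annl F) = F"
    and max: "\<And>B. rid B \<Longrightarrow> B \<subseteq> A \<Longrightarrow> annr (annl B) = B \<Longrightarrow> F \<subseteq> B \<Longrightarrow> B = F"
  shows "annr (annl A) = A"
proof -
  have "A \<subseteq> F"
  proof clarify
    fix k a assume ka: "(k, a) \<in> A"
    note k = rid_deg[OF A ka] and B = rid_rgen[OF rid_deg[OF A ka]]
    have "F \<boxplus>\<^sub>H rgen k a = F"
      by (rule max[OF rid_hsum[OF F(1) B] rid_hsum_least[OF A F(2) rgen_least[OF A ka]]
            baer_double_annihilator_step[OF baer F(1,3) k] rid_hsum_upper(1)[OF F(1) B]])
    then show "(k, a) \<in> F" using rid_hsum_upper(2)[OF F(1) B] rgen_self[OF k] by auto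
  qed
  then show ?thesis using F by auto
qed

lemma double_annihilator_right_if_right_Noetherian:
  assumes baer: "baer G R \<R>" and acc: "satisfies_ACC (Collect rid)" and A: "rid A"
  shows "annr (annl A) = A"
proof -
  let ?P = "\<lambda>F. rid F \<and> F \<subseteq> A \<and> annr (annl F) = F"
  have "\<exists>F. ?P F \<and> hzero \<subseteq> F \<and> (\<forall>B. ?P B \<longrightarrow> F \<subseteq> B \<longrightarrow> B = F)"
    by (rule ACC_maximal[OF acc]) (use rid_hzero rid_zero[OF A] annr_annl_hzero in auto)
  then obtain F where F: "?P F" "\<And>B. ?P B \<Longrightarrow> F \<subseteq> B \<Longrightarrow> B = F" by blast
  then show ?thesis by (intro double_annihilator_right_maximal[OF baer A, of F]) auto
qed

lemma double_annihilator_right_if_left_Artinian: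
  assumes baer: "baer G R \<R>" and dcc: "satisfies_DCC (Collect lid)" and A: "rid A"
  shows "annr (annl A) = A"
proof -
  let ?P = "\<lambda>F. rid F \<and> F \<subseteq> A \<and> annr (annl F) = F"
  \<comment> \<open>The chain condition concerns left ideals, so a minimal left annihilator is
    chosen. Ideals satisfying the condition are determined by their left annihilators, hence the
    corresponding \<open>F\<close> is maximal.\<close>
  define Q where "Q L \<longleftrightarrow> (\<exists>F. ?P F \<and> L = annl F)" for L
  have "\<exists>L. Q L \<and> L \<subseteq> annl hzero \<and> (\<forall>B. Q B \<longrightarrow> B \<subseteq> L \<longrightarrow> B = L)"
  proof (rule DCC_minimal[OF dcc])
    show "Q (annl hzero)"
      unfolding Q_def using rid_hzero rid_zero[OF A] annr_annl_hzero by auto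
    show "L \<in> Collect lid" if "Q L" for L using that lid_annl rid_subset unfolding Q_def by auto
  qed
  then obtain L where L: "Q L" "\<And>B. Q B \<Longrightarrow> B \<subseteq> L \<Longrightarrow> B = L" by blast
  then obtain F where F: "?P F" "L = annl F" unfolding Q_def by blast
  show ?thesis
  proof (rule double_annihilator_right_maximal[OF baer A, of F])
    fix B assume B: "rid B" "B \<subseteq> A" "annr (annl B) = B" "F \<subseteq> B"
    then have "annl B = annl F" using L(2)[of "annl B"] F ann_antimono(1) unfolding Q_def by blast
    then show "B = F" using B F by metis
  qed (use F in auto)
qed

end

section \<open>Graded prime ideals and minimal idempotents modulo them\<close>

text \<open>Elementwise form of \<open>a R b\<close> being inside \<open>Q\<close>, tested on
  homogeneous \<open>a\<close> and \<open>b\<close> only: this is graded primeness, weaker than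
  primeness of the spanned ideal.\<close>

definition hprime ::
    "('g, 'x) monoid_scheme \<Rightarrow> ('r, 'y) ring_scheme \<Rightarrow> ('g \<Rightarrow> 'r set) \<Rightarrow> ('g \<times> 'r) set \<Rightarrow> bool" where
  "hprime G R \<R> Q \<longleftrightarrow> hleft G R \<R> Q \<and> hright G R \<R> Q \<and> (\<one>\<^bsub>G\<^esub>, \<one>\<^bsub>R\<^esub>) \<notin> Q \<and>
     (\<forall>g\<in>carrier G. \<forall>a\<in>\<R> g. \<forall>h\<in>carrier G. \<forall>b\<in>\<R> h.
        (\<forall>k\<in>carrier G. \<forall>r\<in>\<R> k. (g \<otimes>\<^bsub>G\<^esub> k \<otimes>\<^bsub>G\<^esub> h, a \<otimes>\<^bsub>R\<^esub> r \<otimes>\<^bsub>R\<^esub> b) \<in> Q) \<longrightarrow> (g, a) \<in> Q \<or> (h, b) \<in> Q)"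

text \<open>The image of \<open>e\<close> in the quotient by \<open>Q\<close> is an idempotent generating a minimal graded right
  ideal.\<close>

definition right_minimal ::
    "('g, 'x) monoid_scheme \<Rightarrow> ('r, 'y) ring_scheme \<Rightarrow> ('g \<Rightarrow> 'r set) \<Rightarrow> ('g \<times> 'r) set \<Rightarrow> 'r \<Rightarrow> bool" where
  "right_minimal G R \<R> Q e \<longleftrightarrow>
     e \<in> \<R> \<one>\<^bsub>G\<^esub> \<and> (\<one>\<^bsub>G\<^esub>, e) \<notin> Q \<and> (\<one>\<^bsub>G\<^esub>, e \<otimes>\<^bsub>R\<^esub> e \<ominus>\<^bsub>R\<^esub> e) \<in> Q \<and>
     (\<forall>h\<in>carrier G. \<forall>r\<in>\<R> h. (h, e \<otimes>\<^bsub>R\<^esub> r) \<notin> Q \<longrightarrow>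
        (\<exists>k\<in>carrier G. \<exists>t\<in>\<R> k. h \<otimes>\<^bsub>G\<^esub> k = \<one>\<^bsub>G\<^esub> \<and> (\<one>\<^bsub>G\<^esub>, e \<otimes>\<^bsub>R\<^esub> r \<otimes>\<^bsub>R\<^esub> t \<ominus>\<^bsub>R\<^esub> e) \<in> Q))"

definition left_minimal ::
    "('g, 'x) monoid_scheme \<Rightarrow> ('r, 'y) ring_scheme \<Rightarrow> ('g \<Rightarrow> 'r set) \<Rightarrow> ('g \<times> 'r) set \<Rightarrow> 'r \<Rightarrow> bool" where
  "left_minimal G R \<R> Q e \<longleftrightarrow>
     e \<in> \<R> \<one>\<^bsub>G\<^esub> \<and> (\<one>\<^bsub>G\<^esub>, e) \<notin> Q \<and> (\<one>\<^bsub>G\<^esub>, e \<otimes>\<^bsub>R\<^esub> e \<ominus>\<^bsub>R\<^esub> e) \<in> Q \<and>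
     (\<forall>h\<in>carrier G. \<forall>r\<in>\<R> h. (h, r \<otimes>\<^bsub>R\<^esub> e) \<notin> Q \<longrightarrow>
        (\<exists>k\<in>carrier G. \<exists>t\<in>\<R> k. k \<otimes>\<^bsub>G\<^esub> h = \<one>\<^bsub>G\<^esub> \<and> (\<one>\<^bsub>G\<^esub>, t \<otimes>\<^bsub>R\<^esub> r \<otimes>\<^bsub>R\<^esub> e \<ominus>\<^bsub>R\<^esub> e) \<in> Q))"

text \<open>Existence inside every principal right ideal that is nonzero modulo \<open>Q\<close>,
  not merely somewhere: \<open>prime_maximal\<close> looks for a minimal idempotent inside
  \<open>(1 - e) R\<close>.\<close>

definition has_right_minimal ::
    "('g, 'x) monoid_scheme \<Rightarrow> ('r, 'y) ring_scheme \<Rightarrow> ('g \<Rightarrow> 'r set) \<Rightarrow> ('g \<times> 'r) set \<Rightarrow> bool" where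
  "has_right_minimal G R \<R> Q \<longleftrightarrow>
     (\<forall>g\<in>carrier G. \<forall>c\<in>\<R> g. (g, c) \<notin> Q \<longrightarrow>
        (\<exists>h\<in>carrier G. \<exists>w\<in>\<R> h. g \<otimes>\<^bsub>G\<^esub> h = \<one>\<^bsub>G\<^esub> \<and> right_minimal G R \<R> Q (c \<otimes>\<^bsub>R\<^esub> w)))"

text \<open>In the corner at \<open>e\<close>, the element \<open>p = e u s e\<close> has the right
  inverse \<open>q = e t e\<close>, and \<open>q\<close> has a right inverse through
  \<open>w\<close>. Then \<open>p = p q w = e w\<close>, so \<open>q p = q e w = e\<close>.\<close>

lemma (in monoid) corner_left_inverse:
  assumes [simp]: "e \<in> carrier G" "u \<in> carrier G" "s \<in> carrier G" "t \<in> carrier G" "w \<in> carrier G"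
    and e: "e \<otimes> e = e" and t: "e \<otimes> u \<otimes> s \<otimes> e \<otimes> t = e" and w: "e \<otimes> t \<otimes> e \<otimes> w = e"
  shows "e \<otimes> t \<otimes> e \<otimes> u \<otimes> s \<otimes> e = e"
proof -
  let ?p = "e \<otimes> u \<otimes> s \<otimes> e" and ?q = "e \<otimes> t \<otimes> e"
  have p: "?p \<otimes> e = ?p" by (simp add: m_assoc e)
  have pq: "?p \<otimes> ?q = e"
  proof -
    have "?p \<otimes> ?q = e \<otimes> u \<otimes> s \<otimes> (e \<otimes> e) \<otimes> t \<otimes> e" by (simp add: m_assoc)
    also have "\<dots> = e" by (simp only: e t)
    finally show ?thesis .
  qed
  have "?p = ?p \<otimes> (?q \<otimes> w)" using p w by simp
  also have "\<dots> = ?p \<otimes> ?q \<otimes> w" by (rule m_assoc[symmetric]) simp_all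
  also have "\<dots> = e \<otimes> w" by (simp only: pq)
  finally have pw: "?p = e \<otimes> w" .
  have "e \<otimes> t \<otimes> e \<otimes> u \<otimes> s \<otimes> e = e \<otimes> t \<otimes> (e \<otimes> e) \<otimes> u \<otimes> s \<otimes> e" by (simp only: e)
  also have "\<dots> = ?q \<otimes> ?p" by (simp add: m_assoc)
  also have "\<dots> = ?q \<otimes> (e \<otimes> w)" by (simp only: pw)
  also have "\<dots> = e \<otimes> t \<otimes> (e \<otimes> e) \<otimes> w" by (simp add: m_assoc)
  also have "\<dots> = e" by (simp only: e w)
  finally show ?thesis .
qed

context graded_ring
begin

abbreviation prime where "prime \<equiv> hprime G R \<R>"
abbreviation rmin where "rmin \<equiv> right_minimal G R \<R>"
abbreviation lmin where "lmin \<equiv> left_minimal G R \<R>"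
abbreviation hrmin where "hrmin \<equiv> has_right_minimal G R \<R>"

lemma primeE:
  assumes "prime Q" "g \<in> carrier G" "a \<in> \<R> g" "(g, a) \<notin> Q" "h \<in> carrier G" "b \<in> \<R> h" "(h, b) \<notin> Q"
  obtains k r where "k \<in> carrier G" "r \<in> \<R> k" "(g \<otimes> k \<otimes> h, a \<cdot> r \<cdot> b) \<notin> Q"
  using assms unfolding hprime_def by blast

lemma primeD: "prime Q \<Longrightarrow> lid Q" "prime Q \<Longrightarrow> rid Q" "prime Q \<Longrightarrow> (\<one>, \<one>\<^bsub>R\<^esub>) \<notin> Q"
  unfolding hprime_def by blast+

lemma prime_op: "hprime (op_group G) (op_ring R) \<R> Q \<longleftrightarrow> prime Q"
proof -
  have eq: "h \<otimes> (k \<otimes> g) = h \<otimes> k \<otimes> g \<and> b \<cdot> (r \<cdot> a) = b \<cdot> r \<cdot> a"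
    if "g \<in> carrier G" "a \<in> \<R> g" "h \<in> carrier G" "b \<in> \<R> h" "k \<in> carrier G" "r \<in> \<R> k" for g a h b k r
    using that by (simp add: G.m_assoc R.m_assoc deg_carrier)
  have "hprime (op_group G) (op_ring R) \<R> Q \<longleftrightarrow> rid Q \<and> lid Q \<and> (\<one>, \<one>\<^bsub>R\<^esub>) \<notin> Q \<and>
    (\<forall>g\<in>carrier G. \<forall>a\<in>\<R> g. \<forall>h\<in>carrier G. \<forall>b\<in>\<R> h.
        (\<forall>k\<in>carrier G. \<forall>r\<in>\<R> k. (h \<otimes> (k \<otimes> g), b \<cdot> (r \<cdot> a)) \<in> Q) \<longrightarrow> (g, a) \<in> Q \<or> (h, b) \<in> Q)"
    by (simp add: hprime_def hright_def[symmetric])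
  also have "\<dots> \<longleftrightarrow> rid Q \<and> lid Q \<and> (\<one>, \<one>\<^bsub>R\<^esub>) \<notin> Q \<and>
    (\<forall>g\<in>carrier G. \<forall>a\<in>\<R> g. \<forall>h\<in>carrier G. \<forall>b\<in>\<R> h.
        (\<forall>k\<in>carrier G. \<forall>r\<in>\<R> k. (h \<otimes> k \<otimes> g, b \<cdot> r \<cdot> a) \<in> Q) \<longrightarrow> (g, a) \<in> Q \<or> (h, b) \<in> Q)"
    by (simp add: eq cong: ball_cong)
  also have "\<dots> \<longleftrightarrow> prime Q"
    unfolding hprime_def by blast
  finally show ?thesis .
qed

lemma left_minimal_op: "left_minimal (op_group G) (op_ring R) \<R> Q e \<longleftrightarrow> rmin Q e"
proof -
  have "e \<cdot> (r \<cdot> t) = e \<cdot> r \<cdot> t"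
    if "e \<in> \<R> \<one>" "h \<in> carrier G" "r \<in> \<R> h" "k \<in> carrier G" "t \<in> \<R> k" for h r k t
    using that by (simp add: R.m_assoc deg_carrier)
  then show ?thesis
    by (auto simp: left_minimal_def right_minimal_def a_minus_def)
qed

lemma ideal_span: "lid Q \<Longrightarrow> rid Q \<Longrightarrow> ideal (span Q) R"
proof (intro idealI)
  assume Q: "lid Q" "rid Q"
  interpret left_ideal "span Q" R by (rule left_ideal_span[OF Q(1)])
  show "subgroup (span Q) (add_monoid R)" by (rule a_subgroup)
  show "x \<cdot> a \<in> span Q" if "a \<in> span Q" "x \<in> carrier R" for a x using that by (rule l_closed)
  show "a \<cdot> x \<in> span Q" if "a \<in> span Q" "x \<in> carrier R" for a x
    using graded_ring.span_mult[OF graded_ring_op, of Q a x] Q that by (simp add: hright_def)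
qed (rule R.ring_axioms)

text \<open>Congruences modulo \<open>Q\<close> between homogeneous elements of one degree become
  equations in an ordinary quotient ring, while degrees continue to be tracked in
  \<open>R\<close>.\<close>

lemma quotient_hom:
  assumes Q: "lid Q" "rid Q"
  obtains B :: "'r set ring" and \<rho> where "ring B" "\<rho> \<in> ring_hom R B"
    "\<And>g x. g \<in> carrier G \<Longrightarrow> x \<in> \<R> g \<Longrightarrow> (g, x) \<in> Q \<longleftrightarrow> \<rho> x = \<zero>\<^bsub>B\<^esub>"
    "\<And>g x y. g \<in> carrier G \<Longrightarrow> x \<in> \<R> g \<Longrightarrow> y \<in> \<R> g \<Longrightarrow> (g, x \<boxminus> y) \<in> Q \<longleftrightarrow> \<rho> x = \<rho> y"
proof
  interpret ideal "span Q" R by (rule ideal_span[OF Q])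
  show B: "ring (R Quot (span Q))" by (rule quotient_is_ring)
  show hom: "(+>\<^bsub>R\<^esub>) (span Q) \<in> ring_hom R (R Quot (span Q))" by (rule rcos_ring_hom)
  have zero: "span Q +>\<^bsub>R\<^esub> \<zero>\<^bsub>R\<^esub> = \<zero>\<^bsub>R Quot (span Q)\<^esub>"
    by (rule ring_hom_zero[OF hom R.ring_axioms B])
  fix g assume g: "g \<in> carrier G"
  show 2: "(g, x \<boxminus> y) \<in> Q \<longleftrightarrow> span Q +>\<^bsub>R\<^esub> x = span Q +>\<^bsub>R\<^esub> y" if "x \<in> \<R> g" "y \<in> \<R> g" for x y
    using R.quotient_eq_iff_same_a_r_cos[OF ideal_axioms, of x y] that g
      span_homogeneous[OF Q(1) g, of "x \<boxminus> y"] by (simp add: deg_carrier deg_minus)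
  show "(g, x) \<in> Q \<longleftrightarrow> span Q +>\<^bsub>R\<^esub> x = \<zero>\<^bsub>R Quot (span Q)\<^esub>" if "x \<in> \<R> g" for x
    using 2[of x "\<zero>\<^bsub>R\<^esub>"] that g zero by (simp add: dec.summand_zero R.minus_eq deg_carrier)
qed

text \<open>Modulo a prime, \<open>s e\<close> can be moved into the corner at \<open>e\<close> by a
  factor \<open>e u\<close>. Right minimality gives every nonzero corner element a right inverse,
  and then these inverses are two-sided.\<close>

lemma right_minimal_imp_left_minimal:
  assumes Q: "prime Q" and e: "rmin Q e"
  shows "lmin Q e"
proof -
  obtain B :: "'r set ring" and \<rho> where B: "ring B" and hom: "\<rho> \<in> ring_hom R B"
    and \<rho>0: "\<And>g x. g \<in> carrier G \<Longrightarrow> x \<in> \<R> g \<Longrightarrow> (g, x) \<in> Q \<longleftrightarrow> \<rho> x = \<zero>\<^bsub>B\<^esub>"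
    and \<rho>eq: "\<And>g x y. g \<in> carrier G \<Longrightarrow> x \<in> \<R> g \<Longrightarrow> y \<in> \<R> g \<Longrightarrow> (g, x \<boxminus> y) \<in> Q \<longleftrightarrow> \<rho> x = \<rho> y"
    by (rule quotient_hom[OF primeD(1,2)[OF Q]]) (rule that)
  interpret B: ring B by (rule B)
  have e1: "e \<in> \<R> \<one>" and eQ: "(\<one>, e) \<notin> Q" and ee: "(\<one>, e \<cdot> e \<boxminus> e) \<in> Q"
    and min: "\<And>h r. h \<in> carrier G \<Longrightarrow> r \<in> \<R> h \<Longrightarrow> (h, e \<cdot> r) \<notin> Q \<Longrightarrow>
        \<exists>k\<in>carrier G. \<exists>t\<in>\<R> k. h \<otimes> k = \<one> \<and> (\<one>, e \<cdot> r \<cdot> t \<boxminus> e) \<in> Q"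
    using e unfolding right_minimal_def by blast+
  have ec: "e \<in> carrier R" using e1 deg_carrier by blast
  have "e \<cdot> e \<in> \<R> \<one>" using mult_degree[of \<one> \<one> e e] e1 by simp
  then have \<rho>e: "\<rho> e \<otimes>\<^bsub>B\<^esub> \<rho> e = \<rho> e"
    using ee \<rho>eq[of \<one> "e \<cdot> e" e] e1 ec ring_hom_mult[OF hom, of e e] by simp
  have "\<exists>i\<in>carrier G. \<exists>t\<in>\<R> i. i \<otimes> k = \<one> \<and> (\<one>, t \<cdot> s \<cdot> e \<boxminus> e) \<in> Q"
    if k: "k \<in> carrier G" "s \<in> \<R> k" and se: "(k, s \<cdot> e) \<notin> Q" for k s
  proof -
    have sc: "s \<in> carrier R" using k deg_carrier by blast
    have sek: "s \<cdot> e \<in> \<R> k" using mult_degree[of k \<one> s e] k e1 by simp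
    \<comment> \<open>Primeness moves \<open>s e\<close> into the corner without its becoming zero
      modulo \<open>Q\<close>.\<close>
    obtain j u where j: "j \<in> carrier G" "u \<in> \<R> j" and "(\<one> \<otimes> j \<otimes> k, e \<cdot> u \<cdot> (s \<cdot> e)) \<notin> Q"
      by (rule primeE[OF Q G.one_closed e1 eQ k(1) sek se])
    then have use1: "(j \<otimes> k, e \<cdot> (u \<cdot> s \<cdot> e)) \<notin> Q" and uc: "u \<in> carrier R"
      using ec sc k by (simp_all add: R.m_assoc deg_carrier)
    have "u \<cdot> s \<cdot> e \<in> \<R> (j \<otimes> k)"
      using mult_degree[of "j \<otimes> k" \<one> "u \<cdot> s" e] mult_degree[of j k u s] j k e1 by simp
    then obtain i t where i: "i \<in> carrier G" "t \<in> \<R> i" "j \<otimes> k \<otimes> i = \<one>"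
      and t: "(\<one>, e \<cdot> (u \<cdot> s \<cdot> e) \<cdot> t \<boxminus> e) \<in> Q"
      using min[of "j \<otimes> k" "u \<cdot> s \<cdot> e"] use1 j k by auto
    have tc: "t \<in> carrier R" using i deg_carrier by blast
    note c = ec sc uc tc
    have "e \<cdot> (u \<cdot> s \<cdot> e) \<cdot> t \<in> \<R> \<one>"
      using mult_degree[of "j \<otimes> k" i "e \<cdot> (u \<cdot> s \<cdot> e)" t] mult_degree[of \<one> "j \<otimes> k" e "u \<cdot> s \<cdot> e"]
        \<open>u \<cdot> s \<cdot> e \<in> \<R> (j \<otimes> k)\<close> i j k e1 by simp
    then have "\<rho> (e \<cdot> (u \<cdot> s \<cdot> e) \<cdot> t) = \<rho> e" using t \<rho>eq e1 by blast
    then have \<rho>t: "\<rho> e \<otimes>\<^bsub>B\<^esub> \<rho> u \<otimes>\<^bsub>B\<^esub> \<rho> s \<otimes>\<^bsub>B\<^esub> \<rho> e \<otimes>\<^bsub>B\<^esub> \<rho> t = \<rho> e"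
      using c by (simp add: ring_hom_mult[OF hom] ring_hom_closed[OF hom] B.m_assoc)
    have te: "t \<cdot> e \<in> \<R> i" using mult_degree[of i \<one> t e] i e1 by simp
    have ete: "e \<cdot> (t \<cdot> e) \<in> \<R> i" using mult_degree[of \<one> i e "t \<cdot> e"] i te e1 by simp
    \<comment> \<open>If \<open>e t e\<close> vanished modulo \<open>Q\<close>, then so would
      \<open>e = e u s e t e\<close>. Hence \<open>e t e\<close> has a right inverse as
      well.\<close>
    have "(i, e \<cdot> (t \<cdot> e)) \<notin> Q"
    proof
      assume "(i, e \<cdot> (t \<cdot> e)) \<in> Q"
      then have "\<rho> (e \<cdot> (t \<cdot> e)) = \<zero>\<^bsub>B\<^esub>" using \<rho>0 i ete by blast
      then have z: "\<rho> e \<otimes>\<^bsub>B\<^esub> (\<rho> t \<otimes>\<^bsub>B\<^esub> \<rho> e) = \<zero>\<^bsub>B\<^esub>" using c by (simp add: ring_hom_mult[OF hom])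
      have "\<rho> e = \<rho> e \<otimes>\<^bsub>B\<^esub> \<rho> u \<otimes>\<^bsub>B\<^esub> \<rho> s \<otimes>\<^bsub>B\<^esub> \<rho> e \<otimes>\<^bsub>B\<^esub> \<rho> t \<otimes>\<^bsub>B\<^esub> \<rho> e" using \<rho>t \<rho>e by simp
      also have "\<dots> = \<rho> e \<otimes>\<^bsub>B\<^esub> \<rho> u \<otimes>\<^bsub>B\<^esub> \<rho> s \<otimes>\<^bsub>B\<^esub> (\<rho> e \<otimes>\<^bsub>B\<^esub> (\<rho> t \<otimes>\<^bsub>B\<^esub> \<rho> e))"
        using c by (simp add: ring_hom_closed[OF hom] B.m_assoc)
      also have "\<dots> = \<zero>\<^bsub>B\<^esub>" using z c by (simp add: ring_hom_closed[OF hom])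
      finally show False using \<rho>0[of \<one> e] e1 eQ by simp
    qed
    then obtain i' w where w: "i' \<in> carrier G" "w \<in> \<R> i'" "i \<otimes> i' = \<one>"
      and wQ: "(\<one>, e \<cdot> (t \<cdot> e) \<cdot> w \<boxminus> e) \<in> Q"
      using min[OF i(1) te] by auto
    have wc: "w \<in> carrier R" using w deg_carrier by blast
    have "e \<cdot> (t \<cdot> e) \<cdot> w \<in> \<R> \<one>" using mult_degree[OF i(1) w(1) ete w(2)] w by simp
    then have "\<rho> (e \<cdot> (t \<cdot> e) \<cdot> w) = \<rho> e" using wQ \<rho>eq e1 by blast
    then have \<rho>w: "\<rho> e \<otimes>\<^bsub>B\<^esub> \<rho> t \<otimes>\<^bsub>B\<^esub> \<rho> e \<otimes>\<^bsub>B\<^esub> \<rho> w = \<rho> e"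
      using c wc by (simp add: ring_hom_mult[OF hom] ring_hom_closed[OF hom] B.m_assoc)
    \<comment> \<open>One-sided inverses of degrees are two-sided in a group, so the cofactor
      \<open>e t e u\<close> of \<open>s e\<close> has the degree inverse to that of
      \<open>s\<close>.\<close>
    have ij: "i \<otimes> j \<otimes> k = \<one>"
    proof -
      have "i = inv (j \<otimes> k)" using i j k by (metis G.inv_equality G.inv_inv G.m_closed)
      then show ?thesis using i j k by (simp add: G.m_assoc)
    qed
    have tt: "e \<cdot> t \<cdot> e \<cdot> u \<in> \<R> (i \<otimes> j)"
      using mult_degree[OF i(1) j(1) ete j(2)] c by (simp add: R.m_assoc)
    have "e \<cdot> t \<cdot> e \<cdot> u \<cdot> s \<cdot> e \<in> \<R> \<one>"
      using mult_degree[OF _ k(1) tt k(2)] mult_degree[of \<one> \<one> "e \<cdot> t \<cdot> e \<cdot> u \<cdot> s" e] ij i j e1 by simp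
    moreover have "\<rho> (e \<cdot> t \<cdot> e \<cdot> u \<cdot> s \<cdot> e) = \<rho> e"
      using B.corner_left_inverse[OF _ _ _ _ _ \<rho>e \<rho>t \<rho>w] c wc
      by (simp add: ring_hom_mult[OF hom] ring_hom_closed[OF hom])
    ultimately have "(\<one>, e \<cdot> t \<cdot> e \<cdot> u \<cdot> s \<cdot> e \<boxminus> e) \<in> Q" using \<rho>eq e1 by blast
    with tt ij i j show ?thesis by blast
  qed
  then show ?thesis using e1 eQ ee unfolding left_minimal_def by blast
qed

lemma right_minimal_exists:
  assumes "prime Q" "hrmin Q"
  obtains e where "rmin Q e"
  using assms(2) primeD[OF assms(1)] deg_one unfolding has_right_minimal_def by blast

section \<open>Noetherian graded rings with minimal one-sided ideals modulo primes are Artinian\<close>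

text \<open>The annihilator of the submodule generated by \<open>x\<close> in \<open>R / V\<close>;
  for \<open>x = 1\<close> and a left ideal \<open>V\<close> it is the largest two-sided graded
  ideal inside \<open>V\<close>.\<close>

definition hcore :: "('g \<times> 'r) set \<Rightarrow> 'g \<Rightarrow> 'r \<Rightarrow> ('g \<times> 'r) set" where
  "hcore V g x = {(k, r) \<in> E. \<forall>h\<in>carrier G. \<forall>s\<in>\<R> h. (k \<otimes> h \<otimes> g, r \<cdot> s \<cdot> x) \<in> V}"

lemma hcoreI:
  "k \<in> carrier G \<Longrightarrow> r \<in> \<R> k \<Longrightarrow>
    (\<And>h s. h \<in> carrier G \<Longrightarrow> s \<in> \<R> h \<Longrightarrow> (k \<otimes> h \<otimes> g, r \<cdot> s \<cdot> x) \<in> V) \<Longrightarrow> (k, r) \<in> hcore V g x"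
  by (auto simp: hcore_def)

lemma hcoreD: "(k, r) \<in> hcore V g x \<Longrightarrow> h \<in> carrier G \<Longrightarrow> s \<in> \<R> h \<Longrightarrow> (k \<otimes> h \<otimes> g, r \<cdot> s \<cdot> x) \<in> V"
  by (auto simp: hcore_def)

lemma hcore_deg: "(k, r) \<in> hcore V g x \<Longrightarrow> k \<in> carrier G" "(k, r) \<in> hcore V g x \<Longrightarrow> r \<in> \<R> k"
  by (auto simp: hcore_def)

lemma lid_hcore:
  assumes V: "lid V" and g: "g \<in> carrier G" "x \<in> \<R> g"
  shows "lid (hcore V g x)"
proof (rule lidI)
  have x: "x \<in> carrier R" using g deg_carrier by blast
  show "(k, r) \<in> hcore V g x \<Longrightarrow> k \<in> carrier G \<and> r \<in> \<R> k" for k r using hcore_deg by blast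
  show "k \<in> carrier G \<Longrightarrow> (k, \<zero>\<^bsub>R\<^esub>) \<in> hcore V g x" for k
    using x g lid_zero[OF V] by (intro hcoreI) (auto simp: dec.summand_zero deg_carrier)
  show "(k, r \<boxplus> r') \<in> hcore V g x" if r: "(k, r) \<in> hcore V g x" and r': "(k, r') \<in> hcore V g x" for k r r'
  proof (rule hcoreI)
    fix h s assume s: "h \<in> carrier G" "s \<in> \<R> h"
    have "r \<in> carrier R" "r' \<in> carrier R" "s \<in> carrier R"
      using hcore_deg[OF r] hcore_deg[OF r'] s deg_carrier by auto
    then show "(k \<otimes> h \<otimes> g, (r \<boxplus> r') \<cdot> s \<cdot> x) \<in> V"
      using lid_add[OF V hcoreD[OF r s] hcoreD[OF r' s]] x by (simp add: R.l_distr)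
  qed (use hcore_deg[OF r] hcore_deg[OF r'] dec.summand_add in auto)
  show "(l \<otimes> k, p \<cdot> r) \<in> hcore V g x"
    if p: "l \<in> carrier G" "p \<in> \<R> l" and r: "(k, r) \<in> hcore V g x" for l p k r
  proof (rule hcoreI)
    fix h s assume s: "h \<in> carrier G" "s \<in> \<R> h"
    have "r \<in> carrier R" "p \<in> carrier R" "s \<in> carrier R"
      using hcore_deg[OF r] p s deg_carrier by auto
    then show "(l \<otimes> k \<otimes> h \<otimes> g, p \<cdot> r \<cdot> s \<cdot> x) \<in> V"
      using lid_mult[OF V p hcoreD[OF r s]] x p s g hcore_deg[OF r] by (simp add: R.m_assoc G.m_assoc)
  qed (use hcore_deg[OF r] p mult_degree in auto)
qed

lemma rid_hcore:
  assumes V: "lid V" and g: "g \<in> carrier G" "x \<in> \<R> g"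
  shows "rid (hcore V g x)"
proof (rule ridI)
  have x: "x \<in> carrier R" using g deg_carrier by blast
  show "(k \<otimes> l, r \<cdot> p) \<in> hcore V g x"
    if p: "l \<in> carrier G" "p \<in> \<R> l" and r: "(k, r) \<in> hcore V g x" for l p k r
  proof (rule hcoreI)
    fix h s assume s: "h \<in> carrier G" "s \<in> \<R> h"
    have "r \<in> carrier R" "p \<in> carrier R" "s \<in> carrier R"
      using hcore_deg[OF r] p s deg_carrier by auto
    moreover have "(k \<otimes> (l \<otimes> h) \<otimes> g, r \<cdot> (p \<cdot> s) \<cdot> x) \<in> V"
      using p s by (intro hcoreD[OF r] mult_degree) auto
    ultimately show "(k \<otimes> l \<otimes> h \<otimes> g, r \<cdot> p \<cdot> s \<cdot> x) \<in> V"
      using x p s g hcore_deg[OF r] by (simp add: R.m_assoc G.m_assoc)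
  qed (use hcore_deg[OF r] p mult_degree in auto)
  note l = lid_hcore[OF assms]
  show "(k, r) \<in> hcore V g x \<Longrightarrow> k \<in> carrier G \<and> r \<in> \<R> k" for k r using hcore_deg by blast
  show "k \<in> carrier G \<Longrightarrow> (k, \<zero>\<^bsub>R\<^esub>) \<in> hcore V g x" for k by (rule lid_zero[OF l])
  show "(k, r) \<in> hcore V g x \<Longrightarrow> (k, r') \<in> hcore V g x \<Longrightarrow> (k, r \<boxplus> r') \<in> hcore V g x" for k r r'
    by (rule lid_add[OF l])
qed

text \<open>The largest two-sided graded ideal inside a right ideal, obtained as the opposite form
  of \<open>hcore\<close> at \<open>x = 1\<close>.\<close>

lemma tid_right_core:
  assumes V: "rid V"
  shows "lid {(k, x) \<in> E. \<forall>i\<in>carrier G. \<forall>s\<in>\<R> i. (i \<otimes> k, s \<cdot> x) \<in> V}" (is "lid ?C")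
    and "rid {(k, x) \<in> E. \<forall>i\<in>carrier G. \<forall>s\<in>\<R> i. (i \<otimes> k, s \<cdot> x) \<in> V}"
proof -
  interpret op: graded_ring "op_group G" "op_ring R" \<R> by (rule graded_ring_op)
  have "op.hcore V \<one> \<one>\<^bsub>R\<^esub> = ?C"
    unfolding op.hcore_def by (auto simp: deg_carrier)
  then show "lid ?C" "rid ?C"
    using op.lid_hcore[of V \<one> "\<one>\<^bsub>R\<^esub>"] op.rid_hcore[of V \<one> "\<one>\<^bsub>R\<^esub>"] V deg_one
    by (simp_all add: hright_def[symmetric])
qed

text \<open>By \<open>simple\<close>, the class of \<open>y\<close> generates a simple module modulo
  \<open>V\<close> unless it is zero. A descending chain either enters \<open>V\<close> at some
  stage or always maps onto this quotient, and then it is governed by its intersections with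
  \<open>V\<close>.\<close>

lemma DCC_below_extend:
  assumes V: "lid V" and m: "m \<in> carrier G" "y \<in> \<R> m"
    and simple: "\<And>k r. k \<in> carrier G \<Longrightarrow> r \<in> \<R> k \<Longrightarrow> (k \<otimes> m, r \<cdot> y) \<notin> V \<Longrightarrow>
        \<exists>i\<in>carrier G. \<exists>t\<in>\<R> i. i \<otimes> k = \<one> \<and> (m, t \<cdot> r \<cdot> y \<boxminus> y) \<in> V"
    and dcc: "satisfies_DCC {X. lid X \<and> X \<subseteq> V}"
  shows "satisfies_DCC {X. lid X \<and> X \<subseteq> V \<boxplus>\<^sub>H lgen m y}"
  unfolding satisfies_DCC_def
proof (intro allI impI, elim conjE)
  fix I :: "nat \<Rightarrow> ('g \<times> 'r) set"
  assume I: "\<forall>n. I n \<in> {X. lid X \<and> X \<subseteq> V \<boxplus>\<^sub>H lgen m y}" and step: "\<forall>n. I (Suc n) \<subseteq> I n"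
  have lI: "lid (I n)" and sub: "I n \<subseteq> V \<boxplus>\<^sub>H lgen m y" for n using I by auto
  have anti: "I n \<subseteq> I k" if "k \<le> n" for k n
    using that
  proof (induction n rule: dec_induct)
    case (step n)
    then show ?case using \<open>\<forall>n. I (Suc n) \<subseteq> I n\<close> by blast
  qed simp
  have yc: "y \<in> carrier R" using m deg_carrier by blast
  show "\<exists>N. \<forall>n\<ge>N. I n = I N"
  proof (cases "\<exists>n. I n \<subseteq> V")
    case True
    then obtain n0 where n0: "I n0 \<subseteq> V" by blast
    have "(\<forall>n. I (n0 + n) \<in> {X. lid X \<and> X \<subseteq> V}) \<and> (\<forall>n. I (n0 + Suc n) \<subseteq> I (n0 + n))"
    proof (intro conjI allI)
      show "I (n0 + n) \<in> {X. lid X \<and> X \<subseteq> V}" for n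
        using lI[of "n0 + n"] anti[of n0 "n0 + n"] n0 by auto
      show "I (n0 + Suc n) \<subseteq> I (n0 + n)" for n using step by simp
    qed
    with dcc[unfolded satisfies_DCC_def, rule_format, of "\<lambda>n. I (n0 + n)"]
    obtain N where N: "\<And>n. n \<ge> N \<Longrightarrow> I (n0 + n) = I (n0 + N)" by auto
    have "I n = I (n0 + N)" if "n \<ge> n0 + N" for n
      using N[of "n - n0"] that by simp
    then show ?thesis by blast
  next
    case False
    have "(\<forall>n. I n \<inter> V \<in> {X. lid X \<and> X \<subseteq> V}) \<and> (\<forall>n. I (Suc n) \<inter> V \<subseteq> I n \<inter> V)"
      using lI V step lid_Int by auto
    with dcc[unfolded satisfies_DCC_def, rule_format, of "\<lambda>n. I n \<inter> V"]
    obtain N where N: "\<And>n. n \<ge> N \<Longrightarrow> I n \<inter> V = I N \<inter> V" by auto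
    have "I N \<subseteq> I n" if n: "n \<ge> N" for n
    proof clarify
      fix q x assume x: "(q, x) \<in> I N"
      obtain q' x' where x': "(q', x') \<in> I n" "(q', x') \<notin> V"
        using False[simplified, rule_format, of n] by auto
      obtain v w where v: "(q, v) \<in> V" "(q, w) \<in> lgen m y" "x = v \<boxplus> w"
        using x sub by (meson hsumE subsetD)
      obtain k r where r: "k \<in> carrier G" "r \<in> \<R> k" "q = k \<otimes> m" "w = r \<cdot> y" using v(2) by (rule lgenE)
      obtain v' w' where v': "(q', v') \<in> V" "(q', w') \<in> lgen m y" "x' = v' \<boxplus> w'"
        using x'(1) sub by (meson hsumE subsetD)
      obtain k' r' where r': "k' \<in> carrier G" "r' \<in> \<R> k'" "q' = k' \<otimes> m" "w' = r' \<cdot> y"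
        using v'(2) by (rule lgenE)
      have "(k' \<otimes> m, r' \<cdot> y) \<notin> V" using x'(2) v' r' lid_add[OF V] by auto
      then obtain i t where t: "i \<in> carrier G" "t \<in> \<R> i" "i \<otimes> k' = \<one>" "(m, t \<cdot> r' \<cdot> y \<boxminus> y) \<in> V"
        using simple[OF r'(1,2)] by blast
      have c: "v \<in> carrier R" "r \<in> carrier R" "v' \<in> carrier R" "r' \<in> carrier R" "t \<in> carrier R"
        using lid_deg[OF V v(1)] lid_deg[OF V v'(1)] r r' t deg_carrier by auto
      have rt: "k \<otimes> i \<in> carrier G" "r \<cdot> t \<in> \<R> (k \<otimes> i)" using r t mult_degree by auto
      have q: "k \<otimes> i \<otimes> q' = q"
      proof -
        have "k \<otimes> i \<otimes> q' = k \<otimes> (i \<otimes> k') \<otimes> m"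
          using r(1) r'(1,3) t(1) m(1) by (simp only: G.m_assoc G.m_closed)
        then show ?thesis using t r m by simp
      qed
      have z: "(q, r \<cdot> t \<cdot> x') \<in> I n" using lid_mult[OF lI rt x'(1)] q by simp
      \<comment> \<open>Modulo \<open>V\<close>, \<open>x\<close> is \<open>r y\<close> and
        \<open>x'\<close> is \<open>r' y\<close>, with \<open>t r' y\<close> congruent to
        \<open>y\<close>. Subtracting \<open>r t x'\<close> from \<open>x\<close> therefore leaves
        an element of \<open>V\<close>, where the chain is already stationary.\<close>
      have "x \<boxminus> r \<cdot> t \<cdot> x' = v \<boxminus> r \<cdot> t \<cdot> v' \<boxminus> r \<cdot> (t \<cdot> r' \<cdot> y \<boxminus> y)"
        using c yc v v' r r' by (simp add: R.minus_eq R.r_distr R.minus_add R.r_minus R.m_assoc R.a_ac)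
      moreover have "(q, v \<boxminus> r \<cdot> t \<cdot> v' \<boxminus> r \<cdot> (t \<cdot> r' \<cdot> y \<boxminus> y)) \<in> V"
      proof -
        have "(q, r \<cdot> t \<cdot> v') \<in> V" using lid_mult[OF V rt v'(1)] q by simp
        moreover have "(q, r \<cdot> (t \<cdot> r' \<cdot> y \<boxminus> y)) \<in> V" using lid_mult[OF V r(1,2) t(4)] r by simp
        ultimately show ?thesis using v(1) lid_minus[OF V] by blast
      qed
      moreover have "(q, x \<boxminus> r \<cdot> t \<cdot> x') \<in> I N" using x z anti[OF n] lid_minus[OF lI] by blast
      ultimately have "(q, x \<boxminus> r \<cdot> t \<cdot> x') \<in> I n" using N[OF n] by auto
      from lid_add[OF lI this z] show "(q, x) \<in> I n"
        using c yc x v v' r r' by (simp add: R.minus_eq R.a_assoc R.l_neg)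
    qed
    then show ?thesis using anti by blast
  qed
qed

text \<open>Take \<open>V\<close> maximal with the descending chain condition below it. If
  \<open>V\<close> is proper, an associated prime of \<open>R / V\<close> has a minimal idempotent,
  this exhibits a simple submodule of \<open>R / V\<close>, and \<open>V\<close> can be
  enlarged.\<close>

theorem left_Artinian_if_left_Noetherian:
  assumes acc: "satisfies_ACC (Collect lid)" and primes: "\<And>Q. prime Q \<Longrightarrow> \<exists>e. lmin Q e"
  shows "satisfies_DCC (Collect lid)"
proof -
  let ?P = "\<lambda>V. lid V \<and> satisfies_DCC {X. lid X \<and> X \<subseteq> V}"
  have "satisfies_DCC {X. lid X \<and> X \<subseteq> hzero}"
  proof -
    have "X = hzero" if "lid X" "X \<subseteq> hzero" for X using that lid_zero by auto
    then have "{X. lid X \<and> X \<subseteq> hzero} \<subseteq> {hzero}" by blast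
    then have "I n = hzero" if "\<forall>n. I n \<in> {X. lid X \<and> X \<subseteq> hzero}" for I and n :: nat
      using that by blast
    then show ?thesis unfolding satisfies_DCC_def by blast
  qed
  then have "\<exists>V. ?P V \<and> hzero \<subseteq> V \<and> (\<forall>B. ?P B \<longrightarrow> V \<subseteq> B \<longrightarrow> B = V)"
    by (intro ACC_maximal[OF acc]) (auto simp: lid_hzero)
  then obtain V where V: "lid V" and dcc: "satisfies_DCC {X. lid X \<and> X \<subseteq> V}"
    and max: "\<And>B. ?P B \<Longrightarrow> V \<subseteq> B \<Longrightarrow> B = V" by blast
  have "(\<one>, \<one>\<^bsub>R\<^esub>) \<in> V"
  proof (rule ccontr)
    assume 1: "(\<one>, \<one>\<^bsub>R\<^esub>) \<notin> V"
    \<comment> \<open>Annihilators of the nonzero cyclic graded submodules of \<open>R / V\<close>;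
      a maximal one is prime, by the usual argument for associated primes.\<close>
    define P' where "P' A \<longleftrightarrow> (\<exists>g\<in>carrier G. \<exists>x\<in>\<R> g. (g, x) \<notin> V \<and> A = hcore V g x)" for A
    have "\<exists>A. P' A \<and> hcore V \<one> \<one>\<^bsub>R\<^esub> \<subseteq> A \<and> (\<forall>B. P' B \<longrightarrow> A \<subseteq> B \<longrightarrow> B = A)"
    proof (rule ACC_maximal[OF acc])
      show "P' (hcore V \<one> \<one>\<^bsub>R\<^esub>)" using 1 deg_one by (auto simp: P'_def)
      show "A \<in> Collect lid" if "P' A" for A using that lid_hcore[OF V] by (auto simp: P'_def)
    qed
    then obtain A where A: "P' A" "\<And>B. P' B \<Longrightarrow> A \<subseteq> B \<Longrightarrow> B = A" by blast
    then obtain g x where g: "g \<in> carrier G" "x \<in> \<R> g" and x: "(g, x) \<notin> V" and Ax: "A = hcore V g x"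
      by (auto simp: P'_def)
    have xc: "x \<in> carrier R" using g deg_carrier by blast
    have "prime A"
      unfolding hprime_def
    proof (intro conjI ballI impI)
      show "lid A" "rid A" using lid_hcore[OF V g] rid_hcore[OF V g] Ax by auto
      show "(\<one>, \<one>\<^bsub>R\<^esub>) \<notin> A"
      proof
        assume "(\<one>, \<one>\<^bsub>R\<^esub>) \<in> A"
        then have "(\<one> \<otimes> \<one> \<otimes> g, \<one>\<^bsub>R\<^esub> \<cdot> \<one>\<^bsub>R\<^esub> \<cdot> x) \<in> V"
          unfolding Ax by (rule hcoreD) (auto simp: deg_one)
        then show False using x g xc by simp
      qed
      fix i a j b assume i: "i \<in> carrier G" "a \<in> \<R> i" and j: "j \<in> carrier G" "b \<in> \<R> j"
        and ab: "\<forall>k\<in>carrier G. \<forall>r\<in>\<R> k. (i \<otimes> k \<otimes> j, a \<cdot> r \<cdot> b) \<in> A"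
      have c: "a \<in> carrier R" "b \<in> carrier R" using i j deg_carrier by auto
      show "(i, a) \<in> A \<or> (j, b) \<in> A"
      proof (rule disjCI)
        assume "(j, b) \<notin> A"
        then obtain h s where h: "h \<in> carrier G" "s \<in> \<R> h" and y: "(j \<otimes> h \<otimes> g, b \<cdot> s \<cdot> x) \<notin> V"
          using j by (auto simp: Ax hcore_def)
        have sc: "s \<in> carrier R" using h deg_carrier by blast
        have yd: "j \<otimes> h \<otimes> g \<in> carrier G" "b \<cdot> s \<cdot> x \<in> \<R> (j \<otimes> h \<otimes> g)"
          using j h g by (auto intro: mult_degree)
        \<comment> \<open>The class of \<open>b s x\<close> generates a nonzero submodule of the one
          generated by \<open>x\<close>, so by maximality both have the annihilator
          \<open>A\<close>. That \<open>a R b\<close> is inside \<open>A\<close> makes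
          \<open>a\<close> annihilate the smaller one.\<close>
        have "A \<subseteq> hcore V (j \<otimes> h \<otimes> g) (b \<cdot> s \<cdot> x)"
        proof clarify
          fix k r assume r: "(k, r) \<in> A"
          note kr = hcore_deg[OF r[unfolded Ax]]
          show "(k, r) \<in> hcore V (j \<otimes> h \<otimes> g) (b \<cdot> s \<cdot> x)"
          proof (rule hcoreI[OF kr])
            fix l t assume l: "l \<in> carrier G" "t \<in> \<R> l"
            have "(k \<otimes> (l \<otimes> j \<otimes> h) \<otimes> g, r \<cdot> (t \<cdot> b \<cdot> s) \<cdot> x) \<in> V"
              using r l j h unfolding Ax by (intro hcoreD mult_degree) auto
            moreover have "t \<in> carrier R" "r \<in> carrier R" using l kr deg_carrier by auto
            ultimately show "(k \<otimes> l \<otimes> (j \<otimes> h \<otimes> g), r \<cdot> t \<cdot> (b \<cdot> s \<cdot> x)) \<in> V"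
              using c sc xc l j h g kr by (simp add: G.m_assoc R.m_assoc)
          qed
        qed
        then have eq: "hcore V (j \<otimes> h \<otimes> g) (b \<cdot> s \<cdot> x) = A"
          using A(2) yd y unfolding P'_def by blast
        have "(i, a) \<in> hcore V (j \<otimes> h \<otimes> g) (b \<cdot> s \<cdot> x)"
        proof (rule hcoreI[OF i])
          fix l t assume l: "l \<in> carrier G" "t \<in> \<R> l"
          have "(i \<otimes> l \<otimes> j, a \<cdot> t \<cdot> b) \<in> hcore V g x" using ab l Ax by blast
          then have "(i \<otimes> l \<otimes> j \<otimes> h \<otimes> g, a \<cdot> t \<cdot> b \<cdot> s \<cdot> x) \<in> V" by (rule hcoreD[OF _ h])
          moreover have "t \<in> carrier R" using l deg_carrier by auto
          ultimately show "(i \<otimes> l \<otimes> (j \<otimes> h \<otimes> g), a \<cdot> t \<cdot> (b \<cdot> s \<cdot> x)) \<in> V"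
            using c sc xc l i j h g by (simp add: G.m_assoc R.m_assoc)
        qed
        then show "(i, a) \<in> A" using eq by simp
      qed
    qed
    then obtain e where "lmin A e" using primes by blast
    then have e1: "e \<in> \<R> \<one>" and eA: "(\<one>, e) \<notin> A"
      and min: "\<And>h r. h \<in> carrier G \<Longrightarrow> r \<in> \<R> h \<Longrightarrow> (h, r \<cdot> e) \<notin> A \<Longrightarrow>
        \<exists>k\<in>carrier G. \<exists>t\<in>\<R> k. k \<otimes> h = \<one> \<and> (\<one>, t \<cdot> r \<cdot> e \<boxminus> e) \<in> A"
      unfolding left_minimal_def by blast+
    \<comment> \<open>As \<open>e\<close> is outside \<open>A\<close>, some \<open>e s x\<close> is
      outside \<open>V\<close>. It generates a simple submodule modulo \<open>V\<close>: if
      \<open>r e s x\<close> is outside \<open>V\<close>, then \<open>r e\<close> is outside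
      \<open>A\<close>, and some \<open>t r e\<close> is congruent to \<open>e\<close> modulo
      \<open>A\<close>.\<close>
    obtain h s where h: "h \<in> carrier G" "s \<in> \<R> h" and "(\<one> \<otimes> h \<otimes> g, e \<cdot> s \<cdot> x) \<notin> V"
      using eA e1 by (auto simp: Ax hcore_def)
    then have y: "(h \<otimes> g, e \<cdot> s \<cdot> x) \<notin> V" using g by simp
    have c: "e \<in> carrier R" "s \<in> carrier R" using e1 h deg_carrier by auto
    have m: "h \<otimes> g \<in> carrier G" "e \<cdot> s \<cdot> x \<in> \<R> (h \<otimes> g)"
      using mult_degree[of h g "e \<cdot> s" x] mult_degree[of \<one> h e s] h g e1 by auto
    let ?W = "V \<boxplus>\<^sub>H lgen (h \<otimes> g) (e \<cdot> s \<cdot> x)"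
    have "satisfies_DCC {X. lid X \<and> X \<subseteq> ?W}"
    proof (rule DCC_below_extend[OF V m _ dcc])
      fix k r assume k: "k \<in> carrier G" "r \<in> \<R> k" and ry: "(k \<otimes> (h \<otimes> g), r \<cdot> (e \<cdot> s \<cdot> x)) \<notin> V"
      have rc: "r \<in> carrier R" using k deg_carrier by auto
      have "(k, r \<cdot> e) \<notin> A"
      proof
        assume "(k, r \<cdot> e) \<in> A"
        then have "(k \<otimes> h \<otimes> g, r \<cdot> e \<cdot> s \<cdot> x) \<in> V" unfolding Ax by (rule hcoreD[OF _ h])
        then show False using ry c rc xc k h g by (simp add: G.m_assoc R.m_assoc)
      qed
      then obtain i t where t: "i \<in> carrier G" "t \<in> \<R> i" "i \<otimes> k = \<one>" "(\<one>, t \<cdot> r \<cdot> e \<boxminus> e) \<in> A"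
        using min[OF k] by blast
      have "(\<one> \<otimes> h \<otimes> g, (t \<cdot> r \<cdot> e \<boxminus> e) \<cdot> s \<cdot> x) \<in> V"
        using t(4) unfolding Ax by (rule hcoreD[OF _ h])
      moreover have "t \<in> carrier R" using t deg_carrier by auto
      then have "(t \<cdot> r \<cdot> e \<boxminus> e) \<cdot> s \<cdot> x = t \<cdot> r \<cdot> (e \<cdot> s \<cdot> x) \<boxminus> e \<cdot> s \<cdot> x"
        using c rc xc by (simp add: R.minus_eq R.l_distr R.l_minus R.m_assoc)
      ultimately show "\<exists>i\<in>carrier G. \<exists>t\<in>\<R> i. i \<otimes> k = \<one> \<and> (h \<otimes> g, t \<cdot> r \<cdot> (e \<cdot> s \<cdot> x) \<boxminus> e \<cdot> s \<cdot> x) \<in> V"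
        using t h g by auto
    qed
    moreover have "lid ?W" by (intro lid_hsum V lid_lgen m)
    moreover have "V \<subseteq> ?W" by (intro lid_hsum_upper V lid_lgen m)
    ultimately have "?W = V" using max by blast
    moreover have "(h \<otimes> g, e \<cdot> s \<cdot> x) \<in> ?W"
      using lid_hsum_upper(2)[OF V lid_lgen[OF m]] lgen_self[OF m] by blast
    ultimately show False using y by simp
  qed
  then have "V = E" by (rule lid_eq_E[OF V])
  then have "{X. lid X \<and> X \<subseteq> V} = Collect lid" using lid_subset by blast
  then show ?thesis using dcc by simp
qed

theorem right_Artinian_if_right_Noetherian:
  assumes acc: "satisfies_ACC (Collect rid)" and primes: "\<And>Q. prime Q \<Longrightarrow> \<exists>e. rmin Q e"
  shows "satisfies_DCC (Collect rid)"
  using graded_ring.left_Artinian_if_left_Noetherian[OF graded_ring_op] assms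
  by (simp add: hright_def[abs_def] prime_op left_minimal_op)

end

text \<open>The formula comes from \<open>1 - j = (1 - f) (1 - e)\<close>. The right ideal generated
  by \<open>j\<close> contains \<open>e\<close> and \<open>f\<close>, which is how idempotents are
  enlarged.\<close>

lemma (in ring) idempotent_join:
  assumes [simp]: "e \<in> carrier R" "f \<in> carrier R"
    and e: "e \<otimes> e = e" and f: "f \<otimes> f = f" and ef: "e \<otimes> f = \<zero>"
  defines "j \<equiv> e \<oplus> f \<ominus> f \<otimes> e"
  shows "j \<otimes> e = e" "j \<otimes> f = f" "j \<otimes> j = j"
proof -
  have [simp]: "j \<in> carrier R" by (simp add: j_def)
  have "f \<otimes> e \<otimes> e = f \<otimes> e" by (simp add: m_assoc e)
  then show je: "j \<otimes> e = e"
    by (simp add: j_def minus_eq l_distr l_minus e a_assoc r_neg)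
  have "f \<otimes> e \<otimes> f = \<zero>" by (simp add: m_assoc ef)
  then show jf: "j \<otimes> f = f"
    by (simp add: j_def minus_eq l_distr l_minus f ef)
  have "j \<otimes> j = j \<otimes> e \<oplus> j \<otimes> f \<ominus> j \<otimes> f \<otimes> e"
    by (subst (2) j_def) (simp add: minus_eq r_distr r_minus m_assoc)
  also have "\<dots> = j" by (simp only: je jf) (simp only: j_def)
  finally show "j \<otimes> j = j" .
qed

context graded_ring
begin

section \<open>Minimal idempotents from the ascending chain condition on left ideals\<close>

lemma ann_singleton: "(h, r) \<in> annl {(k, a)} \<longleftrightarrow> h \<in> carrier G \<and> r \<in> \<R> h \<and> r \<cdot> a = \<zero>\<^bsub>R\<^esub>"
  by (auto simp: hann_l_def)

text \<open>Passing from \<open>a\<close> to \<open>a r\<close> enlarges the left annihilator, and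
  by self-injectivity equal left annihilators mean equal principal right ideals. So a multiple
  \<open>a\<close> of \<open>c\<close> outside \<open>Q\<close> with maximal left annihilator
  generates a right ideal that is minimal relative to \<open>Q\<close>.\<close>

lemma has_right_minimal_if_left_Noetherian:
  assumes baer: "baer G R \<R>" and acc: "satisfies_ACC (Collect lid)" and Q: "prime Q"
  shows "hrmin Q"
  unfolding has_right_minimal_def
proof (intro ballI impI)
  fix g c assume g: "g \<in> carrier G" "c \<in> \<R> g" and cQ: "(g, c) \<notin> Q"
  have cc: "c \<in> carrier R" using g deg_carrier by blast
  define P' where "P' L \<longleftrightarrow> (\<exists>h\<in>carrier G. \<exists>w\<in>\<R> h. (g \<otimes> h, c \<cdot> w) \<notin> Q \<and> L = annl {(g \<otimes> h, c \<cdot> w)})" for L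
  have "\<exists>L. P' L \<and> annl {(g, c)} \<subseteq> L \<and> (\<forall>B. P' B \<longrightarrow> L \<subseteq> B \<longrightarrow> B = L)"
  proof (rule ACC_maximal[OF acc])
    show "P' (annl {(g, c)})"
      unfolding P'_def using g cc cQ deg_one by (intro bexI[of _ \<one>] bexI[of _ "\<one>\<^bsub>R\<^esub>"]) auto
    show "L \<in> Collect lid" if "P' L" for L
      using that g mult_degree unfolding P'_def by (auto intro!: lid_annl)
  qed
  then obtain L where L: "P' L" "\<And>B. P' B \<Longrightarrow> L \<subseteq> B \<Longrightarrow> B = L" by blast
  then obtain h0 w0 where h0: "h0 \<in> carrier G" "w0 \<in> \<R> h0" and aQ': "(g \<otimes> h0, c \<cdot> w0) \<notin> Q"
    and La: "L = annl {(g \<otimes> h0, c \<cdot> w0)}" unfolding P'_def by blast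
  define g' a where "g' = g \<otimes> h0" and "a = c \<cdot> w0"
  have w0c: "w0 \<in> carrier R" using h0 deg_carrier by blast
  have g': "g' \<in> carrier G" "a \<in> \<R> g'" and aQ: "(g', a) \<notin> Q"
    using g h0 aQ' mult_degree by (auto simp: g'_def a_def)
  have ac: "a \<in> carrier R" using g' deg_carrier by blast
  have min: "\<exists>j\<in>carrier G. \<exists>t\<in>\<R> j. g' = g' \<otimes> k \<otimes> j \<and> a = a \<cdot> r \<cdot> t"
    if k: "k \<in> carrier G" "r \<in> \<R> k" and ar: "(g' \<otimes> k, a \<cdot> r) \<notin> Q" for k r
  proof -
    have rc: "r \<in> carrier R" using k deg_carrier by blast
    have ark: "g' \<otimes> k \<in> carrier G" "a \<cdot> r \<in> \<R> (g' \<otimes> k)" using g' k mult_degree by auto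
    have eq: "(g' \<otimes> k, a \<cdot> r) = (g \<otimes> (h0 \<otimes> k), c \<cdot> (w0 \<cdot> r))"
      using g h0 k cc w0c rc by (simp add: g'_def a_def G.m_assoc R.m_assoc)
    have "h0 \<otimes> k \<in> carrier G" "w0 \<cdot> r \<in> \<R> (h0 \<otimes> k)" using h0 k mult_degree by auto
    then have "P' (annl {(g' \<otimes> k, a \<cdot> r)})" using ar unfolding P'_def eq by blast
    moreover have "L \<subseteq> annl {(g' \<otimes> k, a \<cdot> r)}"
    proof clarify
      fix h s assume "(h, s) \<in> L"
      then have s: "h \<in> carrier G" "s \<in> \<R> h" "s \<cdot> a = \<zero>\<^bsub>R\<^esub>"
        unfolding La by (simp_all add: ann_singleton a_def)
      then have "s \<in> carrier R" using deg_carrier by blast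
      then have "s \<cdot> (a \<cdot> r) = s \<cdot> a \<cdot> r" using ac rc by (simp add: R.m_assoc)
      then show "(h, s) \<in> annl {(g' \<otimes> k, a \<cdot> r)}" using s rc by (simp add: ann_singleton)
    qed
    ultimately have "annl {(g' \<otimes> k, a \<cdot> r)} = L" using L(2) by blast
    then have "annl {(g' \<otimes> k, a \<cdot> r)} \<subseteq> annl {(g', a)}" by (simp add: La g'_def a_def)
    then have "(g', a) \<in> rgen (g' \<otimes> k) (a \<cdot> r)" by (rule baer_principal[OF baer ark g'])
    then show ?thesis by (metis rgenE)
  qed
  \<comment> \<open>Primeness gives \<open>a v a\<close> outside \<open>Q\<close>, so
    \<open>a = a v a t\<close> by minimality. Then \<open>e = a t v\<close> satisfies
    \<open>a v e = a v\<close>, and it inherits minimality from \<open>a\<close>.\<close>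
  obtain p v where p: "p \<in> carrier G" "v \<in> \<R> p" and avaQ: "(g' \<otimes> p \<otimes> g', a \<cdot> v \<cdot> a) \<notin> Q"
    by (rule primeE[OF Q g' aQ g' aQ])
  have vc: "v \<in> carrier R" using p deg_carrier by blast
  have va: "p \<otimes> g' \<in> carrier G" "v \<cdot> a \<in> \<R> (p \<otimes> g')" using p g' mult_degree by auto
  have "(g' \<otimes> (p \<otimes> g'), a \<cdot> (v \<cdot> a)) \<notin> Q" using avaQ g' p ac vc by (simp add: G.m_assoc R.m_assoc)
  from min[OF va this] obtain j t where j: "j \<in> carrier G" "t \<in> \<R> j"
    and gj: "g' = g' \<otimes> (p \<otimes> g') \<otimes> j" and a_eq: "a = a \<cdot> (v \<cdot> a) \<cdot> t" by blast
  have tc: "t \<in> carrier R" using j deg_carrier by blast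
  have "g' \<otimes> (p \<otimes> (g' \<otimes> j)) = g'" using gj g' p j by (simp add: G.m_assoc)
  then have "p \<otimes> (g' \<otimes> j) = \<one>" using g' p j by simp
  then have "g' \<otimes> j = inv p" using g' p j by (metis G.inv_equality G.inv_inv G.m_closed G.l_inv G.inv_comm)
  then have deg1: "g' \<otimes> j \<otimes> p = \<one>" using p by simp
  define tv where "tv = t \<cdot> v"
  have tv: "j \<otimes> p \<in> carrier G" "tv \<in> \<R> (j \<otimes> p)" using j p mult_degree by (auto simp: tv_def)
  have tvc: "tv \<in> carrier R" using tc vc by (simp add: tv_def)
  define e where "e = a \<cdot> tv"
  have deg1': "g' \<otimes> (j \<otimes> p) = \<one>" using deg1 g' j p by (simp add: G.m_assoc)
  have e1: "e \<in> \<R> \<one>" using mult_degree[OF g'(1) tv(1) g'(2) tv(2)] deg1' by (simp add: e_def)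
  have ec: "e \<in> carrier R" using e1 deg_carrier by blast
  have av: "g' \<otimes> p \<in> carrier G" "a \<cdot> v \<in> \<R> (g' \<otimes> p)" using g' p mult_degree by auto
  have ave: "a \<cdot> v \<cdot> e = a \<cdot> v"
  proof -
    have "a \<cdot> v \<cdot> e = a \<cdot> (v \<cdot> a) \<cdot> t \<cdot> v"
      using ac vc tc by (simp add: e_def tv_def R.m_assoc)
    then show ?thesis using a_eq by simp
  qed
  have eQ: "(\<one>, e) \<notin> Q"
  proof
    assume "(\<one>, e) \<in> Q"
    then have "(g' \<otimes> p \<otimes> \<one>, a \<cdot> v \<cdot> e) \<in> Q" using lid_mult[OF primeD(1)[OF Q] av] by blast
    then have "(g' \<otimes> p, a \<cdot> v) \<in> Q" using ave av by simp
    then show False using rid_mult[OF primeD(2)[OF Q] g'] avaQ by blast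
  qed
  \<comment> \<open>Idempotency is obtained modulo \<open>Q\<close>: if \<open>e e - e = a u\<close>
    were outside, then \<open>a = a u s\<close> and \<open>a v a = a v (e e - e) s = 0\<close>,
    because \<open>a v e = a v\<close>.\<close>
  have "(\<one>, e \<cdot> e \<boxminus> e) \<in> Q"
  proof (rule ccontr)
    define u where "u = tv \<cdot> e \<boxminus> tv"
    assume "(\<one>, e \<cdot> e \<boxminus> e) \<notin> Q"
    moreover have eeu: "e \<cdot> e \<boxminus> e = a \<cdot> u"
      using ac tvc ec by (simp add: u_def e_def R.minus_eq R.r_distr R.r_minus R.m_assoc)
    ultimately have auQ: "(g' \<otimes> (j \<otimes> p), a \<cdot> u) \<notin> Q" using deg1' by simp
    have "tv \<cdot> e \<in> \<R> (j \<otimes> p)" using mult_degree[OF tv(1) G.one_closed tv(2) e1] tv by simp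
    then have u: "u \<in> \<R> (j \<otimes> p)" unfolding u_def using tv deg_minus by blast
    have uc: "u \<in> carrier R" using u tv deg_carrier by blast
    obtain i s where s: "i \<in> carrier G" "s \<in> \<R> i" "a = a \<cdot> u \<cdot> s" using min[OF tv(1) u auQ] by blast
    have sc: "s \<in> carrier R" using s deg_carrier by blast
    have "a \<cdot> v \<cdot> a = a \<cdot> v \<cdot> (a \<cdot> u \<cdot> s)" using s(3) by simp
    also have "\<dots> = (a \<cdot> v \<cdot> (e \<cdot> e \<boxminus> e)) \<cdot> s" using ac vc uc sc eeu by (simp add: R.m_assoc)
    also have "a \<cdot> v \<cdot> (e \<cdot> e \<boxminus> e) = a \<cdot> v \<cdot> e \<cdot> e \<boxminus> a \<cdot> v \<cdot> e"
      using ac vc ec by (simp add: R.minus_eq R.r_distr R.r_minus R.m_assoc)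
    also have "\<dots> = \<zero>\<^bsub>R\<^esub>" using ave ac vc by (simp add: R.minus_eq R.r_neg)
    finally have "a \<cdot> v \<cdot> a = \<zero>\<^bsub>R\<^esub>" using sc by simp
    then show False using avaQ lid_zero[OF primeD(1)[OF Q]] g' p by simp
  qed
  moreover have "\<exists>k\<in>carrier G. \<exists>s\<in>\<R> k. h \<otimes> k = \<one> \<and> (\<one>, e \<cdot> r \<cdot> s \<boxminus> e) \<in> Q"
    if h: "h \<in> carrier G" "r \<in> \<R> h" and er: "(h, e \<cdot> r) \<notin> Q" for h r
  proof -
    have rc: "r \<in> carrier R" using h deg_carrier by blast
    have tvr: "j \<otimes> p \<otimes> h \<in> carrier G" "tv \<cdot> r \<in> \<R> (j \<otimes> p \<otimes> h)" using tv h mult_degree by auto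
    have er': "a \<cdot> (tv \<cdot> r) = e \<cdot> r" using ac tvc rc by (simp add: e_def R.m_assoc)
    have h': "g' \<otimes> (j \<otimes> p \<otimes> h) = h"
    proof -
      have "g' \<otimes> (j \<otimes> p \<otimes> h) = g' \<otimes> (j \<otimes> p) \<otimes> h" using g' tv h j p by (simp add: G.m_assoc)
      then show ?thesis using deg1' h by simp
    qed
    obtain i s where s: "i \<in> carrier G" "s \<in> \<R> i" "g' = h \<otimes> i" "a = e \<cdot> r \<cdot> s"
      using min[OF tvr] er unfolding er' h' by blast
    have sc: "s \<in> carrier R" using s deg_carrier by blast
    have "e = e \<cdot> r \<cdot> s \<cdot> tv" by (rule trans[OF e_def arg_cong[OF s(4), of "\<lambda>x. x \<cdot> tv"]])
    then have "e = e \<cdot> r \<cdot> (s \<cdot> tv)" using ec rc sc tvc by (simp add: R.m_assoc)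
    then have "e \<cdot> r \<cdot> (s \<cdot> tv) \<boxminus> e = \<zero>\<^bsub>R\<^esub>" using ec by (simp add: R.minus_eq R.r_neg)
    moreover have "h \<otimes> (i \<otimes> (j \<otimes> p)) = \<one>"
      using deg1' h s tv j p by (simp add: G.m_assoc)
    moreover have "i \<otimes> (j \<otimes> p) \<in> carrier G" "s \<cdot> tv \<in> \<R> (i \<otimes> (j \<otimes> p))"
      using s(1,2) tv mult_degree by auto
    ultimately show ?thesis using lid_zero[OF primeD(1)[OF Q] G.one_closed] by metis
  qed
  ultimately have "rmin Q e" using e1 eQ unfolding right_minimal_def by blast
  moreover have "e = c \<cdot> (w0 \<cdot> tv)" using cc w0c tvc by (simp add: e_def a_def R.m_assoc)
  moreover have "h0 \<otimes> (j \<otimes> p) \<in> carrier G" "w0 \<cdot> tv \<in> \<R> (h0 \<otimes> (j \<otimes> p))"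
    using h0 tv mult_degree by auto
  moreover have "g \<otimes> (h0 \<otimes> (j \<otimes> p)) = \<one>" using deg1' g h0 tv j p by (simp add: g'_def G.m_assoc)
  ultimately show "\<exists>h\<in>carrier G. \<exists>w\<in>\<R> h. g \<otimes> h = \<one> \<and> rmin Q (c \<cdot> w)" by metis
qed

text \<open>For \<open>x\<close> in \<open>K\<close> outside \<open>Q\<close>, primeness and
  minimality make some \<open>e r x t\<close>, which lies in \<open>K\<close>, congruent to
  \<open>e\<close> modulo \<open>Q\<close>.\<close>

lemma right_minimal_in_overideal:
  assumes Q: "prime Q" and e: "rmin Q e" and K: "lid K" "rid K" "Q \<subseteq> K" "K \<noteq> Q"
  shows "(\<one>, e) \<in> K"
proof -
  have e1: "e \<in> \<R> \<one>" and eQ: "(\<one>, e) \<notin> Q" using e by (auto simp: right_minimal_def)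
  have ec: "e \<in> carrier R" using e1 deg_carrier by blast
  obtain k x where x: "(k, x) \<in> K" "(k, x) \<notin> Q" using K by auto
  note k = lid_deg[OF K(1) x(1)]
  have xc: "x \<in> carrier R" using k deg_carrier by blast
  obtain l r where r: "l \<in> carrier G" "r \<in> \<R> l" "(\<one> \<otimes> l \<otimes> k, e \<cdot> r \<cdot> x) \<notin> Q"
    by (rule primeE[OF Q G.one_closed e1 eQ k x(2)])
  have rc: "r \<in> carrier R" using r deg_carrier by blast
  have rx: "(l \<otimes> k, r \<cdot> x) \<in> K" using lid_mult[OF K(1) r(1,2) x(1)] .
  note lk = lid_deg[OF K(1) rx]
  have "(l \<otimes> k, e \<cdot> (r \<cdot> x)) \<notin> Q" using r k ec rc xc by (simp add: R.m_assoc)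
  then obtain i t where t: "i \<in> carrier G" "t \<in> \<R> i" "l \<otimes> k \<otimes> i = \<one>" "(\<one>, e \<cdot> (r \<cdot> x) \<cdot> t \<boxminus> e) \<in> Q"
    using e lk unfolding right_minimal_def by blast
  have tc: "t \<in> carrier R" using t deg_carrier by blast
  have "(\<one> \<otimes> (l \<otimes> k) \<otimes> i, e \<cdot> (r \<cdot> x) \<cdot> t) \<in> K"
    using rid_mult[OF K(2) t(1,2) lid_mult[OF K(1) G.one_closed e1 rx]] .
  then have "(\<one>, e \<cdot> (r \<cdot> x) \<cdot> t) \<in> K" using t lk by simp
  then have "(\<one>, e \<cdot> (r \<cdot> x) \<cdot> t \<boxminus> (e \<cdot> (r \<cdot> x) \<cdot> t \<boxminus> e)) \<in> K" using t(4) K lid_minus by blast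
  moreover have "e \<cdot> (r \<cdot> x) \<cdot> t \<boxminus> (e \<cdot> (r \<cdot> x) \<cdot> t \<boxminus> e) = e"
    using ec rc xc tc by (simp add: R.minus_eq R.minus_add R.a_assoc[symmetric] R.r_neg)
  ultimately show ?thesis by simp
qed

text \<open>Choose \<open>e\<close> in \<open>K\<close>, idempotent modulo \<open>Q\<close>, with
  \<open>Q + e R\<close> maximal. If \<open>1 - e\<close> is outside \<open>Q\<close>, a minimal
  idempotent \<open>f\<close> in \<open>(1 - e) R\<close> also lies in \<open>K\<close> and can be
  joined to \<open>e\<close>, against maximality.\<close>

lemma prime_maximal:
  assumes acc: "satisfies_ACC (Collect rid)" and Q: "prime Q" and hrm: "hrmin Q"
    and K: "lid K" "rid K" "Q \<subseteq> K" "K \<noteq> Q"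
  shows "(\<one>, \<one>\<^bsub>R\<^esub>) \<in> K"
proof -
  note lQ = primeD(1)[OF Q] and rQ = primeD(2)[OF Q]
  obtain B :: "'r set ring" and \<rho> where B: "ring B" and hom: "\<rho> \<in> ring_hom R B"
    and \<rho>0: "\<And>g x. g \<in> carrier G \<Longrightarrow> x \<in> \<R> g \<Longrightarrow> (g, x) \<in> Q \<longleftrightarrow> \<rho> x = \<zero>\<^bsub>B\<^esub>"
    and \<rho>eq: "\<And>g x y. g \<in> carrier G \<Longrightarrow> x \<in> \<R> g \<Longrightarrow> y \<in> \<R> g \<Longrightarrow> (g, x \<boxminus> y) \<in> Q \<longleftrightarrow> \<rho> x = \<rho> y"
    by (rule quotient_hom[OF primeD(1,2)[OF Q]]) (rule that)
  interpret B: ring B by (rule B)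
  interpret \<rho>: ring_hom_ring R B \<rho> by (rule ring_hom_ringI2[OF R.ring_axioms B hom])
  have mult1: "x \<cdot> y \<in> \<R> \<one>" if "x \<in> \<R> \<one>" "y \<in> \<R> \<one>" for x y
    using mult_degree[of \<one> \<one> x y] that by simp
  have c1: "x \<in> carrier R" if "x \<in> \<R> \<one>" for x using that deg_carrier by blast
  define P' where "P' A \<longleftrightarrow> (\<exists>e\<in>\<R> \<one>. (\<one>, e) \<in> K \<and> (\<one>, e \<cdot> e \<boxminus> e) \<in> Q \<and> A = Q \<boxplus>\<^sub>H rgen \<one> e)" for A
  have "\<exists>A. P' A \<and> Q \<boxplus>\<^sub>H rgen \<one> \<zero>\<^bsub>R\<^esub> \<subseteq> A \<and> (\<forall>B. P' B \<longrightarrow> A \<subseteq> B \<longrightarrow> B = A)"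
  proof (rule ACC_maximal[OF acc])
    show "P' (Q \<boxplus>\<^sub>H rgen \<one> \<zero>\<^bsub>R\<^esub>)"
      unfolding P'_def using lid_zero[OF K(1)] lid_zero[OF lQ]
      by (intro bexI[of _ "\<zero>\<^bsub>R\<^esub>"]) (auto simp: dec.summand_zero R.minus_eq)
    show "A \<in> Collect rid" if "P' A" for A
      using that rQ unfolding P'_def by (auto intro!: rid_hsum rid_rgen)
  qed
  then obtain A where A: "P' A" "\<And>B. P' B \<Longrightarrow> A \<subseteq> B \<Longrightarrow> B = A" by blast
  then obtain e where e1: "e \<in> \<R> \<one>" and eK: "(\<one>, e) \<in> K" and ee: "(\<one>, e \<cdot> e \<boxminus> e) \<in> Q"
    and Ae: "A = Q \<boxplus>\<^sub>H rgen \<one> e" unfolding P'_def by blast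
  note ec = c1[OF e1]
  have \<rho>e: "\<rho> e \<otimes>\<^bsub>B\<^esub> \<rho> e = \<rho> e" using ee \<rho>eq[OF G.one_closed mult1[OF e1 e1] e1] ec by simp
  have "(\<one>, \<one>\<^bsub>R\<^esub> \<boxminus> e) \<in> Q"
  proof (rule ccontr)
    assume c: "(\<one>, \<one>\<^bsub>R\<^esub> \<boxminus> e) \<notin> Q"
    have d: "\<one>\<^bsub>R\<^esub> \<boxminus> e \<in> \<R> \<one>" using deg_one e1 deg_minus by blast
    obtain h w where h: "h \<in> carrier G" "w \<in> \<R> h" "\<one> \<otimes> h = \<one>" and f: "rmin Q ((\<one>\<^bsub>R\<^esub> \<boxminus> e) \<cdot> w)"
      using hrm d c unfolding has_right_minimal_def by blast
    have w1: "w \<in> \<R> \<one>" using h by simp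
    note wc = c1[OF w1]
    define f where "f = (\<one>\<^bsub>R\<^esub> \<boxminus> e) \<cdot> w"
    have fr: "rmin Q f" using f by (simp add: f_def)
    have f1: "f \<in> \<R> \<one>" and fQ: "(\<one>, f) \<notin> Q" and ff: "(\<one>, f \<cdot> f \<boxminus> f) \<in> Q"
      using fr unfolding right_minimal_def by blast+
    note fc = c1[OF f1]
    have fK: "(\<one>, f) \<in> K" by (rule right_minimal_in_overideal[OF Q fr K])
    have \<rho>f: "\<rho> f \<otimes>\<^bsub>B\<^esub> \<rho> f = \<rho> f" using ff \<rho>eq[OF G.one_closed mult1[OF f1 f1] f1] fc by simp
    have "\<rho> e \<otimes>\<^bsub>B\<^esub> \<rho> f = (\<rho> e \<ominus>\<^bsub>B\<^esub> \<rho> e \<otimes>\<^bsub>B\<^esub> \<rho> e) \<otimes>\<^bsub>B\<^esub> \<rho> w"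
      using ec wc by (simp add: f_def R.minus_eq B.minus_eq B.l_distr B.r_distr B.l_minus B.r_minus
          B.m_assoc[symmetric])
    then have \<rho>ef: "\<rho> e \<otimes>\<^bsub>B\<^esub> \<rho> f = \<zero>\<^bsub>B\<^esub>" using \<rho>e ec wc by (simp add: B.minus_eq B.r_neg)
    define e' where "e' = e \<boxplus> f \<boxminus> f \<cdot> e"
    have e'1: "e' \<in> \<R> \<one>"
      unfolding e'_def using e1 f1 mult1 dec.summand_add deg_minus by (metis G.one_closed)
    note e'c = c1[OF e'1]
    have \<rho>e': "\<rho> e' = \<rho> e \<oplus>\<^bsub>B\<^esub> \<rho> f \<ominus>\<^bsub>B\<^esub> \<rho> f \<otimes>\<^bsub>B\<^esub> \<rho> e"
      using ec fc by (simp add: e'_def R.minus_eq B.minus_eq)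
    have join: "\<rho> e' \<otimes>\<^bsub>B\<^esub> \<rho> e = \<rho> e" "\<rho> e' \<otimes>\<^bsub>B\<^esub> \<rho> f = \<rho> f" "\<rho> e' \<otimes>\<^bsub>B\<^esub> \<rho> e' = \<rho> e'"
      unfolding \<rho>e' using B.idempotent_join[OF _ _ \<rho>e \<rho>f \<rho>ef] ec fc by auto
    have e'K: "(\<one>, e') \<in> K"
      unfolding e'_def
      using lid_minus[OF K(1) lid_add[OF K(1) eK fK]] lid_mult[OF K(1) G.one_closed f1 eK] by simp
    have mem: "(\<one>, x) \<in> Q \<boxplus>\<^sub>H rgen \<one> e'" if x: "x \<in> \<R> \<one>" and ex: "\<rho> e' \<otimes>\<^bsub>B\<^esub> \<rho> x = \<rho> x" for x
    proof -
      note xc = c1[OF x]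
      have "(\<one>, x \<boxminus> e' \<cdot> x) \<in> Q"
        using \<rho>eq[OF G.one_closed x mult1[OF e'1 x]] ex e'c xc by simp
      moreover have "(\<one> \<otimes> \<one>, e' \<cdot> x) \<in> rgen \<one> e'" using x by (intro rgenI) auto
      ultimately have "(\<one>, x \<boxminus> e' \<cdot> x \<boxplus> e' \<cdot> x) \<in> Q \<boxplus>\<^sub>H rgen \<one> e'" by (intro hsumI) auto
      then show ?thesis using xc e'c by (simp add: R.minus_eq R.a_assoc R.l_neg)
    qed
    have re': "rid (Q \<boxplus>\<^sub>H rgen \<one> e')" by (intro rid_hsum rQ rid_rgen) (auto simp: e'1)
    have "A \<subseteq> Q \<boxplus>\<^sub>H rgen \<one> e'"
      unfolding Ae
      by (intro rid_hsum_least[OF re'] rgen_least[OF re'] mem e1 join rid_hsum_upper(1) rQ rid_rgen)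
        (auto simp: e'1)
    moreover have "P' (Q \<boxplus>\<^sub>H rgen \<one> e')"
      unfolding P'_def
    proof (intro bexI[of _ e'] conjI)
      show "(\<one>, e' \<cdot> e' \<boxminus> e') \<in> Q"
        using \<rho>eq[OF G.one_closed mult1[OF e'1 e'1] e'1] join e'c by simp
    qed (use e'1 e'K in auto)
    ultimately have "Q \<boxplus>\<^sub>H rgen \<one> e' = A" using A(2) by blast
    \<comment> \<open>Maximality puts \<open>f\<close> into \<open>Q + e R\<close>, so
      \<open>e f = f\<close> modulo \<open>Q\<close>, whereas \<open>e f = 0\<close> modulo
      \<open>Q\<close> by the choice of \<open>f\<close>.\<close>
    then have "(\<one>, f) \<in> Q \<boxplus>\<^sub>H rgen \<one> e" using mem[OF f1 join(2)] Ae by simp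
    then obtain q v where q: "(\<one>, q) \<in> Q" "(\<one>, v) \<in> rgen \<one> e" "f = q \<boxplus> v" by (rule hsumE)
    obtain h' z where z: "h' \<in> carrier G" "z \<in> \<R> h'" "v = e \<cdot> z" using q(2) by (rule rgenE)
    have zc: "z \<in> carrier R" using z deg_carrier by blast
    have q1: "q \<in> \<R> \<one>" using lid_deg[OF lQ q(1)] by blast
    have "\<rho> q = \<zero>\<^bsub>B\<^esub>" using \<rho>0[OF G.one_closed q1] q(1) by simp
    then have "\<rho> f = \<rho> e \<otimes>\<^bsub>B\<^esub> \<rho> z" using q(3) z(3) c1[OF q1] ec zc by simp
    then have "\<rho> e \<otimes>\<^bsub>B\<^esub> \<rho> f = \<rho> f" using \<rho>e ec zc by (simp add: B.m_assoc[symmetric])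
    then show False using \<rho>ef fQ \<rho>0[OF G.one_closed f1] by simp
  qed
  then have "(\<one>, \<one>\<^bsub>R\<^esub> \<boxminus> e \<boxplus> e) \<in> K" using K(3) eK lid_add[OF K(1)] by blast
  then show ?thesis using ec by (simp add: R.minus_eq R.a_assoc R.l_neg)
qed

section \<open>Annihilators of minimal two-sided ideals and maximal left ideals\<close>

lemma lid_Union_chain:
  assumes "C \<noteq> {}" "subset.chain A C" "\<And>X. X \<in> C \<Longrightarrow> lid X"
  shows "lid (\<Union>C)"
proof (rule lidI)
  show "(g, x \<boxplus> y) \<in> \<Union>C" if x: "(g, x) \<in> \<Union>C" and y: "(g, y) \<in> \<Union>C" for g x y
  proof -
    obtain X Y where X: "X \<in> C" "(g, x) \<in> X" and Y: "Y \<in> C" "(g, y) \<in> Y" using x y by blast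
    then have "X \<subseteq> Y \<or> Y \<subseteq> X" using assms(2) unfolding subset.chain_def by blast
    then show ?thesis
      using X Y lid_add[OF assms(3)[OF X(1)]] lid_add[OF assms(3)[OF Y(1)]] by blast
  qed
  show "g \<in> carrier G \<and> x \<in> \<R> g" if "(g, x) \<in> \<Union>C" for g x
    using that lid_deg[OF assms(3)] by blast
  show "(g, \<zero>\<^bsub>R\<^esub>) \<in> \<Union>C" if "g \<in> carrier G" for g
    using assms(1) lid_zero[OF assms(3) that] by blast
  show "(h \<otimes> g, r \<cdot> x) \<in> \<Union>C" if "h \<in> carrier G" "r \<in> \<R> h" "(g, x) \<in> \<Union>C" for h r g x
    using that(3) lid_mult[OF assms(3) that(1,2)] by blast
qed

text \<open>A pointwise condition is inherited by unions of chains. This serves for proper left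
  ideals and for left ideals on which a right multiplication is injective, in places where left
  ideals are not yet known to satisfy a chain condition.\<close>

lemma lid_maximal:
  assumes U: "lid U" "\<forall>x\<in>U. \<phi> x"
  shows "\<exists>M. lid M \<and> U \<subseteq> M \<and> (\<forall>x\<in>M. \<phi> x) \<and> (\<forall>X. lid X \<longrightarrow> M \<subseteq> X \<longrightarrow> (\<forall>x\<in>X. \<phi> x) \<longrightarrow> X = M)"
proof -
  let ?A = "{X. lid X \<and> U \<subseteq> X \<and> (\<forall>x\<in>X. \<phi> x)}"
  have "\<exists>M\<in>?A. \<forall>X\<in>?A. M \<subseteq> X \<longrightarrow> X = M"
  proof (rule subset_Zorn_nonempty)
    show "?A \<noteq> {}" using U by blast
    fix C assume C: "C \<noteq> {}" "subset.chain ?A C"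
    then have sub: "C \<subseteq> ?A" by (simp add: subset.chain_def)
    have "lid (\<Union>C)" using sub by (intro lid_Union_chain[OF C]) auto
    moreover have "U \<subseteq> \<Union>C" using sub C(1) by blast
    moreover have "\<forall>x\<in>\<Union>C. \<phi> x" using sub by blast
    ultimately show "\<Union>C \<in> ?A" by blast
  qed
  then show ?thesis by (smt (verit, best) mem_Collect_eq subset_trans)
qed

abbreviation tid where "tid N \<equiv> lid N \<and> rid N"

definition minimal_tid where
  "minimal_tid N \<longleftrightarrow> tid N \<and> N \<noteq> hzero \<and> (\<forall>X. tid X \<longrightarrow> X \<subseteq> N \<longrightarrow> X \<noteq> hzero \<longrightarrow> X = N)"

lemma tid_ann: "tid N \<Longrightarrow> tid (annl N)" "tid N \<Longrightarrow> tid (annr N)"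
  by (simp_all add: lid_annl rid_annl lid_annr rid_annr lid_subset)

lemma hzero_subset: "lid U \<Longrightarrow> hzero \<subseteq> U"
  using lid_zero by auto

lemma nonzero_element:
  assumes "lid N" "N \<noteq> hzero"
  obtains k n where "(k, n) \<in> N" "n \<noteq> \<zero>\<^bsub>R\<^esub>"
  using assms hzero_subset[OF assms(1)] lid_deg(1)[OF assms(1)] by fastforce

lemma one_notin_ann:
  assumes N: "tid N" "N \<noteq> hzero"
  shows "(\<one>, \<one>\<^bsub>R\<^esub>) \<notin> annl N" "(\<one>, \<one>\<^bsub>R\<^esub>) \<notin> annr N"
proof -
  obtain k n where n: "(k, n) \<in> N" "n \<noteq> \<zero>\<^bsub>R\<^esub>" using nonzero_element N by blast
  then have "n \<in> carrier R" using lid_deg N deg_carrier by metis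
  then show "(\<one>, \<one>\<^bsub>R\<^esub>) \<notin> annl N" "(\<one>, \<one>\<^bsub>R\<^esub>) \<notin> annr N"
    using annlD[OF _ n(1), of \<one> "\<one>\<^bsub>R\<^esub>"] annrD[OF _ n(1), of \<one> "\<one>\<^bsub>R\<^esub>"] n(2) by auto
qed

text \<open>If \<open>a R b N = 0\<close> and \<open>b N\<close> is nonzero, the part of
  \<open>N\<close> annihilated on the left by \<open>a R\<close> is a nonzero two-sided ideal, hence
  all of \<open>N\<close>, and \<open>a N = 0\<close>.\<close>

lemma prime_annl_minimal_tid:
  assumes N: "minimal_tid N"
  shows "prime (annl N)"
  unfolding hprime_def
proof (intro conjI ballI impI)
  have tN: "tid N" "N \<noteq> hzero" using N by (auto simp: minimal_tid_def)
  show "lid (annl N)" "rid (annl N)" "(\<one>, \<one>\<^bsub>R\<^esub>) \<notin> annl N"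
    using tid_ann(1)[OF tN(1)] one_notin_ann[OF tN] by auto
  fix g a h b assume g: "g \<in> carrier G" "a \<in> \<R> g" and h: "h \<in> carrier G" "b \<in> \<R> h"
    and ab: "\<forall>k\<in>carrier G. \<forall>r\<in>\<R> k. (g \<otimes> k \<otimes> h, a \<cdot> r \<cdot> b) \<in> annl N"
  have c: "a \<in> carrier R" "b \<in> carrier R" using g h deg_carrier by auto
  have Nc: "x \<in> carrier R" if "(k, x) \<in> N" for k x using lid_deg tN that deg_carrier by metis
  show "(g, a) \<in> annl N \<or> (h, b) \<in> annl N"
  proof (rule disjCI)
    assume "(h, b) \<notin> annl N"
    then obtain k n where n: "(k, n) \<in> N" "b \<cdot> n \<noteq> \<zero>\<^bsub>R\<^esub>" using h by (auto simp: hann_l_def)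
    note A = rid_rgen[OF g]
    define X where "X = N \<inter> annr (rgen g a)"
    have "(h \<otimes> k, b \<cdot> n) \<in> annr (rgen g a)"
    proof (rule annrI)
      fix i x assume "(i, x) \<in> rgen g a"
      then obtain l r where r: "l \<in> carrier G" "r \<in> \<R> l" "x = a \<cdot> r" by (rule rgenE)
      have "a \<cdot> r \<cdot> b \<cdot> n = \<zero>\<^bsub>R\<^esub>" using ab r annlD n(1) by blast
      then show "x \<cdot> (b \<cdot> n) = \<zero>\<^bsub>R\<^esub>" using c r Nc[OF n(1)] by (simp add: R.m_assoc deg_carrier)
    qed (use h lid_deg[OF _ n(1)] tN mult_degree in auto)
    then have "(h \<otimes> k, b \<cdot> n) \<in> X" using lid_mult[OF _ h n(1)] tN by (simp add: X_def)
    then have "X \<noteq> hzero" using n(2) by auto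
    moreover have "tid X" "X \<subseteq> N"
      using tN lid_annr[OF A] rid_annr[OF rid_subset[OF A]] by (simp_all add: X_def lid_Int rid_Int)
    ultimately have "X = N" using N unfolding minimal_tid_def by blast
    then have "N \<subseteq> annr (rgen g a)" unfolding X_def by blast
    then show "(g, a) \<in> annl N"
      using annrD[OF _ rgen_self[OF g]] by (intro annlI[OF g]) blast
  qed
qed

text \<open>\<open>M + R y\<close> contains 1. In other words, every nonzero homogeneous element of
  the simple module \<open>R / M\<close> generates it.\<close>

lemma maximal_left_inverse:
  assumes M: "lid M" and max: "\<forall>X. lid X \<longrightarrow> M \<subseteq> X \<longrightarrow> (\<one>, \<one>\<^bsub>R\<^esub>) \<notin> X \<longrightarrow> X = M"
    and m: "m \<in> carrier G" "y \<in> \<R> m" "(m, y) \<notin> M"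
  obtains l r where "l \<in> carrier G" "r \<in> \<R> l" "l \<otimes> m = \<one>" "(\<one>, \<one>\<^bsub>R\<^esub> \<boxminus> r \<cdot> y) \<in> M"
proof -
  note L = lid_lgen[OF m(1,2)]
  have "M \<boxplus>\<^sub>H lgen m y \<noteq> M"
    using lid_hsum_upper(2)[OF M L] lgen_self[OF m(1,2)] m(3) by blast
  then have "(\<one>, \<one>\<^bsub>R\<^esub>) \<in> M \<boxplus>\<^sub>H lgen m y"
    using max lid_hsum[OF M L] lid_hsum_upper(1)[OF M L] by blast
  then obtain u v where u: "(\<one>, u) \<in> M" "(\<one>, v) \<in> lgen m y" "\<one>\<^bsub>R\<^esub> = u \<boxplus> v" by (rule hsumE)
  obtain l r where r: "l \<in> carrier G" "r \<in> \<R> l" "\<one> = l \<otimes> m" "v = r \<cdot> y" using u(2) by (rule lgenE)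
  have "u \<in> carrier R" using lid_deg[OF M u(1)] deg_carrier by blast
  moreover have "v \<in> carrier R" using r m deg_carrier by auto
  ultimately have "\<one>\<^bsub>R\<^esub> \<boxminus> v = u" using u(3) by (simp add: R.minus_eq R.a_assoc R.r_neg)
  then show thesis using that r u(1) by auto
qed

lemma hcore_one:
  "(k, r) \<in> hcore M \<one> \<one>\<^bsub>R\<^esub> \<longleftrightarrow>
     k \<in> carrier G \<and> r \<in> \<R> k \<and> (\<forall>h\<in>carrier G. \<forall>s\<in>\<R> h. (k \<otimes> h, r \<cdot> s) \<in> M)"
  by (auto simp: hcore_def deg_carrier)

text \<open>If \<open>b s\<close> is outside \<open>M\<close>, then \<open>r b s\<close> is 1 modulo
  \<open>M\<close> for some \<open>r\<close>, and every \<open>a t\<close> agrees modulo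
  \<open>M\<close> with \<open>a (t r) b s\<close>, which lies in \<open>M\<close>. This is the
  classical argument for the annihilator of the simple module \<open>R / M\<close>.\<close>

lemma prime_hcore_maximal:
  assumes M: "lid M" "(\<one>, \<one>\<^bsub>R\<^esub>) \<notin> M" and max: "\<forall>X. lid X \<longrightarrow> M \<subseteq> X \<longrightarrow> (\<one>, \<one>\<^bsub>R\<^esub>) \<notin> X \<longrightarrow> X = M"
  shows "prime (hcore M \<one> \<one>\<^bsub>R\<^esub>)"
  unfolding hprime_def
proof (intro conjI ballI impI)
  let ?P = "hcore M \<one> \<one>\<^bsub>R\<^esub>"
  show "lid ?P" "rid ?P" using lid_hcore rid_hcore M deg_one by auto
  show "(\<one>, \<one>\<^bsub>R\<^esub>) \<notin> ?P"
  proof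
    assume "(\<one>, \<one>\<^bsub>R\<^esub>) \<in> ?P"
    then have "(\<one> \<otimes> \<one>, \<one>\<^bsub>R\<^esub> \<cdot> \<one>\<^bsub>R\<^esub>) \<in> M" unfolding hcore_one using deg_one by blast
    then show False using M by simp
  qed
  fix i a j b assume i: "i \<in> carrier G" "a \<in> \<R> i" and j: "j \<in> carrier G" "b \<in> \<R> j"
    and ab: "\<forall>k\<in>carrier G. \<forall>r\<in>\<R> k. (i \<otimes> k \<otimes> j, a \<cdot> r \<cdot> b) \<in> ?P"
  have c: "a \<in> carrier R" "b \<in> carrier R" using i j deg_carrier by auto
  show "(i, a) \<in> ?P \<or> (j, b) \<in> ?P"
  proof (rule disjCI)
    assume "(j, b) \<notin> ?P"
    then obtain h s where h: "h \<in> carrier G" "s \<in> \<R> h" and bs: "(j \<otimes> h, b \<cdot> s) \<notin> M"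
      using j by (auto simp: hcore_one)
    have jh: "j \<otimes> h \<in> carrier G" "b \<cdot> s \<in> \<R> (j \<otimes> h)" using j h mult_degree by auto
    obtain l r where l: "l \<in> carrier G" "r \<in> \<R> l" "l \<otimes> (j \<otimes> h) = \<one>" and 1: "(\<one>, \<one>\<^bsub>R\<^esub> \<boxminus> r \<cdot> (b \<cdot> s)) \<in> M"
      by (rule maximal_left_inverse[OF M(1) max jh bs])
    have sr: "s \<in> carrier R" "r \<in> carrier R" using h l deg_carrier by auto
    show "(i, a) \<in> ?P"
      unfolding hcore_one
    proof (intro conjI ballI i)
      fix h' t assume t: "h' \<in> carrier G" "t \<in> \<R> h'"
      have tc: "t \<in> carrier R" using t deg_carrier by blast
      have at: "i \<otimes> h' \<in> carrier G" "a \<cdot> t \<in> \<R> (i \<otimes> h')" using i t mult_degree by auto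
      have "t \<cdot> r \<in> \<R> (h' \<otimes> l)" using t l mult_degree by blast
      then have "(i \<otimes> (h' \<otimes> l) \<otimes> j \<otimes> h, a \<cdot> (t \<cdot> r) \<cdot> b \<cdot> s) \<in> M"
        using ab t l h unfolding hcore_one by blast
      moreover have "i \<otimes> (h' \<otimes> l) \<otimes> j \<otimes> h = i \<otimes> h'"
      proof -
        have "i \<otimes> (h' \<otimes> l) \<otimes> j \<otimes> h = i \<otimes> h' \<otimes> (l \<otimes> (j \<otimes> h))"
          using i(1) t(1) l(1) j(1) h(1) by (simp only: G.m_assoc G.m_closed)
        then show ?thesis using l(3) i t by simp
      qed
      ultimately have 2: "(i \<otimes> h', a \<cdot> (t \<cdot> r) \<cdot> b \<cdot> s) \<in> M" by simp
      have "(i \<otimes> h', a \<cdot> t \<cdot> (\<one>\<^bsub>R\<^esub> \<boxminus> r \<cdot> (b \<cdot> s))) \<in> M" using lid_mult[OF M(1) at 1] at by simp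
      from lid_add[OF M(1) this 2] show "(i \<otimes> h', a \<cdot> t) \<in> M"
        using c sr tc by (simp add: R.minus_eq R.r_distr R.r_minus R.m_assoc R.a_assoc R.l_neg)
    qed
  qed
qed

text \<open>For \<open>x\<close> outside \<open>U\<close>, a maximal left ideal over the annihilator
  of \<open>x\<close> modulo \<open>U\<close> kills some nonzero \<open>c\<close>. The map
  \<open>u + w x |-> w c\<close> on \<open>U + R x\<close> is right multiplication by some
  \<open>y\<close> with \<open>U y = 0\<close> and \<open>x y = c\<close>, so \<open>x\<close> is
  not in \<open>annl (annr U)\<close>.\<close>

lemma double_annihilator_left_if_maximal:
  assumes baer: "baer G R \<R>"
    and kasch: "\<And>M. lid M \<Longrightarrow> (\<one>, \<one>\<^bsub>R\<^esub>) \<notin> M \<Longrightarrow> (\<forall>X. lid X \<longrightarrow> M \<subseteq> X \<longrightarrow> (\<one>, \<one>\<^bsub>R\<^esub>) \<notin> X \<longrightarrow> X = M) \<Longrightarrow>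
        \<exists>d c. (d, c) \<in> annr M \<and> c \<noteq> \<zero>\<^bsub>R\<^esub>"
    and U: "lid U"
  shows "annl (annr U) = U"
proof
  show "U \<subseteq> annl (annr U)" by (rule ann_ann(2)[OF lid_subset[OF U]])
  show "annl (annr U) \<subseteq> U"
  proof clarify
    fix g x assume x: "(g, x) \<in> annl (annr U)"
    then have g: "g \<in> carrier G" "x \<in> \<R> g" by (auto simp: hann_l_def)
    have xc: "x \<in> carrier R" using g deg_carrier by blast
    show "(g, x) \<in> U"
    proof (rule ccontr)
      assume xU: "(g, x) \<notin> U"
      define M' where "M' = {(h, r) \<in> E. (h \<otimes> g, r \<cdot> x) \<in> U}"
      have "lid M'" unfolding M'_def by (rule lid_colon[OF U g])
      moreover have "\<forall>p\<in>M'. p \<noteq> (\<one>, \<one>\<^bsub>R\<^esub>)" using xU g xc by (auto simp: M'_def)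
      ultimately obtain M where M: "lid M" "M' \<subseteq> M" "\<forall>p\<in>M. p \<noteq> (\<one>, \<one>\<^bsub>R\<^esub>)"
        and max: "\<forall>X. lid X \<longrightarrow> M \<subseteq> X \<longrightarrow> (\<forall>p\<in>X. p \<noteq> (\<one>, \<one>\<^bsub>R\<^esub>)) \<longrightarrow> X = M"
        using lid_maximal[of M' "\<lambda>p. p \<noteq> (\<one>, \<one>\<^bsub>R\<^esub>)"] by blast
      have max': "\<forall>X. lid X \<longrightarrow> M \<subseteq> X \<longrightarrow> (\<one>, \<one>\<^bsub>R\<^esub>) \<notin> X \<longrightarrow> X = M"
        using max by auto
      have "(\<one>, \<one>\<^bsub>R\<^esub>) \<notin> M" using M(3) by blast
      from kasch[OF M(1) this max'] obtain d c where c: "(d, c) \<in> annr M" "c \<noteq> \<zero>\<^bsub>R\<^esub>" by blast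
      have d: "d \<in> carrier G" "c \<in> \<R> d" using c by (auto simp: hann_r_def)
      have ker: "w \<cdot> c = \<zero>\<^bsub>R\<^esub>" if "(h, w) \<in> E" "(h \<otimes> g, w \<cdot> x) \<in> U" for h w
      proof -
        have "(h, w) \<in> M" using that M(2) by (auto simp: M'_def)
        then show ?thesis using annrD[OF c(1)] by blast
      qed
      obtain y where y: "y \<in> \<R> (inv g \<otimes> d)" "\<And>h u. (h, u) \<in> U \<Longrightarrow> u \<cdot> y = \<zero>\<^bsub>R\<^esub>"
        "\<And>h w. (h, w) \<in> E \<Longrightarrow> w \<cdot> x \<cdot> y = w \<cdot> c"
        by (rule baer_extend[OF baer U lid_E g d], rule ker, assumption, assumption, rule that)
      have "(inv g \<otimes> d, y) \<in> annr U" using y d g by (intro annrI) auto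
      then have "x \<cdot> y = \<zero>\<^bsub>R\<^esub>" by (rule annlD[OF x])
      moreover have "\<one>\<^bsub>R\<^esub> \<cdot> x \<cdot> y = \<one>\<^bsub>R\<^esub> \<cdot> c" using y(3)[of \<one> "\<one>\<^bsub>R\<^esub>"] deg_one by simp
      ultimately show False using c(2) xc d deg_carrier by simp
    qed
  qed
qed

section \<open>Graded primes of a right Noetherian self-injective ring\<close>

context
  assumes baer: "baer G R \<R>" and acc: "satisfies_ACC (Collect rid)"
    and hrm: "\<And>Q. prime Q \<Longrightarrow> hrmin Q"
begin

lemma right_Artinian: "satisfies_DCC (Collect rid)"
  by (rule right_Artinian_if_right_Noetherian[OF acc]) (meson right_minimal_exists hrm)

lemma annr_annl: "rid A \<Longrightarrow> annr (annl A) = A"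
  by (rule double_annihilator_right_if_right_Noetherian[OF baer acc])

lemma minimal_tid_exists:
  assumes "tid J" "J \<noteq> hzero"
  obtains N where "minimal_tid N" "N \<subseteq> J"
proof -
  let ?P = "\<lambda>X. tid X \<and> X \<subseteq> J \<and> X \<noteq> hzero"
  have "\<exists>N. ?P N \<and> N \<subseteq> J \<and> (\<forall>X. ?P X \<longrightarrow> X \<subseteq> N \<longrightarrow> X = N)"
    by (rule DCC_minimal[OF right_Artinian]) (use assms in auto)
  then obtain N where N: "?P N" "\<And>X. ?P X \<Longrightarrow> X \<subseteq> N \<Longrightarrow> X = N" by blast
  have "minimal_tid N"
    unfolding minimal_tid_def using N by (meson order_trans)
  with N(1) show thesis using that by blast
qed

lemma lmin_exists: "prime Q \<Longrightarrow> \<exists>e. lmin Q e"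
  by (meson right_minimal_exists right_minimal_imp_left_minimal hrm)

text \<open>With \<open>Q\<close> the common annihilator and \<open>e\<close> left minimal modulo
  it, nonzero elements \<open>e a\<close> of \<open>N\<close> and \<open>e b\<close> of
  \<open>N'\<close> both have the left annihilator \<open>{s. s e \<in> Q}\<close>. By
  self-injectivity \<open>e b\<close> lies in \<open>e a R\<close>, so the two minimal ideals
  meet.\<close>

lemma minimal_tid_eqI:
  assumes N: "minimal_tid N" and N': "minimal_tid N'" and eq: "annl N = annl N'"
  shows "N = N'"
proof -
  have tN: "tid N" and tN': "tid N'" using N N' by (auto simp: minimal_tid_def)
  let ?Q = "annl N"
  obtain e where "lmin ?Q e" using lmin_exists prime_annl_minimal_tid[OF N] by blast
  then have e1: "e \<in> \<R> \<one>" and eQ: "(\<one>, e) \<notin> ?Q"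
      and min: "\<And>h r. h \<in> carrier G \<Longrightarrow> r \<in> \<R> h \<Longrightarrow> (h, r \<cdot> e) \<notin> ?Q \<Longrightarrow>
        \<exists>k\<in>carrier G. \<exists>t\<in>\<R> k. k \<otimes> h = \<one> \<and> (\<one>, t \<cdot> r \<cdot> e \<boxminus> e) \<in> ?Q"
      unfolding left_minimal_def by blast+
  have ec: "e \<in> carrier R" using e1 deg_carrier by blast
  obtain k a where a: "(k, a) \<in> N" "e \<cdot> a \<noteq> \<zero>\<^bsub>R\<^esub>" using eQ e1 by (auto simp: hann_l_def)
  obtain m b where b: "(m, b) \<in> N'" "e \<cdot> b \<noteq> \<zero>\<^bsub>R\<^esub>" using eQ e1 unfolding eq by (auto simp: hann_l_def)
  have c: "a \<in> carrier R" "b \<in> carrier R" using a b lid_deg tN tN' deg_carrier by metis+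
  have ea: "(k, e \<cdot> a) \<in> N"
    using lid_mult[OF _ G.one_closed e1 a(1)] tN lid_deg(1)[of N k a] a(1) by simp
  have eb: "(m, e \<cdot> b) \<in> N'"
    using lid_mult[OF _ G.one_closed e1 b(1)] tN' lid_deg(1)[of N' m b] b(1) by simp
  have dea: "k \<in> carrier G" "e \<cdot> a \<in> \<R> k" and deb: "m \<in> carrier G" "e \<cdot> b \<in> \<R> m"
    using lid_deg[OF _ ea] lid_deg[OF _ eb] tN tN' by auto
  have "annl {(k, e \<cdot> a)} \<subseteq> annl {(m, e \<cdot> b)}"
  proof clarify
    fix h s assume "(h, s) \<in> annl {(k, e \<cdot> a)}"
    then have s: "h \<in> carrier G" "s \<in> \<R> h" "s \<cdot> (e \<cdot> a) = \<zero>\<^bsub>R\<^esub>" by (auto simp: ann_singleton)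
    have sc: "s \<in> carrier R" using s deg_carrier by blast
    \<comment> \<open>If \<open>s e\<close> were outside \<open>Q\<close>, some
      \<open>t s e - e\<close> would lie in \<open>Q\<close> and annihilate \<open>a\<close>, giving
      \<open>e a = t s e a = 0\<close>.\<close>
    have "(h, s \<cdot> e) \<in> ?Q"
    proof (rule ccontr)
      assume "(h, s \<cdot> e) \<notin> ?Q"
      from min[OF s(1,2) this] obtain i t where t: "i \<in> carrier G" "t \<in> \<R> i" "(\<one>, t \<cdot> s \<cdot> e \<boxminus> e) \<in> ?Q"
        by blast
      have tc: "t \<in> carrier R" using t deg_carrier by blast
      have "(t \<cdot> s \<cdot> e \<boxminus> e) \<cdot> a = \<zero>\<^bsub>R\<^esub>" using annlD[OF t(3) a(1)] .
      moreover have "(t \<cdot> s \<cdot> e \<boxminus> e) \<cdot> a = t \<cdot> (s \<cdot> (e \<cdot> a)) \<boxminus> e \<cdot> a"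
        using tc sc ec c by (simp add: R.minus_eq R.l_distr R.l_minus R.m_assoc)
      ultimately have "\<zero>\<^bsub>R\<^esub> \<boxminus> e \<cdot> a = \<zero>\<^bsub>R\<^esub>" using s(3) tc by simp
      then show False using a(2) ec c by (simp add: R.minus_eq)
    qed
    then have "s \<cdot> e \<cdot> b = \<zero>\<^bsub>R\<^esub>" using annlD b(1) unfolding eq by blast
    then show "(h, s) \<in> annl {(m, e \<cdot> b)}" using s sc ec c by (simp add: ann_singleton R.m_assoc)
  qed
  then have "(m, e \<cdot> b) \<in> rgen k (e \<cdot> a)" by (rule baer_principal[OF baer dea deb])
  then have "(m, e \<cdot> b) \<in> N" using rgen_least[OF _ ea] tN by blast
  then have "N \<inter> N' \<noteq> hzero" using eb b(2) by auto
  moreover have "tid (N \<inter> N')" using tN tN' by (simp add: lid_Int rid_Int)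
  ultimately have "N \<inter> N' = N" "N \<inter> N' = N'" using N N' unfolding minimal_tid_def by blast+
  then show ?thesis by simp
qed

lemma prime_eqI: "prime Q \<Longrightarrow> tid K \<Longrightarrow> Q \<subseteq> K \<Longrightarrow> (\<one>, \<one>\<^bsub>R\<^esub>) \<notin> K \<Longrightarrow> K = Q"
  using prime_maximal[OF acc] hrm by blast

text \<open>\<open>annl P\<close> is nonzero, since otherwise \<open>P = annr (annl P)\<close> would
  be everything. A minimal ideal \<open>N\<close> inside it satisfies
  \<open>P \<subseteq> annr N\<close>, and maximality of \<open>P\<close> gives equality.\<close>

lemma prime_as_annr:
  assumes P: "prime P"
  shows "\<exists>N. minimal_tid N \<and> annr N = P"
proof -
  have tP: "tid P" using primeD[OF P] by blast
  have "annl P \<noteq> hzero"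
  proof
    assume "annl P = hzero"
    then have "P = annr hzero" using annr_annl tP by metis
    moreover have "(\<one>, \<one>\<^bsub>R\<^esub>) \<in> annr hzero" using deg_one by (auto intro!: annrI)
    ultimately show False using primeD(3)[OF P] by simp
  qed
  then obtain N where N: "minimal_tid N" "N \<subseteq> annl P"
    using minimal_tid_exists tid_ann(1)[OF tP] by blast
  then have tN: "tid N" "N \<noteq> hzero" by (auto simp: minimal_tid_def)
  have "P \<subseteq> annr N"
    using ann_ann(1)[of P] ann_antimono(2)[OF N(2)] lid_subset tP by blast
  then have "annr N = P"
    using prime_eqI[OF P tid_ann(2)[OF tN(1)]] one_notin_ann(2)[OF tN] by blast
  then show ?thesis using N by blast
qed

text \<open>Distinct primes are incomparable because each is maximal. So a finite intersection of
  primes is never contained in a further one, and infinitely many primes would give a strictly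
  descending chain of right ideals.\<close>

lemma finite_primes: "finite (Collect prime)"
proof (rule ccontr)
  assume "infinite (Collect prime)"
  then obtain f :: "nat \<Rightarrow> _" where f: "inj f" "range f \<subseteq> Collect prime"
    using infinite_countable_subset by blast
  then have fp: "prime (f n)" for n by blast
  define I where "I n = (\<Inter>i\<le>n. f i)" for n
  have tI: "tid (I n)" for n
  proof (induction n)
    case 0
    then show ?case using primeD[OF fp] by (simp add: I_def)
  next
    case (Suc n)
    moreover have "I (Suc n) = I n \<inter> f (Suc n)" by (auto simp: I_def le_Suc_eq)
    ultimately show ?case using primeD[OF fp] by (simp add: lid_Int rid_Int)
  qed
  have avoid: "\<exists>p\<in>I n. p \<notin> f k" if "n < k" for n k
    using that
  proof (induction n)
    case 0
    have "f 0 \<noteq> f k" using f(1) 0 by (metis injD less_irrefl)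
    then have "\<not> f 0 \<subseteq> f k" using prime_eqI[OF fp, of "f k"] primeD[OF fp] by blast
    then show ?case by (auto simp: I_def)
  next
    case (Suc n)
    then obtain g a where a: "(g, a) \<in> I n" "(g, a) \<notin> f k" by auto
    have "f (Suc n) \<noteq> f k" using f(1) Suc by (metis injD less_irrefl)
    then have "\<not> f (Suc n) \<subseteq> f k" using prime_eqI[OF fp, of "f k"] primeD[OF fp] by blast
    then obtain h b where b: "(h, b) \<in> f (Suc n)" "(h, b) \<notin> f k" by auto
    note da = lid_deg[OF conjunct1[OF tI] a(1)] and db = lid_deg[OF primeD(1)[OF fp] b(1)]
    obtain l r where r: "l \<in> carrier G" "r \<in> \<R> l" "(g \<otimes> l \<otimes> h, a \<cdot> r \<cdot> b) \<notin> f k"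
      by (rule primeE[OF fp da a(2) db b(2)])
    have "(g \<otimes> l \<otimes> h, a \<cdot> r \<cdot> b) \<in> I n"
      using rid_mult[OF conjunct2[OF tI] db rid_mult[OF conjunct2[OF tI] r(1,2) a(1)]] .
    moreover have "(g \<otimes> l \<otimes> h, a \<cdot> r \<cdot> b) \<in> f (Suc n)"
      using da r by (intro lid_mult[OF primeD(1)[OF fp] _ _ b(1)] mult_degree) auto
    ultimately have "(g \<otimes> l \<otimes> h, a \<cdot> r \<cdot> b) \<in> I (Suc n)" by (auto simp: I_def le_Suc_eq)
    then show ?case using r(3) by blast
  qed
  have "(\<forall>n. I n \<in> Collect rid) \<and> (\<forall>n. I (Suc n) \<subseteq> I n)"
    using tI by (auto simp: I_def)
  with right_Artinian[unfolded satisfies_DCC_def, rule_format, of I]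
  obtain n where "\<forall>m\<ge>n. I m = I n" by blast
  then have "I (Suc n) = I n" by (blast intro: le_SucI)
  then have "I n \<subseteq> f (Suc n)" by (auto simp: I_def)
  then show False using avoid[of n "Suc n"] by blast
qed

text \<open>Left annihilators of minimal two-sided ideals are prime and determine the ideal, and every
  prime is the right annihilator of such an ideal. As there are finitely many primes, every prime
  is also a left annihilator of such an ideal.\<close>

lemma prime_as_annl:
  assumes "prime P"
  shows "\<exists>N. minimal_tid N \<and> annl N = P"
proof -
  define p where "p P = (SOME N. minimal_tid N \<and> annr N = P)" for P
  have p: "minimal_tid (p P)" "annr (p P) = P" if "prime P" for P
    using someI_ex[OF prime_as_annr[OF that]] by (simp_all add: p_def)
  \<comment> \<open>\<open>annl\<close> determines a minimal two-sided ideal, and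
    \<open>annr\<close> of \<open>p P\<close> returns \<open>P\<close>. An injective map of a finite
    set into itself is onto.\<close>
  have "inj_on (\<lambda>P. annl (p P)) (Collect prime)"
    by (rule inj_onI) (metis minimal_tid_eqI p mem_Collect_eq)
  moreover have "(\<lambda>P. annl (p P)) ` Collect prime \<subseteq> Collect prime"
    using prime_annl_minimal_tid p by auto
  ultimately have "(\<lambda>P. annl (p P)) ` Collect prime = Collect prime"
    using finite_primes by (intro endo_inj_surj)
  then have "P \<in> (\<lambda>P. annl (p P)) ` Collect prime" using assms by simp
  then show ?thesis using p by blast
qed

text \<open>There are \<open>r\<close> and \<open>s\<close> with \<open>r e s\<close> congruent to 1
  modulo \<open>M\<close>, and then \<open>M r e\<close> lies in the core \<open>P\<close> of
  \<open>M\<close>. As \<open>P = annl N\<close> and \<open>r e\<close> is outside \<open>P\<close>,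
  some \<open>r e n\<close> with \<open>n\<close> in \<open>N\<close> is nonzero, while
  \<open>M r e n = 0\<close>.\<close>

lemma annr_maximal_nonzero:
  assumes M: "lid M" "(\<one>, \<one>\<^bsub>R\<^esub>) \<notin> M" and max: "\<forall>X. lid X \<longrightarrow> M \<subseteq> X \<longrightarrow> (\<one>, \<one>\<^bsub>R\<^esub>) \<notin> X \<longrightarrow> X = M"
  shows "\<exists>d c. (d, c) \<in> annr M \<and> c \<noteq> \<zero>\<^bsub>R\<^esub>"
proof -
  let ?P = "hcore M \<one> \<one>\<^bsub>R\<^esub>"
  have P: "prime ?P" by (rule prime_hcore_maximal[OF assms])
  then obtain N where N: "minimal_tid N" "annl N = ?P" using prime_as_annl by blast
  then have tN: "tid N" by (auto simp: minimal_tid_def)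
  obtain e where "lmin ?P e" using lmin_exists[OF P] by blast
  then have e1: "e \<in> \<R> \<one>" and eP: "(\<one>, e) \<notin> ?P"
      and min: "\<And>h r. h \<in> carrier G \<Longrightarrow> r \<in> \<R> h \<Longrightarrow> (h, r \<cdot> e) \<notin> ?P \<Longrightarrow>
        \<exists>k\<in>carrier G. \<exists>t\<in>\<R> k. k \<otimes> h = \<one> \<and> (\<one>, t \<cdot> r \<cdot> e \<boxminus> e) \<in> ?P"
      unfolding left_minimal_def by blast+
  have ec: "e \<in> carrier R" using e1 deg_carrier by blast
  obtain h s where h: "h \<in> carrier G" "s \<in> \<R> h" and "(\<one> \<otimes> h, e \<cdot> s) \<notin> M"
    using eP e1 by (auto simp: hcore_one)
  then have es: "(h, e \<cdot> s) \<notin> M" by simp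
  have esd: "e \<cdot> s \<in> \<R> h" using mult_degree[of \<one> h e s] e1 h by simp
  obtain l r where l: "l \<in> carrier G" "r \<in> \<R> l" "l \<otimes> h = \<one>" and 1: "(\<one>, \<one>\<^bsub>R\<^esub> \<boxminus> r \<cdot> (e \<cdot> s)) \<in> M"
    by (rule maximal_left_inverse[OF M(1) max h(1) esd es])
  have c: "s \<in> carrier R" "r \<in> carrier R" using h l deg_carrier by auto
  have re: "r \<cdot> e \<in> \<R> l" using mult_degree[of l \<one> r e] l e1 by simp
  \<comment> \<open>Otherwise some \<open>t m r e\<close> is congruent to \<open>e\<close> modulo
    \<open>P\<close>, and multiplying by \<open>s\<close> puts \<open>t m r e s - e s\<close> into
    \<open>M\<close>. But \<open>m r e s\<close> is congruent to \<open>m\<close> and lies in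
    \<open>M\<close>, so \<open>e s\<close> would lie in \<open>M\<close>.\<close>
  have Mre: "(k \<otimes> l, m \<cdot> r \<cdot> e) \<in> ?P" if m: "(k, m) \<in> M" for k m
  proof (rule ccontr)
    assume n: "(k \<otimes> l, m \<cdot> r \<cdot> e) \<notin> ?P"
    note k = lid_deg[OF M(1) m]
    have mc: "m \<in> carrier R" using k deg_carrier by blast
    have kl: "k \<otimes> l \<in> carrier G" "m \<cdot> r \<in> \<R> (k \<otimes> l)" using k l mult_degree by auto
    obtain i t where t: "i \<in> carrier G" "t \<in> \<R> i" "i \<otimes> (k \<otimes> l) = \<one>"
      and tP: "(\<one>, t \<cdot> (m \<cdot> r) \<cdot> e \<boxminus> e) \<in> ?P" using min[OF kl n] by blast
    have tc: "t \<in> carrier R" using t deg_carrier by blast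
    have "(\<one> \<otimes> h, (t \<cdot> (m \<cdot> r) \<cdot> e \<boxminus> e) \<cdot> s) \<in> M" using tP h unfolding hcore_one by blast
    then have 2: "(h, (t \<cdot> (m \<cdot> r) \<cdot> e \<boxminus> e) \<cdot> s) \<in> M" using h by simp
    have ik: "i \<otimes> k = h"
    proof -
      have "i \<otimes> k = i \<otimes> k \<otimes> (l \<otimes> h)" using l(3) t(1) k(1) by simp
      also have "\<dots> = i \<otimes> (k \<otimes> l) \<otimes> h" using t(1) k(1) l(1) h(1) by (simp only: G.m_assoc G.m_closed)
      finally show ?thesis using t(3) h by simp
    qed
    have "(k \<otimes> \<one>, m \<cdot> (\<one>\<^bsub>R\<^esub> \<boxminus> r \<cdot> (e \<cdot> s))) \<in> M" by (rule lid_mult[OF M(1) k 1])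
    then have "(k, m \<boxminus> m \<cdot> (\<one>\<^bsub>R\<^esub> \<boxminus> r \<cdot> (e \<cdot> s))) \<in> M" using m k lid_minus[OF M(1)] by simp
    then have "(i \<otimes> k, t \<cdot> (m \<boxminus> m \<cdot> (\<one>\<^bsub>R\<^esub> \<boxminus> r \<cdot> (e \<cdot> s)))) \<in> M" using lid_mult[OF M(1) t(1,2)] by blast
    moreover have "m \<boxminus> m \<cdot> (\<one>\<^bsub>R\<^esub> \<boxminus> r \<cdot> (e \<cdot> s)) = m \<cdot> r \<cdot> e \<cdot> s"
      using mc c ec by (simp add: R.minus_eq R.r_distr R.r_minus R.minus_add R.a_assoc[symmetric] R.r_neg R.m_assoc)
    ultimately have "(h, t \<cdot> (m \<cdot> r \<cdot> e \<cdot> s)) \<in> M" using ik by simp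
    then have "(h, t \<cdot> (m \<cdot> r \<cdot> e \<cdot> s) \<boxminus> (t \<cdot> (m \<cdot> r) \<cdot> e \<boxminus> e) \<cdot> s) \<in> M" using 2 lid_minus[OF M(1)] by blast
    moreover have "t \<cdot> (m \<cdot> r \<cdot> e \<cdot> s) \<boxminus> (t \<cdot> (m \<cdot> r) \<cdot> e \<boxminus> e) \<cdot> s = e \<cdot> s"
      using mc c ec tc
      by (simp add: R.minus_eq R.l_distr R.l_minus R.minus_add R.a_assoc[symmetric] R.r_neg R.m_assoc)
    ultimately show False using es by simp
  qed
  have "(l, r \<cdot> e) \<notin> ?P"
  proof
    assume "(l, r \<cdot> e) \<in> ?P"
    then have "(l \<otimes> h, r \<cdot> e \<cdot> s) \<in> M" using h unfolding hcore_one by blast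
    then have "(\<one>, r \<cdot> (e \<cdot> s)) \<in> M" using l c ec by (simp add: R.m_assoc)
    from lid_add[OF M(1) 1 this] show False
      using M(2) c ec by (simp add: R.minus_eq R.a_assoc R.l_neg)
  qed
  then obtain k n where n: "(k, n) \<in> N" "r \<cdot> e \<cdot> n \<noteq> \<zero>\<^bsub>R\<^esub>"
    using l re unfolding N(2)[symmetric] by (auto simp: hann_l_def)
  note k = lid_deg[OF conjunct1[OF tN] n(1)]
  have nc: "n \<in> carrier R" using k deg_carrier by blast
  have "(l \<otimes> k, r \<cdot> e \<cdot> n) \<in> annr M"
  proof (rule annrI)
    show "l \<otimes> k \<in> carrier G" "r \<cdot> e \<cdot> n \<in> \<R> (l \<otimes> k)" using l k re mult_degree by auto
    fix k' m assume m: "(k', m) \<in> M"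
    have "m \<cdot> r \<cdot> e \<cdot> n = \<zero>\<^bsub>R\<^esub>" using Mre[OF m] n(1) annlD unfolding N(2)[symmetric] by blast
    moreover have "m \<in> carrier R" using lid_deg[OF M(1) m] deg_carrier by blast
    ultimately show "m \<cdot> (r \<cdot> e \<cdot> n) = \<zero>\<^bsub>R\<^esub>" using c ec nc by (simp add: R.m_assoc)
  qed
  then show ?thesis using n(2) by blast
qed

lemma annl_annr: "lid U \<Longrightarrow> annl (annr U) = U"
  by (rule double_annihilator_left_if_maximal[OF baer annr_maximal_nonzero])

text \<open>Right annihilators embed the left ideals, with reversed order, into the right ideals,
  where both chain conditions hold.\<close>

lemma left_Noetherian: "satisfies_ACC (Collect lid)"
  by (rule DCC_imp_ACC[OF right_Artinian, of _ annr annl])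
    (simp_all add: rid_annr lid_subset annl_annr ann_antimono)

lemma left_Artinian: "satisfies_DCC (Collect lid)"
  by (rule ACC_imp_DCC[OF acc, of _ annr annl])
    (simp_all add: rid_annr lid_subset annl_annr ann_antimono)

end

end

lemma (in ring) minus_eq_zeroD:
  assumes "a \<in> carrier R" "b \<in> carrier R" "a \<ominus> b = \<zero>"
  shows "a = b"
proof -
  have "a = a \<ominus> b \<oplus> b" using assms(1,2) by (simp add: minus_eq a_assoc l_neg)
  then show ?thesis using assms by simp
qed

section \<open>The singular ideal\<close>

context graded_ring
begin

text \<open>The graded left singular ideal: the left annihilator of \<open>a\<close> meets every
  nonzero principal graded left ideal, that is, it is essential.\<close>

definition singular where
  "singular = {(g, a) \<in> E. \<forall>k\<in>carrier G. \<forall>x\<in>\<R> k. x \<noteq> \<zero>\<^bsub>R\<^esub> \<longrightarrow>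
      (\<exists>h\<in>carrier G. \<exists>r\<in>\<R> h. r \<cdot> x \<noteq> \<zero>\<^bsub>R\<^esub> \<and> r \<cdot> x \<cdot> a = \<zero>\<^bsub>R\<^esub>)}"

lemma singularI:
  "g \<in> carrier G \<Longrightarrow> a \<in> \<R> g \<Longrightarrow>
    (\<And>k x. k \<in> carrier G \<Longrightarrow> x \<in> \<R> k \<Longrightarrow> x \<noteq> \<zero>\<^bsub>R\<^esub> \<Longrightarrow>
      \<exists>h\<in>carrier G. \<exists>r\<in>\<R> h. r \<cdot> x \<noteq> \<zero>\<^bsub>R\<^esub> \<and> r \<cdot> x \<cdot> a = \<zero>\<^bsub>R\<^esub>) \<Longrightarrow> (g, a) \<in> singular"
  by (auto simp: singular_def)

lemma singularE:
  assumes "(g, a) \<in> singular" "k \<in> carrier G" "x \<in> \<R> k" "x \<noteq> \<zero>\<^bsub>R\<^esub>"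
  obtains h r where "h \<in> carrier G" "r \<in> \<R> h" "r \<cdot> x \<noteq> \<zero>\<^bsub>R\<^esub>" "r \<cdot> x \<cdot> a = \<zero>\<^bsub>R\<^esub>"
  using assms unfolding singular_def by blast

lemma singular_deg: "(g, a) \<in> singular \<Longrightarrow> g \<in> carrier G" "(g, a) \<in> singular \<Longrightarrow> a \<in> \<R> g"
  by (auto simp: singular_def)

lemma lid_singular: "lid singular"
proof (rule lidI)
  show "(g, x) \<in> singular \<Longrightarrow> g \<in> carrier G \<and> x \<in> \<R> g" for g x using singular_deg by blast
  show "(g, \<zero>\<^bsub>R\<^esub>) \<in> singular" if "g \<in> carrier G" for g
  proof (rule singularI)
    fix k x assume x: "k \<in> carrier G" "x \<in> \<R> k" "x \<noteq> \<zero>\<^bsub>R\<^esub>"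
    then have "x \<in> carrier R" using deg_carrier by blast
    then show "\<exists>h\<in>carrier G. \<exists>r\<in>\<R> h. r \<cdot> x \<noteq> \<zero>\<^bsub>R\<^esub> \<and> r \<cdot> x \<cdot> \<zero>\<^bsub>R\<^esub> = \<zero>\<^bsub>R\<^esub>"
      using x deg_one by (intro bexI[of _ \<one>] bexI[of _ "\<one>\<^bsub>R\<^esub>"]) auto
  qed (use that dec.summand_zero in auto)
next
  fix g a b assume a: "(g, a) \<in> singular" and b: "(g, b) \<in> singular"
  note d = singular_deg[OF a] singular_deg(2)[OF b]
  have c: "a \<in> carrier R" "b \<in> carrier R" using d deg_carrier by auto
  show "(g, a \<boxplus> b) \<in> singular"
  proof (rule singularI)
    fix k x assume x: "k \<in> carrier G" "x \<in> \<R> k" "x \<noteq> \<zero>\<^bsub>R\<^esub>"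
    obtain h r where r: "h \<in> carrier G" "r \<in> \<R> h" "r \<cdot> x \<noteq> \<zero>\<^bsub>R\<^esub>" "r \<cdot> x \<cdot> a = \<zero>\<^bsub>R\<^esub>"
      by (rule singularE[OF a x])
    have rx: "h \<otimes> k \<in> carrier G" "r \<cdot> x \<in> \<R> (h \<otimes> k)" using r x mult_degree by auto
    \<comment> \<open>\<open>r x\<close> already annihilates \<open>a\<close>; a further multiple,
      still nonzero, annihilates \<open>b\<close> as well.\<close>
    obtain i s where s: "i \<in> carrier G" "s \<in> \<R> i" "s \<cdot> (r \<cdot> x) \<noteq> \<zero>\<^bsub>R\<^esub>" "s \<cdot> (r \<cdot> x) \<cdot> b = \<zero>\<^bsub>R\<^esub>"
      by (rule singularE[OF b rx r(3)])
    have cc: "x \<in> carrier R" "r \<in> carrier R" "s \<in> carrier R" using x r s deg_carrier by auto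
    have "s \<cdot> (r \<cdot> x) \<cdot> a = s \<cdot> (r \<cdot> x \<cdot> a)" using cc c by (simp add: R.m_assoc)
    then have "s \<cdot> r \<cdot> x \<cdot> (a \<boxplus> b) = \<zero>\<^bsub>R\<^esub>"
      using r s cc c by (simp add: R.r_distr R.m_assoc)
    moreover have "s \<cdot> r \<cdot> x \<noteq> \<zero>\<^bsub>R\<^esub>" using s cc by (simp add: R.m_assoc)
    moreover have "i \<otimes> h \<in> carrier G" "s \<cdot> r \<in> \<R> (i \<otimes> h)" using r s mult_degree by auto
    ultimately show "\<exists>h\<in>carrier G. \<exists>r\<in>\<R> h. r \<cdot> x \<noteq> \<zero>\<^bsub>R\<^esub> \<and> r \<cdot> x \<cdot> (a \<boxplus> b) = \<zero>\<^bsub>R\<^esub>" by blast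
  qed (use d dec.summand_add in auto)
next
  fix i s g a assume s: "i \<in> carrier G" "s \<in> \<R> i" and a: "(g, a) \<in> singular"
  note d = singular_deg[OF a]
  have c: "a \<in> carrier R" "s \<in> carrier R" using d s deg_carrier by auto
  show "(i \<otimes> g, s \<cdot> a) \<in> singular"
  proof (rule singularI)
    fix k x assume x: "k \<in> carrier G" "x \<in> \<R> k" "x \<noteq> \<zero>\<^bsub>R\<^esub>"
    have xc: "x \<in> carrier R" using x deg_carrier by blast
    show "\<exists>h\<in>carrier G. \<exists>r\<in>\<R> h. r \<cdot> x \<noteq> \<zero>\<^bsub>R\<^esub> \<and> r \<cdot> x \<cdot> (s \<cdot> a) = \<zero>\<^bsub>R\<^esub>"
    \<comment> \<open>The element to test \<open>a\<close> with is \<open>x s\<close>; if it is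
      zero, \<open>x\<close> itself annihilates \<open>s a\<close>.\<close>
    proof (cases "x \<cdot> s = \<zero>\<^bsub>R\<^esub>")
      case True
      then have "\<one>\<^bsub>R\<^esub> \<cdot> x \<cdot> (s \<cdot> a) = \<zero>\<^bsub>R\<^esub>" using c xc by (simp add: R.m_assoc[symmetric])
      then show ?thesis using deg_one x xc by (intro bexI[of _ \<one>] bexI[of _ "\<one>\<^bsub>R\<^esub>"]) auto
    next
      case False
      have xs: "k \<otimes> i \<in> carrier G" "x \<cdot> s \<in> \<R> (k \<otimes> i)" using x s mult_degree by auto
      obtain h r where r: "h \<in> carrier G" "r \<in> \<R> h" "r \<cdot> (x \<cdot> s) \<noteq> \<zero>\<^bsub>R\<^esub>" "r \<cdot> (x \<cdot> s) \<cdot> a = \<zero>\<^bsub>R\<^esub>"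
        by (rule singularE[OF a xs False])
      have rc: "r \<in> carrier R" using r deg_carrier by blast
      have "r \<cdot> x \<noteq> \<zero>\<^bsub>R\<^esub>"
      proof
        assume "r \<cdot> x = \<zero>\<^bsub>R\<^esub>"
        then have "r \<cdot> (x \<cdot> s) = \<zero>\<^bsub>R\<^esub>" using rc xc c by (simp add: R.m_assoc[symmetric])
        then show False using r by simp
      qed
      moreover have "r \<cdot> x \<cdot> (s \<cdot> a) = \<zero>\<^bsub>R\<^esub>" using r rc xc c by (simp add: R.m_assoc)
      ultimately show ?thesis using r by blast
    qed
  qed (use d s mult_degree in auto)
qed

lemma rid_singular: "rid singular"
proof (rule ridI)
  show "(g, x) \<in> singular \<Longrightarrow> g \<in> carrier G \<and> x \<in> \<R> g" for g x using singular_deg by blast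
  show "g \<in> carrier G \<Longrightarrow> (g, \<zero>\<^bsub>R\<^esub>) \<in> singular" for g by (rule lid_zero[OF lid_singular])
  show "(g, x) \<in> singular \<Longrightarrow> (g, y) \<in> singular \<Longrightarrow> (g, x \<boxplus> y) \<in> singular" for g x y
    by (rule lid_add[OF lid_singular])
  fix i s g a assume s: "i \<in> carrier G" "s \<in> \<R> i" and a: "(g, a) \<in> singular"
  note d = singular_deg[OF a]
  have c: "a \<in> carrier R" "s \<in> carrier R" using d s deg_carrier by auto
  show "(g \<otimes> i, a \<cdot> s) \<in> singular"
  proof (rule singularI)
    fix k x assume x: "k \<in> carrier G" "x \<in> \<R> k" "x \<noteq> \<zero>\<^bsub>R\<^esub>"
    obtain h r where r: "h \<in> carrier G" "r \<in> \<R> h" "r \<cdot> x \<noteq> \<zero>\<^bsub>R\<^esub>" "r \<cdot> x \<cdot> a = \<zero>\<^bsub>R\<^esub>"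
      by (rule singularE[OF a x])
    have rxc: "r \<cdot> x \<in> carrier R" using r x deg_carrier by auto
    have "r \<cdot> x \<cdot> (a \<cdot> s) = r \<cdot> x \<cdot> a \<cdot> s" using rxc c by (simp only: R.m_assoc)
    then have "r \<cdot> x \<cdot> (a \<cdot> s) = \<zero>\<^bsub>R\<^esub>" using r c by simp
    then show "\<exists>h\<in>carrier G. \<exists>r\<in>\<R> h. r \<cdot> x \<noteq> \<zero>\<^bsub>R\<^esub> \<and> r \<cdot> x \<cdot> (a \<cdot> s) = \<zero>\<^bsub>R\<^esub>" using r by blast
  qed (use d s mult_degree in auto)
qed

text \<open>If \<open>s (1 - y) = 0\<close>, then \<open>r s y = r s\<close> for all
  \<open>r\<close>, so essentiality of the annihilator of \<open>y\<close> forces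
  \<open>s = 0\<close>. Having zero left annihilator, \<open>1 - y\<close> generates everything as a
  right ideal by self-injectivity.\<close>

lemma one_minus_singular_invertible:
  assumes baer: "baer G R \<R>" and y: "(\<one>, y) \<in> singular"
  obtains u where "u \<in> \<R> \<one>" "(\<one>\<^bsub>R\<^esub> \<boxminus> y) \<cdot> u = \<one>\<^bsub>R\<^esub>"
proof -
  have y1: "y \<in> \<R> \<one>" using singular_deg[OF y] by blast
  have yc: "y \<in> carrier R" using y1 deg_carrier by blast
  have d: "\<one>\<^bsub>R\<^esub> \<boxminus> y \<in> \<R> \<one>" using deg_one y1 deg_minus by blast
  have "annl {(\<one>, \<one>\<^bsub>R\<^esub> \<boxminus> y)} \<subseteq> annl {(\<one>, \<one>\<^bsub>R\<^esub>)}"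
  proof clarify
    fix h s assume "(h, s) \<in> annl {(\<one>, \<one>\<^bsub>R\<^esub> \<boxminus> y)}"
    then have s: "h \<in> carrier G" "s \<in> \<R> h" "s \<cdot> (\<one>\<^bsub>R\<^esub> \<boxminus> y) = \<zero>\<^bsub>R\<^esub>" by (auto simp: ann_singleton)
    have sc: "s \<in> carrier R" using s deg_carrier by blast
    have sy: "s \<cdot> y = s"
    proof -
      have "s = s \<cdot> (\<one>\<^bsub>R\<^esub> \<boxminus> y) \<boxplus> s \<cdot> y"
        using sc yc by (simp add: R.minus_eq R.r_distr R.r_minus R.a_assoc R.l_neg)
      then show ?thesis using s sc yc by simp
    qed
    have "s = \<zero>\<^bsub>R\<^esub>"
    proof (rule ccontr)
      assume "s \<noteq> \<zero>\<^bsub>R\<^esub>"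
      obtain k r where r: "k \<in> carrier G" "r \<in> \<R> k" "r \<cdot> s \<noteq> \<zero>\<^bsub>R\<^esub>" "r \<cdot> s \<cdot> y = \<zero>\<^bsub>R\<^esub>"
        by (rule singularE[OF y s(1,2) \<open>s \<noteq> \<zero>\<^bsub>R\<^esub>\<close>])
      have "r \<cdot> s \<cdot> y = r \<cdot> s" using sy r sc yc by (simp add: R.m_assoc deg_carrier)
      then show False using r by simp
    qed
    then show "(h, s) \<in> annl {(\<one>, \<one>\<^bsub>R\<^esub>)}" using s by (simp add: ann_singleton)
  qed
  then have "(\<one>, \<one>\<^bsub>R\<^esub>) \<in> rgen \<one> (\<one>\<^bsub>R\<^esub> \<boxminus> y)"
    by (intro baer_principal[OF baer G.one_closed d G.one_closed deg_one])
  then obtain h u where "h \<in> carrier G" "u \<in> \<R> h" "\<one> = \<one> \<otimes> h" "\<one>\<^bsub>R\<^esub> = (\<one>\<^bsub>R\<^esub> \<boxminus> y) \<cdot> u" by (rule rgenE)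
  then show thesis using that[of u] by simp
qed

text \<open>Let \<open>U\<close> be a maximal left ideal on which multiplication by \<open>a\<close>
  is injective. The inverse \<open>u a |-> u\<close> is right multiplication by some
  \<open>c\<close>, so \<open>U\<close> and the left annihilator of \<open>a\<close> both kill
  \<open>a c a - a\<close>; by maximality their sum is essential.\<close>

lemma regular_modulo_singular:
  assumes baer: "baer G R \<R>" and g: "g \<in> carrier G" "a \<in> \<R> g"
  obtains c where "c \<in> \<R> (inv g)" "(g, a \<cdot> c \<cdot> a \<boxminus> a) \<in> singular"
proof -
  have ac: "a \<in> carrier R" using g deg_carrier by blast
  let ?\<phi> = "\<lambda>(k, u). u \<cdot> a = \<zero>\<^bsub>R\<^esub> \<longrightarrow> u = \<zero>\<^bsub>R\<^esub>"
  have "\<exists>U. lid U \<and> hzero \<subseteq> U \<and> (\<forall>p\<in>U. ?\<phi> p) \<and> (\<forall>X. lid X \<longrightarrow> U \<subseteq> X \<longrightarrow> (\<forall>p\<in>X. ?\<phi> p) \<longrightarrow> X = U)"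
    by (rule lid_maximal[OF lid_hzero]) auto
  then obtain U where U: "lid U" "\<forall>p\<in>U. ?\<phi> p"
    and max: "\<And>X. lid X \<Longrightarrow> U \<subseteq> X \<Longrightarrow> (\<forall>p\<in>X. ?\<phi> p) \<Longrightarrow> X = U" by blast
  have inj: "u = \<zero>\<^bsub>R\<^esub>" if "(k, u) \<in> U" "u \<cdot> a = \<zero>\<^bsub>R\<^esub>" for k u using U(2) that by auto
  have Uc: "u \<in> carrier R" if "(k, u) \<in> U" for k u using lid_deg[OF U(1) that] deg_carrier by blast
  have ker: "w \<cdot> \<one>\<^bsub>R\<^esub> = \<zero>\<^bsub>R\<^esub>" if "(h, w) \<in> U" "(h \<otimes> g, w \<cdot> a) \<in> hzero" for h w
    using inj[OF that(1)] that(2) by simp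
  obtain c where c: "c \<in> \<R> (inv g \<otimes> \<one>)" "\<And>h u. (h, u) \<in> hzero \<Longrightarrow> u \<cdot> c = \<zero>\<^bsub>R\<^esub>"
    "\<And>h w. (h, w) \<in> U \<Longrightarrow> w \<cdot> a \<cdot> c = w \<cdot> \<one>\<^bsub>R\<^esub>"
    by (rule baer_extend[OF baer lid_hzero U(1) g G.one_closed deg_one], rule ker, assumption,
      assumption, rule that)
  have ci: "c \<in> \<R> (inv g)" using c(1) g by simp
  then have cc: "c \<in> carrier R" using g deg_carrier by auto
  let ?y = "a \<cdot> c \<cdot> a \<boxminus> a"
  have aca: "a \<cdot> c \<cdot> a \<in> \<R> g"
    using mult_degree[of \<one> g "a \<cdot> c" a] mult_degree[of g "inv g" a c] g ci by simp
  have yd: "?y \<in> \<R> g" using aca g deg_minus by blast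
  have Uy: "u \<cdot> ?y = \<zero>\<^bsub>R\<^esub>" if u: "(k, u) \<in> U" for k u
  proof -
    have "u \<cdot> ?y = u \<cdot> a \<cdot> c \<cdot> a \<boxminus> u \<cdot> a"
      using Uc[OF u] ac cc by (simp add: R.minus_eq R.r_distr R.r_minus R.m_assoc)
    then show ?thesis using c(3)[OF u] Uc[OF u] ac by (simp add: R.minus_eq R.r_neg)
  qed
  have "(g, ?y) \<in> singular"
  proof (rule singularI[OF g(1) yd])
    fix k x assume x: "k \<in> carrier G" "x \<in> \<R> k" "x \<noteq> \<zero>\<^bsub>R\<^esub>"
    have xc: "x \<in> carrier R" using x deg_carrier by blast
    show "\<exists>h\<in>carrier G. \<exists>r\<in>\<R> h. r \<cdot> x \<noteq> \<zero>\<^bsub>R\<^esub> \<and> r \<cdot> x \<cdot> ?y = \<zero>\<^bsub>R\<^esub>"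
    proof (cases "(k, x) \<in> U")
      case True
      then show ?thesis using Uy x xc deg_one by (intro bexI[of _ \<one>] bexI[of _ "\<one>\<^bsub>R\<^esub>"]) auto
    next
      case False
      note L = lid_lgen[OF x(1,2)]
      have "U \<boxplus>\<^sub>H lgen k x \<noteq> U"
        using lid_hsum_upper(2)[OF U(1) L] lgen_self[OF x(1,2)] False by blast
      then have "\<not> (\<forall>p\<in>U \<boxplus>\<^sub>H lgen k x. ?\<phi> p)"
        using max[of "U \<boxplus>\<^sub>H lgen k x"] lid_hsum[OF U(1) L] lid_hsum_upper(1)[OF U(1) L] by blast
      \<comment> \<open>By maximality \<open>U + R x\<close> contains a nonzero
        \<open>z = u + r x\<close> annihilating \<open>a\<close>. As \<open>u\<close> and
        \<open>z\<close> kill \<open>a c a - a\<close>, so does \<open>r x\<close>; it is nonzero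
        because multiplication by \<open>a\<close> is injective on \<open>U\<close>.\<close>
      then obtain l z where z: "(l, z) \<in> U \<boxplus>\<^sub>H lgen k x" "z \<cdot> a = \<zero>\<^bsub>R\<^esub>" "z \<noteq> \<zero>\<^bsub>R\<^esub>" by auto
      obtain u v where u: "(l, u) \<in> U" "(l, v) \<in> lgen k x" "z = u \<boxplus> v" using z(1) by (rule hsumE)
      obtain h r where r: "h \<in> carrier G" "r \<in> \<R> h" "l = h \<otimes> k" "v = r \<cdot> x" using u(2) by (rule lgenE)
      have rc: "r \<in> carrier R" using r deg_carrier by blast
      note uc = Uc[OF u(1)]
      have "r \<cdot> x \<noteq> \<zero>\<^bsub>R\<^esub>"
      proof
        assume "r \<cdot> x = \<zero>\<^bsub>R\<^esub>"
        then have "z = u" using u r uc by simp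
        then show False using z inj[OF u(1)] by simp
      qed
      moreover have "r \<cdot> x \<cdot> ?y = \<zero>\<^bsub>R\<^esub>"
      proof -
        have "z \<cdot> ?y = z \<cdot> a \<cdot> c \<cdot> a \<boxminus> z \<cdot> a"
          using u r uc rc xc ac cc by (simp add: R.minus_eq R.r_distr R.r_minus R.m_assoc)
        also have "\<dots> = \<zero>\<^bsub>R\<^esub>" using z(2) ac cc by (simp add: R.minus_eq)
        finally have "u \<cdot> ?y \<boxplus> r \<cdot> x \<cdot> ?y = \<zero>\<^bsub>R\<^esub>"
          using u(3) r(4) uc rc xc ac cc by (simp add: R.l_distr)
        then show ?thesis using Uy[OF u(1)] rc xc ac cc by simp
      qed
      ultimately show ?thesis using r by blast
    qed
  qed
  then show thesis using that ci by blast
qed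

text \<open>If a prime \<open>Q\<close> does not contain the singular ideal \<open>Z\<close>, then an ideal \<open>I\<close> outside \<open>Q\<close> with
  maximal left annihilator satisfies \<open>I Z = I\<close>. As \<open>1 - z\<close> is right invertible for \<open>z\<close> in \<open>Z\<close>,
  this contradicts Nakayama's lemma.\<close>

lemma singular_subset_prime:
  assumes baer: "baer G R \<R>" and acc: "satisfies_ACC (Collect rid)" and Q: "prime Q"
  shows "singular \<subseteq> Q"
proof (rule ccontr)
  assume "\<not> singular \<subseteq> Q"
  then obtain h z where z: "(h, z) \<in> singular" "(h, z) \<notin> Q" by auto
  note dz = singular_deg[OF z(1)]
  note dar = double_annihilator_right_if_right_Noetherian[OF baer acc]
  \<comment> \<open>Left annihilators of two-sided ideals are right ideals, so the chain condition
    on right ideals yields a maximal one.\<close>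
  define P' where "P' A \<longleftrightarrow> (\<exists>J. tid J \<and> \<not> J \<subseteq> Q \<and> A = annl J)" for A
  have "\<exists>A. P' A \<and> annl E \<subseteq> A \<and> (\<forall>B. P' B \<longrightarrow> A \<subseteq> B \<longrightarrow> B = A)"
  proof (rule ACC_maximal[OF acc])
    have "(\<one>, \<one>\<^bsub>R\<^esub>) \<in> E - Q" using deg_one primeD(3)[OF Q] by auto
    then show "P' (annl E)" unfolding P'_def using lid_E rid_E by blast
    show "A \<in> Collect rid" if "P' A" for A using that rid_annl unfolding P'_def by blast
  qed
  then obtain A where A: "P' A" "\<And>B. P' B \<Longrightarrow> A \<subseteq> B \<Longrightarrow> B = A" by blast
  then obtain J where J: "lid J" "rid J" "\<not> J \<subseteq> Q" "A = annl J" unfolding P'_def by blast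
  \<comment> \<open>\<open>\<Inter>W\<close> is the product of \<open>J\<close> with the singular
    ideal \<open>Z\<close>, obtained as the smallest two-sided ideal containing all
    products.\<close>
  define W where "W = {X. tid X \<and> (\<forall>(g, p)\<in>J. \<forall>(k, y)\<in>singular. (g \<otimes> k, p \<cdot> y) \<in> X)}"
  have JW: "J \<in> W" unfolding W_def using J singular_deg rid_mult by auto
  have "lid (\<Inter>W)"
  proof (rule lidI)
    show "(g, x) \<in> \<Inter>W \<Longrightarrow> g \<in> carrier G \<and> x \<in> \<R> g" for g x using JW lid_deg[OF J(1)] by blast
  qed (auto simp: W_def lid_zero lid_add lid_mult)
  moreover have "rid (\<Inter>W)"
  proof (rule ridI)
    show "(g, x) \<in> \<Inter>W \<Longrightarrow> g \<in> carrier G \<and> x \<in> \<R> g" for g x using JW lid_deg[OF J(1)] by blast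
  qed (auto simp: W_def rid_zero rid_add rid_mult)
  ultimately have tW: "tid (\<Inter>W)" by blast
  obtain g0 x0 where x0: "(g0, x0) \<in> J" "(g0, x0) \<notin> Q" using J(3) by auto
  obtain l r where r: "l \<in> carrier G" "r \<in> \<R> l" "(g0 \<otimes> l \<otimes> h, x0 \<cdot> r \<cdot> z) \<notin> Q"
    by (rule primeE[OF Q lid_deg[OF J(1) x0(1)] x0(2) dz z(2)])
  have "(g0 \<otimes> l \<otimes> h, x0 \<cdot> r \<cdot> z) \<in> \<Inter>W"
    using rid_mult[OF J(2) r(1,2) x0(1)] z(1) unfolding W_def by blast
  then have "P' (annl (\<Inter>W))" unfolding P'_def using tW r(3) by blast
  moreover have "annl J \<subseteq> annl (\<Inter>W)" using JW by (intro ann_antimono) blast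
  ultimately have "annl (\<Inter>W) = annl J" using A(2) J(4) by blast
  \<comment> \<open>Right ideals are recovered from their left annihilators, so maximality yields
    \<open>J = J Z\<close>.\<close>
  then have WJ: "\<Inter>W = J" using dar tW J(2) by metis
  have "J \<noteq> hzero" using x0 lid_zero[OF primeD(1)[OF Q]] by auto
  \<comment> \<open>A maximal proper right subideal of \<open>J\<close>, which exists by the chain
    condition, takes the place of a finite generating set in Nakayama's argument.\<close>
  define proper where "proper X \<longleftrightarrow> rid X \<and> X \<subseteq> J \<and> X \<noteq> J" for X
  have "\<exists>X. proper X \<and> hzero \<subseteq> X \<and> (\<forall>B. proper B \<longrightarrow> X \<subseteq> B \<longrightarrow> B = X)"
    by (rule ACC_maximal[OF acc])
      (use \<open>J \<noteq> hzero\<close> rid_hzero hzero_subset[OF J(1)] in \<open>simp_all add: proper_def\<close>)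
  then obtain J' where J'p: "proper J'" and max': "\<And>B. proper B \<Longrightarrow> J' \<subseteq> B \<Longrightarrow> B = J'" by blast
  then have J': "rid J'" "J' \<subseteq> J" "J' \<noteq> J" by (simp_all add: proper_def)
  have max: "B = J'" if "rid B" "B \<subseteq> J" "B \<noteq> J" "J' \<subseteq> B" for B
    using max' that by (simp add: proper_def)
  \<comment> \<open>If \<open>p y\<close> were outside \<open>J'\<close>, then
    \<open>J = J' + p y R\<close> and \<open>p = u + p y t\<close> with \<open>u\<close> in
    \<open>J'\<close>. As \<open>1 - y t\<close> is right invertible, \<open>p\<close> itself would
    lie in \<open>J'\<close>.\<close>
  have prod: "(g \<otimes> k, p \<cdot> y) \<in> J'" if p: "(g, p) \<in> J" and y: "(k, y) \<in> singular" for g p k y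
  proof (rule ccontr)
    assume n: "(g \<otimes> k, p \<cdot> y) \<notin> J'"
    note dp = lid_deg[OF J(1) p] and dy = singular_deg[OF y]
    have c: "p \<in> carrier R" "y \<in> carrier R" using dp dy deg_carrier by auto
    have py: "(g \<otimes> k, p \<cdot> y) \<in> J" using rid_mult[OF J(2) dy p] .
    have L: "rid (rgen (g \<otimes> k) (p \<cdot> y))" by (intro rid_rgen rid_deg[OF J(2) py])
    have "J' \<boxplus>\<^sub>H rgen (g \<otimes> k) (p \<cdot> y) \<noteq> J'"
      using n rid_hsum_upper(2)[OF J'(1) L] rgen_self[OF rid_deg[OF J(2) py]] by blast
    then have "J' \<boxplus>\<^sub>H rgen (g \<otimes> k) (p \<cdot> y) = J"
      using max[OF rid_hsum[OF J'(1) L]] rid_hsum_upper(1)[OF J'(1) L]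
        rid_hsum_least[OF J(2) J'(2) rgen_least[OF J(2) py]] by blast
    then have "(g, p) \<in> J' \<boxplus>\<^sub>H rgen (g \<otimes> k) (p \<cdot> y)" using p by simp
    then obtain u v where u: "(g, u) \<in> J'" "(g, v) \<in> rgen (g \<otimes> k) (p \<cdot> y)" "p = u \<boxplus> v" by (rule hsumE)
    obtain m t where t: "m \<in> carrier G" "t \<in> \<R> m" "g = g \<otimes> k \<otimes> m" "v = p \<cdot> y \<cdot> t"
      using u(2) by (rule rgenE)
    have uc: "u \<in> carrier R" "t \<in> carrier R" using rid_deg[OF J'(1) u(1)] t deg_carrier by auto
    have "g \<otimes> (k \<otimes> m) = g" using t dp dy by (simp add: G.m_assoc)
    then have "k \<otimes> m = \<one>" using t dp dy by simp
    then have yt: "(\<one>, y \<cdot> t) \<in> singular" using rid_mult[OF rid_singular t(1,2) y] by simp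
    obtain w where w: "w \<in> \<R> \<one>" "(\<one>\<^bsub>R\<^esub> \<boxminus> y \<cdot> t) \<cdot> w = \<one>\<^bsub>R\<^esub>"
      by (rule one_minus_singular_invertible[OF baer yt])
    have wc: "w \<in> carrier R" using w deg_carrier by blast
    have "p \<cdot> (\<one>\<^bsub>R\<^esub> \<boxminus> y \<cdot> t) = p \<boxminus> v"
      using c uc t(4) by (simp add: R.minus_eq R.r_distr R.r_minus R.m_assoc)
    also have "\<dots> = u \<boxplus> v \<boxminus> v" by (simp only: u(3))
    also have "\<dots> = u" using c uc t(4) by (simp add: R.minus_eq R.a_assoc R.r_neg)
    finally have pu: "p \<cdot> (\<one>\<^bsub>R\<^esub> \<boxminus> y \<cdot> t) = u" .
    have "p = p \<cdot> ((\<one>\<^bsub>R\<^esub> \<boxminus> y \<cdot> t) \<cdot> w)" using w c by simp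
    also have "\<dots> = u \<cdot> w" using c uc wc pu by (simp add: R.m_assoc[symmetric])
    finally have "p = u \<cdot> w" .
    then have "(g, p) \<in> J'" using rid_mult[OF J'(1) G.one_closed w(1) u(1)] dp by simp
    then show False using n rid_mult[OF J'(1) dy] by blast
  qed
  \<comment> \<open>\<open>J'\<close> is only a right ideal. Its two-sided core still contains the
    products, because \<open>J\<close> is also a left ideal, and therefore contains
    \<open>J Z = J\<close>.\<close>
  define C where "C = {(k, x) \<in> E. \<forall>i\<in>carrier G. \<forall>s\<in>\<R> i. (i \<otimes> k, s \<cdot> x) \<in> J'}"
  have CJ: "C \<subseteq> J'"
  proof clarify
    fix k x assume x: "(k, x) \<in> C"
    then have k: "k \<in> carrier G" "x \<in> \<R> k" by (auto simp: C_def)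
    have "(\<one> \<otimes> k, \<one>\<^bsub>R\<^esub> \<cdot> x) \<in> J'" using x deg_one unfolding C_def by blast
    then show "(k, x) \<in> J'" using k by (simp add: deg_carrier)
  qed
  have "tid C" unfolding C_def using tid_right_core[OF J'(1)] by blast
  moreover have "(g \<otimes> k, p \<cdot> y) \<in> C" if p: "(g, p) \<in> J" and y: "(k, y) \<in> singular" for g p k y
  proof -
    note dp = lid_deg[OF J(1) p] and dy = singular_deg[OF y]
    have "(i \<otimes> (g \<otimes> k), s \<cdot> (p \<cdot> y)) \<in> J'" if s: "i \<in> carrier G" "s \<in> \<R> i" for i s
      using prod[OF lid_mult[OF J(1) s p] y] s dp dy by (simp add: G.m_assoc R.m_assoc deg_carrier)
    then show ?thesis using dp dy mult_degree by (auto simp: C_def)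
  qed
  ultimately have "C \<in> W" unfolding W_def by blast
  then have "J \<subseteq> C" using WJ by blast
  then show False using CJ J' by blast
qed

text \<open>Modulo \<open>Q\<close> every homogeneous element is von Neumann regular, so
  \<open>c R\<close> contains idempotents \<open>c w\<close>. Maximality of the complement
  \<open>Q + (1 - c w) R\<close> means minimality of the idempotent: a nonzero \<open>e r\<close>
  yields an idempotent \<open>f = e r s e\<close> below \<open>e\<close>, whose complement contains
  that of \<open>e\<close>, hence \<open>f = e\<close> modulo \<open>Q\<close>.\<close>

lemma has_right_minimal_if_right_Noetherian:
  assumes baer: "baer G R \<R>" and acc: "satisfies_ACC (Collect rid)" and Q: "prime Q"
  shows "hrmin Q"
  unfolding has_right_minimal_def
proof (intro ballI impI)
  note lQ = primeD(1)[OF Q] and rQ = primeD(2)[OF Q]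
  obtain B :: "'r set ring" and \<rho> where B: "ring B" and hom: "\<rho> \<in> ring_hom R B"
    and \<rho>0: "\<And>g x. g \<in> carrier G \<Longrightarrow> x \<in> \<R> g \<Longrightarrow> (g, x) \<in> Q \<longleftrightarrow> \<rho> x = \<zero>\<^bsub>B\<^esub>"
    and \<rho>eq: "\<And>g x y. g \<in> carrier G \<Longrightarrow> x \<in> \<R> g \<Longrightarrow> y \<in> \<R> g \<Longrightarrow> (g, x \<boxminus> y) \<in> Q \<longleftrightarrow> \<rho> x = \<rho> y"
    by (rule quotient_hom[OF primeD(1,2)[OF Q]]) (rule that)
  interpret B: ring B by (rule B)
  interpret \<rho>: ring_hom_ring R B \<rho> by (rule ring_hom_ringI2[OF R.ring_axioms B hom])
  have mult1: "x \<cdot> y \<in> \<R> \<one>" if "x \<in> \<R> \<one>" "y \<in> \<R> \<one>" for x y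
    using mult_degree[of \<one> \<one> x y] that by simp
  have c1: "x \<in> carrier R" if "x \<in> \<R> \<one>" for x using that deg_carrier by blast
  have regular: "\<exists>c\<in>\<R> (inv h). \<rho> x \<otimes>\<^bsub>B\<^esub> \<rho> c \<otimes>\<^bsub>B\<^esub> \<rho> x = \<rho> x" if h: "h \<in> carrier G" "x \<in> \<R> h" for h x
  proof -
    obtain c where c: "c \<in> \<R> (inv h)" "(h, x \<cdot> c \<cdot> x \<boxminus> x) \<in> singular"
      by (rule regular_modulo_singular[OF baer h])
    have cc: "c \<in> carrier R" "x \<in> carrier R" using c h deg_carrier by auto
    have "x \<cdot> c \<cdot> x \<in> \<R> h"
      using mult_degree[of \<one> h "x \<cdot> c" x] mult_degree[of h "inv h" x c] h c by simp
    moreover have "(h, x \<cdot> c \<cdot> x \<boxminus> x) \<in> Q" using singular_subset_prime[OF assms] c by blast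
    ultimately have "\<rho> (x \<cdot> c \<cdot> x) = \<rho> x" using \<rho>eq h by blast
    then show ?thesis using c(1) cc by auto
  qed
  fix g c assume g: "g \<in> carrier G" "c \<in> \<R> g" and cQ: "(g, c) \<notin> Q"
  have cc: "c \<in> carrier R" using g deg_carrier by blast
  have cw: "c \<cdot> w \<in> \<R> \<one>" if "w \<in> \<R> (inv g)" for w using mult_degree[of g "inv g" c w] g that by simp
  have wc: "w \<in> carrier R" if "w \<in> \<R> (inv g)" for w using that g deg_carrier by auto
  define P' where "P' A \<longleftrightarrow> (\<exists>w\<in>\<R> (inv g). (\<one>, c \<cdot> w) \<notin> Q \<and> \<rho> (c \<cdot> w) \<otimes>\<^bsub>B\<^esub> \<rho> (c \<cdot> w) = \<rho> (c \<cdot> w) \<and>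
      A = Q \<boxplus>\<^sub>H rgen \<one> (\<one>\<^bsub>R\<^esub> \<boxminus> c \<cdot> w))" for A
  obtain w0 where w0: "w0 \<in> \<R> (inv g)" "\<rho> c \<otimes>\<^bsub>B\<^esub> \<rho> w0 \<otimes>\<^bsub>B\<^esub> \<rho> c = \<rho> c" using regular[OF g] by blast
  have "\<exists>A. P' A \<and> Q \<boxplus>\<^sub>H rgen \<one> (\<one>\<^bsub>R\<^esub> \<boxminus> c \<cdot> w0) \<subseteq> A \<and> (\<forall>B. P' B \<longrightarrow> A \<subseteq> B \<longrightarrow> B = A)"
  proof (rule ACC_maximal[OF acc])
    have "(\<one>, c \<cdot> w0) \<notin> Q"
    proof
      assume "(\<one>, c \<cdot> w0) \<in> Q"
      then have "\<rho> c \<otimes>\<^bsub>B\<^esub> \<rho> w0 = \<zero>\<^bsub>B\<^esub>" using \<rho>0[OF G.one_closed cw[OF w0(1)]] cc wc[OF w0(1)] by simp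
      then have "\<rho> c = \<zero>\<^bsub>B\<^esub>" using w0(2) cc by (metis B.l_null \<rho>.hom_closed)
      then show False using cQ \<rho>0[OF g] by simp
    qed
    moreover have "\<rho> (c \<cdot> w0) \<otimes>\<^bsub>B\<^esub> \<rho> (c \<cdot> w0) = \<rho> (c \<cdot> w0)"
      using w0(2) cc wc[OF w0(1)] by (simp add: B.m_assoc[symmetric])
    ultimately show "P' (Q \<boxplus>\<^sub>H rgen \<one> (\<one>\<^bsub>R\<^esub> \<boxminus> c \<cdot> w0))" unfolding P'_def using w0(1) by blast
    show "A \<in> Collect rid" if "P' A" for A
      using that rQ cw deg_one unfolding P'_def by (auto intro!: rid_hsum rid_rgen deg_minus)
  qed
  then obtain A where A: "P' A" "\<And>B. P' B \<Longrightarrow> A \<subseteq> B \<Longrightarrow> B = A" by blast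
  then obtain w where w: "w \<in> \<R> (inv g)" and eQ': "(\<one>, c \<cdot> w) \<notin> Q"
    and ee': "\<rho> (c \<cdot> w) \<otimes>\<^bsub>B\<^esub> \<rho> (c \<cdot> w) = \<rho> (c \<cdot> w)" and A': "A = Q \<boxplus>\<^sub>H rgen \<one> (\<one>\<^bsub>R\<^esub> \<boxminus> c \<cdot> w)"
    unfolding P'_def by blast
  define e where "e = c \<cdot> w"
  have e1: "e \<in> \<R> \<one>" and eQ: "(\<one>, e) \<notin> Q" and ee: "\<rho> e \<otimes>\<^bsub>B\<^esub> \<rho> e = \<rho> e"
    and Ae: "A = Q \<boxplus>\<^sub>H rgen \<one> (\<one>\<^bsub>R\<^esub> \<boxminus> e)"
    using cw[OF w] eQ' ee' A' by (simp_all add: e_def)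
  note ec = c1[OF e1]
  have d1: "\<one>\<^bsub>R\<^esub> \<boxminus> x \<in> \<R> \<one>" if "x \<in> \<R> \<one>" for x using deg_one that deg_minus by blast
  have "\<exists>k\<in>carrier G. \<exists>t\<in>\<R> k. h \<otimes> k = \<one> \<and> (\<one>, e \<cdot> r \<cdot> t \<boxminus> e) \<in> Q"
    if h: "h \<in> carrier G" "r \<in> \<R> h" and er: "(h, e \<cdot> r) \<notin> Q" for h r
  proof -
    have rc: "r \<in> carrier R" using h deg_carrier by blast
    have erd: "e \<cdot> r \<in> \<R> h" using mult_degree[of \<one> h e r] e1 h by simp
    obtain s where s: "s \<in> \<R> (inv h)" "\<rho> (e \<cdot> r) \<otimes>\<^bsub>B\<^esub> \<rho> s \<otimes>\<^bsub>B\<^esub> \<rho> (e \<cdot> r) = \<rho> (e \<cdot> r)"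
      using regular[OF h(1) erd] by blast
    have sc: "s \<in> carrier R" using s h deg_carrier by auto
    have reg: "\<rho> e \<otimes>\<^bsub>B\<^esub> \<rho> r \<otimes>\<^bsub>B\<^esub> \<rho> s \<otimes>\<^bsub>B\<^esub> \<rho> e \<otimes>\<^bsub>B\<^esub> \<rho> r = \<rho> e \<otimes>\<^bsub>B\<^esub> \<rho> r"
      using s(2) ec rc sc by (simp add: B.m_assoc)
    have se: "s \<cdot> e \<in> \<R> (inv h)" using mult_degree[of "inv h" \<one> s e] s h e1 by simp
    define f where "f = e \<cdot> r \<cdot> (s \<cdot> e)"
    have f1: "f \<in> \<R> \<one>" using mult_degree[of h "inv h" "e \<cdot> r" "s \<cdot> e"] erd se h by (simp add: f_def)
    note fc = c1[OF f1]
    have \<rho>f: "\<rho> f = \<rho> e \<otimes>\<^bsub>B\<^esub> \<rho> r \<otimes>\<^bsub>B\<^esub> \<rho> s \<otimes>\<^bsub>B\<^esub> \<rho> e" using ec rc sc by (simp add: f_def B.m_assoc)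
    have fe: "\<rho> f \<otimes>\<^bsub>B\<^esub> \<rho> e = \<rho> f" unfolding \<rho>f using ec rc sc by (simp add: B.m_assoc ee)
    have ef: "\<rho> e \<otimes>\<^bsub>B\<^esub> \<rho> f = \<rho> f" unfolding \<rho>f using ec rc sc by (simp add: B.m_assoc[symmetric] ee)
    have fr: "\<rho> f \<otimes>\<^bsub>B\<^esub> \<rho> r = \<rho> e \<otimes>\<^bsub>B\<^esub> \<rho> r" unfolding \<rho>f by (rule reg)
    have ff: "\<rho> f \<otimes>\<^bsub>B\<^esub> \<rho> f = \<rho> f"
    proof -
      have "\<rho> f \<otimes>\<^bsub>B\<^esub> \<rho> f = \<rho> f \<otimes>\<^bsub>B\<^esub> \<rho> e \<otimes>\<^bsub>B\<^esub> \<rho> r \<otimes>\<^bsub>B\<^esub> \<rho> s \<otimes>\<^bsub>B\<^esub> \<rho> e"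
        by (subst (2) \<rho>f) (use ec rc sc fc in \<open>simp add: B.m_assoc\<close>)
      also have "\<dots> = \<rho> f" by (simp only: fe fr) (simp only: \<rho>f)
      finally show ?thesis .
    qed
    have "(\<one>, f) \<notin> Q"
    proof
      assume "(\<one>, f) \<in> Q"
      then have "\<rho> f = \<zero>\<^bsub>B\<^esub>" using \<rho>0[OF G.one_closed f1] by simp
      then have "\<rho> (e \<cdot> r) = \<zero>\<^bsub>B\<^esub>" using fr ec rc by simp
      then show False using er \<rho>0[OF h(1) erd] by simp
    qed
    moreover have "f = c \<cdot> (w \<cdot> r \<cdot> (s \<cdot> e))"
      using cc wc[OF w] rc sc ec by (simp add: f_def e_def R.m_assoc)
    moreover have "w \<cdot> r \<cdot> (s \<cdot> e) \<in> \<R> (inv g)"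
      using mult_degree[of "inv g \<otimes> h" "inv h" "w \<cdot> r" "s \<cdot> e"] mult_degree[of "inv g" h w r] g h w se
      by (simp add: G.m_assoc)
    ultimately have "P' (Q \<boxplus>\<^sub>H rgen \<one> (\<one>\<^bsub>R\<^esub> \<boxminus> f))" unfolding P'_def using ff by metis
    moreover have "A \<subseteq> Q \<boxplus>\<^sub>H rgen \<one> (\<one>\<^bsub>R\<^esub> \<boxminus> f)"
    proof -
      have r1: "rid (rgen \<one> (\<one>\<^bsub>R\<^esub> \<boxminus> f))" using d1[OF f1] by (intro rid_rgen) auto
      have rf: "rid (Q \<boxplus>\<^sub>H rgen \<one> (\<one>\<^bsub>R\<^esub> \<boxminus> f))" by (rule rid_hsum[OF rQ r1])
      \<comment> \<open>From \<open>f e = f\<close> follows \<open>(1 - f) (1 - e) = 1 - e\<close>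
        modulo \<open>Q\<close>, so the complement of \<open>f\<close> contains that of
        \<open>e\<close>.\<close>
      have "\<rho> ((\<one>\<^bsub>R\<^esub> \<boxminus> f) \<cdot> (\<one>\<^bsub>R\<^esub> \<boxminus> e)) = \<rho> (\<one>\<^bsub>R\<^esub> \<boxminus> e)"
        using ec fc fe
        by (simp add: R.minus_eq B.l_distr B.r_distr B.l_minus B.r_minus B.minus_add B.a_assoc
            B.a_comm[of "\<ominus>\<^bsub>B\<^esub> \<rho> e" "\<rho> f"] B.r_neg1)
      then have "(\<one>, (\<one>\<^bsub>R\<^esub> \<boxminus> e) \<boxminus> (\<one>\<^bsub>R\<^esub> \<boxminus> f) \<cdot> (\<one>\<^bsub>R\<^esub> \<boxminus> e)) \<in> Q"
        using \<rho>eq[OF G.one_closed d1[OF e1] mult1[OF d1[OF f1] d1[OF e1]]] by simp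
      moreover have "(\<one> \<otimes> \<one>, (\<one>\<^bsub>R\<^esub> \<boxminus> f) \<cdot> (\<one>\<^bsub>R\<^esub> \<boxminus> e)) \<in> rgen \<one> (\<one>\<^bsub>R\<^esub> \<boxminus> f)"
        using d1[OF e1] by (intro rgenI) auto
      ultimately have "(\<one>, (\<one>\<^bsub>R\<^esub> \<boxminus> e) \<boxminus> (\<one>\<^bsub>R\<^esub> \<boxminus> f) \<cdot> (\<one>\<^bsub>R\<^esub> \<boxminus> e) \<boxplus> (\<one>\<^bsub>R\<^esub> \<boxminus> f) \<cdot> (\<one>\<^bsub>R\<^esub> \<boxminus> e)) \<in> Q \<boxplus>\<^sub>H rgen \<one> (\<one>\<^bsub>R\<^esub> \<boxminus> f)"
        by (intro hsumI) auto
      moreover have "(\<one>\<^bsub>R\<^esub> \<boxminus> e) \<boxminus> (\<one>\<^bsub>R\<^esub> \<boxminus> f) \<cdot> (\<one>\<^bsub>R\<^esub> \<boxminus> e) \<boxplus> (\<one>\<^bsub>R\<^esub> \<boxminus> f) \<cdot> (\<one>\<^bsub>R\<^esub> \<boxminus> e) = \<one>\<^bsub>R\<^esub> \<boxminus> e"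
        using c1[OF d1[OF e1]] c1[OF d1[OF f1]]
        by (simp only: R.minus_eq[of "\<one>\<^bsub>R\<^esub> \<boxminus> e"] R.a_assoc R.m_closed R.a_inv_closed R.l_neg R.r_zero)
      ultimately have "(\<one>, \<one>\<^bsub>R\<^esub> \<boxminus> e) \<in> Q \<boxplus>\<^sub>H rgen \<one> (\<one>\<^bsub>R\<^esub> \<boxminus> f)" by simp
      then show ?thesis
        unfolding Ae by (intro rid_hsum_least[OF rf] rgen_least[OF rf] rid_hsum_upper(1) rQ r1)
    qed
    ultimately have "Q \<boxplus>\<^sub>H rgen \<one> (\<one>\<^bsub>R\<^esub> \<boxminus> f) = A" using A(2) by blast
    moreover have "(\<one>, \<one>\<^bsub>R\<^esub> \<boxminus> f) \<in> Q \<boxplus>\<^sub>H rgen \<one> (\<one>\<^bsub>R\<^esub> \<boxminus> f)"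
      using rid_hsum_upper(2)[OF rQ rid_rgen[OF G.one_closed d1[OF f1]]]
        rgen_self[OF G.one_closed d1[OF f1]] by blast
    ultimately have "(\<one>, \<one>\<^bsub>R\<^esub> \<boxminus> f) \<in> Q \<boxplus>\<^sub>H rgen \<one> (\<one>\<^bsub>R\<^esub> \<boxminus> e)" using Ae by simp
    then obtain q v where q: "(\<one>, q) \<in> Q" "(\<one>, v) \<in> rgen \<one> (\<one>\<^bsub>R\<^esub> \<boxminus> e)" "\<one>\<^bsub>R\<^esub> \<boxminus> f = q \<boxplus> v" by (rule hsumE)
    obtain k z where z: "k \<in> carrier G" "z \<in> \<R> k" "v = (\<one>\<^bsub>R\<^esub> \<boxminus> e) \<cdot> z" using q(2) by (rule rgenE)
    have zc: "z \<in> carrier R" using z deg_carrier by blast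
    have q1: "q \<in> \<R> \<one>" using lid_deg[OF lQ q(1)] by blast
    have q0: "\<rho> q = \<zero>\<^bsub>B\<^esub>" using \<rho>0[OF G.one_closed q1] q(1) by simp
    \<comment> \<open>\<open>1 - f\<close> lies in \<open>Q + (1 - e) R\<close>, which
      multiplication by \<open>e\<close> sends to zero modulo \<open>Q\<close>; so
      \<open>e = e f = f\<close> there.\<close>
    have "\<rho> (e \<cdot> (\<one>\<^bsub>R\<^esub> \<boxminus> f)) = \<rho> e \<otimes>\<^bsub>B\<^esub> \<rho> v"
      using q(3) q0 z(3) c1[OF q1] ec zc by simp
    also have "\<dots> = (\<rho> e \<ominus>\<^bsub>B\<^esub> \<rho> e \<otimes>\<^bsub>B\<^esub> \<rho> e) \<otimes>\<^bsub>B\<^esub> \<rho> z"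
      using z(3) ec zc by (simp add: R.minus_eq B.minus_eq B.l_distr B.r_distr B.l_minus B.r_minus B.m_assoc)
    also have "\<dots> = \<zero>\<^bsub>B\<^esub>" using ee ec zc by (simp add: B.minus_eq B.r_neg)
    finally have "\<rho> e \<ominus>\<^bsub>B\<^esub> \<rho> e \<otimes>\<^bsub>B\<^esub> \<rho> f = \<zero>\<^bsub>B\<^esub>"
      using ec fc by (simp add: R.minus_eq B.minus_eq B.r_distr B.r_minus)
    then have "\<rho> e = \<rho> f" using B.minus_eq_zeroD[of "\<rho> e" "\<rho> f"] ef ec fc by simp
    then have "(\<one>, f \<boxminus> e) \<in> Q" using \<rho>eq[OF G.one_closed f1 e1] by simp
    then show ?thesis using h se unfolding f_def by (intro bexI[of _ "inv h"] bexI[of _ "s \<cdot> e"]) auto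
  qed
  moreover have "(\<one>, e \<cdot> e \<boxminus> e) \<in> Q" using \<rho>eq[OF G.one_closed mult1[OF e1 e1] e1] ee ec by simp
  ultimately have "rmin Q (c \<cdot> w)" using e1 eQ unfolding right_minimal_def e_def by blast
  then show "\<exists>h\<in>carrier G. \<exists>w\<in>\<R> h. g \<otimes> h = \<one> \<and> rmin Q (c \<cdot> w)"
    using w g by (intro bexI[of _ "inv g"] bexI[of _ w]) auto
qed

section \<open>Double annihilator conditions and self-injectivity\<close>

lemma hlinearD:
  assumes "hlinear G R \<R> d \<Gamma>"
  shows hlinear_deg: "(g, x, y) \<in> \<Gamma> \<Longrightarrow> g \<in> carrier G" "(g, x, y) \<in> \<Gamma> \<Longrightarrow> x \<in> \<R> g"
      "(g, x, y) \<in> \<Gamma> \<Longrightarrow> y \<in> \<R> (g \<otimes> d)"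
    and hlinear_zero: "g \<in> carrier G \<Longrightarrow> (g, \<zero>\<^bsub>R\<^esub>, \<zero>\<^bsub>R\<^esub>) \<in> \<Gamma>"
    and hlinear_add: "(g, x, y) \<in> \<Gamma> \<Longrightarrow> (g, x', y') \<in> \<Gamma> \<Longrightarrow> (g, x \<boxplus> x', y \<boxplus> y') \<in> \<Gamma>"
    and hlinear_mult: "h \<in> carrier G \<Longrightarrow> r \<in> \<R> h \<Longrightarrow> (g, x, y) \<in> \<Gamma> \<Longrightarrow> (h \<otimes> g, r \<cdot> x, r \<cdot> y) \<in> \<Gamma>"
    and hlinear_single_zero: "(g, \<zero>\<^bsub>R\<^esub>, y) \<in> \<Gamma> \<Longrightarrow> y = \<zero>\<^bsub>R\<^esub>"
  using assms unfolding hlinear_def by metis+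

lemma hlinear_single:
  assumes d: "d \<in> carrier G" and \<Gamma>: "hlinear G R \<R> d \<Gamma>"
    and xy: "(g, x, y) \<in> \<Gamma>" and xy': "(g, x, y') \<in> \<Gamma>"
  shows "y = y'"
proof -
  note deg = hlinear_deg[OF \<Gamma>]
  have c: "x \<in> carrier R" "y \<in> carrier R" "y' \<in> carrier R"
    using deg[OF xy] deg[OF xy'] d deg_carrier by auto
  have "(\<one> \<otimes> g, \<ominus>\<^bsub>R\<^esub> \<one>\<^bsub>R\<^esub> \<cdot> x, \<ominus>\<^bsub>R\<^esub> \<one>\<^bsub>R\<^esub> \<cdot> y') \<in> \<Gamma>"
    using deg_one by (intro hlinear_mult[OF \<Gamma>] xy') (auto simp: dec.summand_neg)
  then have "(g, \<ominus>\<^bsub>R\<^esub> x, \<ominus>\<^bsub>R\<^esub> y') \<in> \<Gamma>" using c deg[OF xy] by (simp add: R.l_minus)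
  from hlinear_add[OF \<Gamma> xy this] have "y \<boxplus> \<ominus>\<^bsub>R\<^esub> y' = \<zero>\<^bsub>R\<^esub>"
    using c by (intro hlinear_single_zero[OF \<Gamma>]) (simp add: R.r_neg)
  then show ?thesis using R.minus_eq_zeroD[of y y'] c by (simp add: R.minus_eq)
qed

text \<open>A maximal left ideal \<open>U\<close> on which the given map is right multiplication is
  enlarged by one generator \<open>a\<close>. The two multipliers, for \<open>U\<close> and for
  \<open>V = R a\<close>, can be reconciled because
  \<open>annr (U \<inter> V) = annr U + annr V\<close>, which follows from the two
  conditions.\<close>

lemma baer_if_double_annihilators:
  assumes acc: "satisfies_ACC (Collect lid)" and dar: "\<And>A. rid A \<Longrightarrow> annr (annl A) = A"
    and dal: "\<And>U. lid U \<Longrightarrow> annl (annr U) = U"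
  shows "baer G R \<R>"
  unfolding baer_def
proof (intro ballI allI impI)
  fix d \<Gamma> assume d: "d \<in> carrier G" and \<Gamma>: "hlinear G R \<R> d \<Gamma>"
  note deg = hlinear_deg[OF \<Gamma>] and add = hlinear_add[OF \<Gamma>] and mult = hlinear_mult[OF \<Gamma>]
    and sv0 = hlinear_single_zero[OF \<Gamma>] and sv = hlinear_single[OF d \<Gamma>]
  have car: "x \<in> carrier R" "y \<in> carrier R" if "(g, x, y) \<in> \<Gamma>" for g x y
    using deg[OF that] d deg_carrier by auto
  define P' where "P' U \<longleftrightarrow> lid U \<and> (\<exists>c\<in>\<R> d. \<forall>(g, x)\<in>U. (g, x, x \<cdot> c) \<in> \<Gamma>)" for U
  have "\<exists>U. P' U \<and> hzero \<subseteq> U \<and> (\<forall>B. P' B \<longrightarrow> U \<subseteq> B \<longrightarrow> B = U)"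
  proof (rule ACC_maximal[OF acc])
    have "\<forall>(g, x)\<in>hzero. (g, x, x \<cdot> \<zero>\<^bsub>R\<^esub>) \<in> \<Gamma>" using \<Gamma> unfolding hlinear_def by auto
    then show "P' hzero" unfolding P'_def using lid_hzero dec.summand_zero[OF d] by blast
  qed (simp add: P'_def)
  then obtain U where U: "P' U" and max: "\<And>B. P' B \<Longrightarrow> U \<subseteq> B \<Longrightarrow> B = U" by blast
  then obtain c where lU: "lid U" and c: "c \<in> \<R> d" and Uc: "\<And>g x. (g, x) \<in> U \<Longrightarrow> (g, x, x \<cdot> c) \<in> \<Gamma>"
    unfolding P'_def by blast
  have cc: "c \<in> carrier R" using c d deg_carrier by blast
  have "(k, a) \<in> U" if kab: "(k, a, b) \<in> \<Gamma>" for k a b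
  proof -
    note k = deg(1,2)[OF kab]
    have ac: "a \<in> carrier R" using car[OF kab] by blast
    \<comment> \<open>\<open>s a = 0\<close> implies \<open>s b = 0\<close>, as \<open>b\<close> is
      the image of \<open>a\<close>; the condition for the right ideal \<open>a R\<close> turns this
      into \<open>b = a c'\<close>.\<close>
    have "(k \<otimes> d, b) \<in> annr (annl (rgen k a))"
    proof (rule annrI)
      fix h s assume s: "(h, s) \<in> annl (rgen k a)"
      then have ds: "h \<in> carrier G" "s \<in> \<R> h" by (auto simp: hann_l_def)
      have "s \<cdot> a = \<zero>\<^bsub>R\<^esub>" using annlD[OF s rgen_self[OF k]] .
      then show "s \<cdot> b = \<zero>\<^bsub>R\<^esub>" using mult[OF ds kab] sv0 by simp
    qed (use deg[OF kab] d in auto)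
    then have "(k \<otimes> d, b) \<in> rgen k a" using dar[OF rid_rgen[OF k]] by simp
    then obtain h c' where c': "h \<in> carrier G" "c' \<in> \<R> h" "k \<otimes> d = k \<otimes> h" "b = a \<cdot> c'" by (rule rgenE)
    then have "h = d" using k d by simp
    with c' have c'd: "c' \<in> \<R> d" by simp
    have c'c: "c' \<in> carrier R" using c' deg_carrier by blast
    note lV = lid_lgen[OF k]
    have Vc': "(g, x, x \<cdot> c') \<in> \<Gamma>" if x: "(g, x) \<in> lgen k a" for g x
    proof -
      obtain h r where r: "h \<in> carrier G" "r \<in> \<R> h" "g = h \<otimes> k" "x = r \<cdot> a" using x by (rule lgenE)
      then show ?thesis using mult[OF r(1,2) kab] c'(4) ac c'c by (simp add: R.m_assoc deg_carrier)
    qed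
    let ?S = "annr U \<boxplus>\<^sub>H annr (lgen k a)"
    have rU: "rid (annr U)" and rV: "rid (annr (lgen k a))"
      using lU lV by (simp_all add: rid_annr lid_subset)
    have rS: "rid ?S" by (rule rid_hsum[OF rU rV])
    \<comment> \<open>The left annihilator of the sum lies in \<open>annl (annr U) = U\<close> and
      likewise in \<open>R a\<close>; taking right annihilators puts
      \<open>annr (U \<inter> R a)\<close> into the sum.\<close>
    have "annl ?S \<subseteq> annl (annr U)" "annl ?S \<subseteq> annl (annr (lgen k a))"
      using rid_hsum_upper[OF rU rV] ann_antimono(1) by blast+
    then have "annl ?S \<subseteq> U \<inter> lgen k a" using dal[OF lU] dal[OF lV] by blast
    then have "annr (U \<inter> lgen k a) \<subseteq> ?S" using ann_antimono(2) dar[OF rS] by blast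
    moreover have "(d, c \<boxminus> c') \<in> annr (U \<inter> lgen k a)"
    proof (rule annrI)
      fix g x assume x: "(g, x) \<in> U \<inter> lgen k a"
      then have "x \<cdot> c = x \<cdot> c'" using sv Uc Vc' by blast
      moreover have "x \<in> carrier R" using x lid_deg[OF lU] deg_carrier by blast
      ultimately show "x \<cdot> (c \<boxminus> c') = \<zero>\<^bsub>R\<^esub>"
        using cc c'c by (simp add: R.minus_eq R.r_distr R.r_minus R.r_neg)
    qed (use d c c'd deg_minus in auto)
    ultimately have "(d, c \<boxminus> c') \<in> ?S" by blast
    then obtain p q where p: "(d, p) \<in> annr U" and q: "(d, q) \<in> annr (lgen k a)" and pq: "c \<boxminus> c' = p \<boxplus> q"
      by (rule hsumE)
    have dp: "p \<in> \<R> d" "q \<in> \<R> d" using rid_deg[OF rU p] rid_deg[OF rV q] by auto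
    have pc: "p \<in> carrier R" "q \<in> carrier R" using dp d deg_carrier by auto
    \<comment> \<open>The common multiplier: \<open>p\<close> is killed by \<open>U\<close> and
      \<open>q\<close> by \<open>R a\<close>, so it acts as \<open>c\<close> on \<open>U\<close> and
      as \<open>c'\<close> on \<open>R a\<close>.\<close>
    have eq: "c \<boxminus> p = c' \<boxplus> q"
    proof -
      have "c \<boxminus> p = (c \<boxminus> c') \<boxplus> c' \<boxminus> p" using cc c'c pc by (simp add: R.minus_eq R.a_assoc R.l_neg)
      also have "\<dots> = p \<boxplus> q \<boxplus> c' \<boxminus> p" by (simp only: pq)
      also have "\<dots> = c' \<boxplus> q"
        using cc c'c pc by (simp add: R.minus_eq R.a_ac R.r_neg R.a_lcomm[of p])
      finally show ?thesis .
    qed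
    have cp: "c \<boxminus> p \<in> \<R> d" using c dp d deg_minus by blast
    have "P' (U \<boxplus>\<^sub>H lgen k a)"
      unfolding P'_def
    proof (intro conjI lid_hsum lU lV bexI[OF _ cp], clarify)
      fix g x assume "(g, x) \<in> U \<boxplus>\<^sub>H lgen k a"
      then obtain u v where u: "(g, u) \<in> U" "(g, v) \<in> lgen k a" "x = u \<boxplus> v" by (rule hsumE)
      have uvc: "u \<in> carrier R" "v \<in> carrier R"
        using lid_deg[OF lU u(1)] lid_deg[OF lV u(2)] deg_carrier by auto
      have "u \<cdot> (c \<boxminus> p) = u \<cdot> c"
        using annrD[OF p u(1)] uvc cc pc by (simp add: R.minus_eq R.r_distr R.r_minus)
      moreover have "v \<cdot> (c \<boxminus> p) = v \<cdot> c'"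
        using annrD[OF q u(2)] uvc c'c pc unfolding eq by (simp add: R.r_distr)
      ultimately have "x \<cdot> (c \<boxminus> p) = u \<cdot> c \<boxplus> v \<cdot> c'" using u(3) uvc cc pc by (simp add: R.l_distr)
      then show "(g, x, x \<cdot> (c \<boxminus> p)) \<in> \<Gamma>" using add[OF Uc[OF u(1)] Vc'[OF u(2)]] u(3) by simp
    qed
    then have "U \<boxplus>\<^sub>H lgen k a = U" using max lid_hsum_upper(1)[OF lU lV] by blast
    then show ?thesis using lid_hsum_upper(2)[OF lU lV] lgen_self[OF k] by blast
  qed
  then have "\<forall>(g, x, y)\<in>\<Gamma>. y = x \<cdot> c" using sv Uc by blast
  then show "\<exists>c\<in>\<R> d. \<forall>(g, x, y)\<in>\<Gamma>. y = x \<cdot> c" using c by blast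
qed

end

section \<open>The graded Baer criterion\<close>

text \<open>Additive projections \<open>\<pi>\<close> with the expected values on the summands force
  uniqueness, and \<open>gen\<close>, which expresses that the summands generate the group, gives
  existence of finite decompositions.\<close>

lemma internal_direct_sumI:
  assumes M: "abelian_group M" and C: "\<And>i. i \<in> I \<Longrightarrow> additive_subgroup (C i) M"
    and \<pi>_in: "\<And>i x. i \<in> I \<Longrightarrow> x \<in> carrier M \<Longrightarrow> \<pi> i x \<in> C i"
    and \<pi>_add: "\<And>i x y. i \<in> I \<Longrightarrow> x \<in> carrier M \<Longrightarrow> y \<in> carrier M \<Longrightarrow> \<pi> i (x \<oplus>\<^bsub>M\<^esub> y) = \<pi> i x \<oplus>\<^bsub>M\<^esub> \<pi> i y"
    and \<pi>_eq: "\<And>i x. i \<in> I \<Longrightarrow> x \<in> C i \<Longrightarrow> \<pi> i x = x"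
    and \<pi>_neq: "\<And>i j x. i \<in> I \<Longrightarrow> j \<in> I \<Longrightarrow> i \<noteq> j \<Longrightarrow> x \<in> C j \<Longrightarrow> \<pi> i x = \<zero>\<^bsub>M\<^esub>"
    and gen: "\<And>x P. x \<in> carrier M \<Longrightarrow> P \<zero>\<^bsub>M\<^esub> \<Longrightarrow> (\<And>i y. i \<in> I \<Longrightarrow> y \<in> C i \<Longrightarrow> P y) \<Longrightarrow>
        (\<And>y z. y \<in> carrier M \<Longrightarrow> z \<in> carrier M \<Longrightarrow> P y \<Longrightarrow> P z \<Longrightarrow> P (y \<oplus>\<^bsub>M\<^esub> z)) \<Longrightarrow> P x"
  shows "internal_direct_sum I M C"
proof -
  interpret abelian_group M by (rule M)
  have Cc: "x \<in> carrier M" if "i \<in> I" "x \<in> C i" for i x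
    using additive_subgroup.a_Hcarr[OF C] that by metis
  have \<pi>c: "\<pi> i x \<in> carrier M" if "i \<in> I" "x \<in> carrier M" for i x using Cc \<pi>_in that by blast
  have \<pi>0: "\<pi> i \<zero>\<^bsub>M\<^esub> = \<zero>\<^bsub>M\<^esub>" if "i \<in> I" for i
    using \<pi>_eq[OF that] additive_subgroup.zero_closed[OF C[OF that]] by blast
  have \<pi>_sum: "\<pi> j (finsum M c F) = (if j \<in> F then c j else \<zero>\<^bsub>M\<^esub>)"
    if "finite F" "F \<subseteq> I" "\<And>i. i \<in> F \<Longrightarrow> c i \<in> C i" and j: "j \<in> I" for j c F
    using that(1-3)
  proof (induction F)
    case empty
    then show ?case using \<pi>0 j by simp
  next
    case (insert i F)
    then have c: "c \<in> F \<rightarrow> carrier M" "c i \<in> carrier M" using Cc by auto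
    then have "\<pi> j (finsum M c (insert i F)) = \<pi> j (c i) \<oplus>\<^bsub>M\<^esub> \<pi> j (finsum M c F)"
      using insert j \<pi>_add by simp
    moreover have "\<pi> j (c i) = (if j = i then c i else \<zero>\<^bsub>M\<^esub>)"
      using \<pi>_eq \<pi>_neq insert.prems j by auto
    moreover have "\<pi> j (finsum M c F) = (if j \<in> F then c j else \<zero>\<^bsub>M\<^esub>)" using insert by simp
    ultimately show ?case using insert.hyps c by (auto simp: Pi_iff)
  qed
  have sum: "\<exists>F. finite F \<and> F \<subseteq> I \<and> (\<forall>i\<in>I - F. \<pi> i x = \<zero>\<^bsub>M\<^esub>) \<and> finsum M (\<lambda>i. \<pi> i x) F = x"
    if "x \<in> carrier M" for x
    using that
  proof (rule gen)
    show "\<exists>F. finite F \<and> F \<subseteq> I \<and> (\<forall>i\<in>I - F. \<pi> i \<zero>\<^bsub>M\<^esub> = \<zero>\<^bsub>M\<^esub>) \<and> finsum M (\<lambda>i. \<pi> i \<zero>\<^bsub>M\<^esub>) F = \<zero>\<^bsub>M\<^esub>"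
      using \<pi>0 by (intro exI[of _ "{}"]) auto
  next
    fix i y assume i: "i \<in> I" "y \<in> C i"
    then have "finsum M (\<lambda>j. \<pi> j y) {i} = y" using Cc \<pi>_eq by simp
    then show "\<exists>F. finite F \<and> F \<subseteq> I \<and> (\<forall>j\<in>I - F. \<pi> j y = \<zero>\<^bsub>M\<^esub>) \<and> finsum M (\<lambda>j. \<pi> j y) F = y"
      using i \<pi>_neq by (intro exI[of _ "{i}"]) auto
  next
    fix y z assume yz: "y \<in> carrier M" "z \<in> carrier M"
      and "\<exists>F. finite F \<and> F \<subseteq> I \<and> (\<forall>i\<in>I - F. \<pi> i y = \<zero>\<^bsub>M\<^esub>) \<and> finsum M (\<lambda>i. \<pi> i y) F = y"
      and "\<exists>F. finite F \<and> F \<subseteq> I \<and> (\<forall>i\<in>I - F. \<pi> i z = \<zero>\<^bsub>M\<^esub>) \<and> finsum M (\<lambda>i. \<pi> i z) F = z"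
    then obtain F F' where F: "finite F" "F \<subseteq> I" "\<forall>i\<in>I - F. \<pi> i y = \<zero>\<^bsub>M\<^esub>" "finsum M (\<lambda>i. \<pi> i y) F = y"
      and F': "finite F'" "F' \<subseteq> I" "\<forall>i\<in>I - F'. \<pi> i z = \<zero>\<^bsub>M\<^esub>" "finsum M (\<lambda>i. \<pi> i z) F' = z" by blast
    have "finsum M (\<lambda>i. \<pi> i y) F = finsum M (\<lambda>i. \<pi> i y) (F \<union> F')"
      using F F' yz \<pi>c by (intro add.finprod_mono_neutral_cong_left) auto
    moreover have "finsum M (\<lambda>i. \<pi> i z) F' = finsum M (\<lambda>i. \<pi> i z) (F \<union> F')"
      using F F' yz \<pi>c by (intro add.finprod_mono_neutral_cong_left) auto
    moreover have "finsum M (\<lambda>i. \<pi> i (y \<oplus>\<^bsub>M\<^esub> z)) (F \<union> F') =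
        finsum M (\<lambda>i. \<pi> i y \<oplus>\<^bsub>M\<^esub> \<pi> i z) (F \<union> F')"
      using F F' yz \<pi>c \<pi>_add by (intro finsum_cong') auto
    moreover have "\<dots> = finsum M (\<lambda>i. \<pi> i y) (F \<union> F') \<oplus>\<^bsub>M\<^esub> finsum M (\<lambda>i. \<pi> i z) (F \<union> F')"
      using F F' yz \<pi>c by (intro finsum_addf) auto
    ultimately have "finsum M (\<lambda>i. \<pi> i (y \<oplus>\<^bsub>M\<^esub> z)) (F \<union> F') = y \<oplus>\<^bsub>M\<^esub> z" using F(4) F'(4) by simp
    then show "\<exists>F. finite F \<and> F \<subseteq> I \<and> (\<forall>i\<in>I - F. \<pi> i (y \<oplus>\<^bsub>M\<^esub> z) = \<zero>\<^bsub>M\<^esub>) \<and>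
        finsum M (\<lambda>i. \<pi> i (y \<oplus>\<^bsub>M\<^esub> z)) F = y \<oplus>\<^bsub>M\<^esub> z"
      using F F' yz \<pi>_add by (intro exI[of _ "F \<union> F'"]) auto
  qed
  have "\<exists>!c. c \<in> (\<Pi>\<^sub>E i\<in>I. C i) \<and> finite {i \<in> I. c i \<noteq> \<zero>\<^bsub>M\<^esub>} \<and> x = finsum M c {i \<in> I. c i \<noteq> \<zero>\<^bsub>M\<^esub>}"
    if x: "x \<in> carrier M" for x
  proof (rule ex1I)
    let ?c = "\<lambda>i\<in>I. \<pi> i x"
    obtain F where F: "finite F" "F \<subseteq> I" "\<forall>i\<in>I - F. \<pi> i x = \<zero>\<^bsub>M\<^esub>" "finsum M (\<lambda>i. \<pi> i x) F = x"
      using sum[OF x] by blast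
    have supp: "{i \<in> I. ?c i \<noteq> \<zero>\<^bsub>M\<^esub>} \<subseteq> F" using F by auto
    have "finsum M ?c {i \<in> I. ?c i \<noteq> \<zero>\<^bsub>M\<^esub>} = finsum M (\<lambda>i. \<pi> i x) F"
      using F supp x \<pi>c by (intro add.finprod_mono_neutral_cong_left) auto
    then show "?c \<in> (\<Pi>\<^sub>E i\<in>I. C i) \<and> finite {i \<in> I. ?c i \<noteq> \<zero>\<^bsub>M\<^esub>} \<and> x = finsum M ?c {i \<in> I. ?c i \<noteq> \<zero>\<^bsub>M\<^esub>}"
      using F(4) finite_subset[OF supp F(1)] \<pi>_in x by auto
    fix c assume c: "c \<in> (\<Pi>\<^sub>E i\<in>I. C i) \<and> finite {i \<in> I. c i \<noteq> \<zero>\<^bsub>M\<^esub>} \<and> x = finsum M c {i \<in> I. c i \<noteq> \<zero>\<^bsub>M\<^esub>}"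
    show "c = ?c"
    proof
      fix j show "c j = ?c j"
      proof (cases "j \<in> I")
        case True
        have "\<pi> j (finsum M c {i \<in> I. c i \<noteq> \<zero>\<^bsub>M\<^esub>}) = (if j \<in> {i \<in> I. c i \<noteq> \<zero>\<^bsub>M\<^esub>} then c j else \<zero>\<^bsub>M\<^esub>)"
          using c True by (intro \<pi>_sum) (auto simp: PiE_iff)
        then show ?thesis using c True by auto
      next
        case False
        then show ?thesis using c by (auto simp: PiE_iff extensional_def)
      qed
    qed
  qed
  then show ?thesis using C by (simp add: internal_direct_sum_def)
qed

sublocale graded_left_module \<subseteq> mod: decomposed_group M "carrier G" \<M>
  by unfold_locales (rule module_decomposition)

context left_module
begin

lemma smult_l_zero: "x \<in> carrier M \<Longrightarrow> \<zero>\<^bsub>R\<^esub> \<odot>\<^bsub>M\<^esub> x = \<zero>\<^bsub>M\<^esub>"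
  using smult_l_distr[of "\<zero>\<^bsub>R\<^esub>" "\<zero>\<^bsub>R\<^esub>" x] smult_closed[of "\<zero>\<^bsub>R\<^esub>" x]
  by (metis M.add.l_cancel_one' R.add.l_one R.add.one_closed)

lemma smult_r_zero: "a \<in> carrier R \<Longrightarrow> a \<odot>\<^bsub>M\<^esub> \<zero>\<^bsub>M\<^esub> = \<zero>\<^bsub>M\<^esub>"
  using smult_r_distr[of a "\<zero>\<^bsub>M\<^esub>" "\<zero>\<^bsub>M\<^esub>"] smult_closed[of a "\<zero>\<^bsub>M\<^esub>"]
  by (metis M.add.l_cancel_one' M.add.l_one M.add.one_closed)

lemma smult_minus_one: "x \<in> carrier M \<Longrightarrow> \<ominus>\<^bsub>R\<^esub> \<one>\<^bsub>R\<^esub> \<odot>\<^bsub>M\<^esub> x = \<ominus>\<^bsub>M\<^esub> x"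
proof -
  assume x: "x \<in> carrier M"
  have "(\<ominus>\<^bsub>R\<^esub> \<one>\<^bsub>R\<^esub> \<oplus>\<^bsub>R\<^esub> \<one>\<^bsub>R\<^esub>) \<odot>\<^bsub>M\<^esub> x = \<ominus>\<^bsub>R\<^esub> \<one>\<^bsub>R\<^esub> \<odot>\<^bsub>M\<^esub> x \<oplus>\<^bsub>M\<^esub> x"
    using x smult_one smult_l_distr by simp
  then show ?thesis
    using x smult_l_zero smult_closed by (intro M.minus_equality[symmetric]) (simp_all add: R.l_neg)
qed

end

context graded_left_module
begin

lemma deg_carrier_module: "x \<in> \<M> g \<Longrightarrow> g \<in> carrier G \<Longrightarrow> x \<in> carrier M"
  by (rule mod.summand_carrier)

text \<open>Both sides are additive in the scalar and in the module element.\<close>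

lemma linear_if_homogeneous:
  assumes N: "left_module R N" and f: "f \<in> carrier M \<rightarrow> carrier N"
    and add: "\<And>x y. x \<in> carrier M \<Longrightarrow> y \<in> carrier M \<Longrightarrow> f (x \<oplus>\<^bsub>M\<^esub> y) = f x \<oplus>\<^bsub>N\<^esub> f y"
    and hom: "\<And>g h a x. g \<in> carrier G \<Longrightarrow> h \<in> carrier G \<Longrightarrow> a \<in> \<R> g \<Longrightarrow> x \<in> \<M> h \<Longrightarrow>
      f (a \<odot>\<^bsub>M\<^esub> x) = a \<odot>\<^bsub>N\<^esub> f x"
    and a: "a \<in> carrier R" and x: "x \<in> carrier M"
  shows "f (a \<odot>\<^bsub>M\<^esub> x) = a \<odot>\<^bsub>N\<^esub> f x"
proof -
  interpret N: left_module R N by (rule N)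
  have fc: "f x \<in> carrier N" if "x \<in> carrier M" for x using f that by blast
  have f0: "f \<zero>\<^bsub>M\<^esub> = \<zero>\<^bsub>N\<^esub>"
    using add[of "\<zero>\<^bsub>M\<^esub>" "\<zero>\<^bsub>M\<^esub>"] fc[of "\<zero>\<^bsub>M\<^esub>"]
    by (metis M.add.l_one M.add.one_closed N.M.add.l_cancel_one')
  have hom': "f (a \<odot>\<^bsub>M\<^esub> x) = a \<odot>\<^bsub>N\<^esub> f x" if a: "g \<in> carrier G" "a \<in> \<R> g" for a g
    using x
  proof (induction x rule: mod.component_induct)
    case zero
    then show ?case using a by (simp add: smult_r_zero N.smult_r_zero f0 deg_carrier)
  next
    case (summand k x)
    then show ?case using hom a by blast
  next
    case (add x y)
    then show ?case
      using a assms(3) by (simp add: smult_r_distr N.smult_r_distr fc smult_closed deg_carrier)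
  qed
  show ?thesis
    using a
  proof (induction a rule: dec.component_induct)
    case zero
    then show ?case using x by (simp add: smult_l_zero N.smult_l_zero f0 fc)
  next
    case (summand g a)
    then show ?case using hom' by blast
  next
    case (add a b)
    then show ?case
      using x assms(3) by (simp add: smult_l_distr N.smult_l_distr fc smult_closed)
  qed
qed

text \<open>Makes kernels into objects of the category, so that monomorphisms can be tested on
  them.\<close>

lemma graded_submodule:
  fixes S :: "'m set"
  assumes S: "subgroup S (add_monoid M)"
    and smult: "\<And>a x. a \<in> carrier R \<Longrightarrow> x \<in> S \<Longrightarrow> a \<odot>\<^bsub>M\<^esub> x \<in> S"
    and comp: "\<And>g x. g \<in> carrier G \<Longrightarrow> x \<in> S \<Longrightarrow> mod.cmp x g \<in> S"
  shows "graded_left_module G R \<R> (M\<lparr>carrier := S\<rparr>) (\<lambda>g. \<M> g \<inter> S)"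
proof -
  interpret S: subgroup S "add_monoid M" by (rule S)
  let ?K = "M\<lparr>carrier := S\<rparr>"
  have SM: "x \<in> carrier M" if "x \<in> S" for x using S.mem_carrier[OF that] by simp
  have S0: "\<zero>\<^bsub>M\<^esub> \<in> S" using S.one_closed by simp
  have Sadd: "x \<oplus>\<^bsub>M\<^esub> y \<in> S" if "x \<in> S" "y \<in> S" for x y using S.m_closed[OF that] by simp
  have Sneg: "\<ominus>\<^bsub>M\<^esub> x \<in> S" if "x \<in> S" for x using S.m_inv_closed[OF that] by (simp add: a_inv_def)
  have K: "abelian_group ?K"
  proof (rule abelian_groupI)
    fix x assume "x \<in> carrier ?K"
    then show "\<exists>y\<in>carrier ?K. y \<oplus>\<^bsub>?K\<^esub> x = \<zero>\<^bsub>?K\<^esub>"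
      using Sneg SM M.l_neg by (intro bexI[of _ "\<ominus>\<^bsub>M\<^esub> x"]) auto
    show "x \<oplus>\<^bsub>?K\<^esub> y = y \<oplus>\<^bsub>?K\<^esub> x" if "x \<in> carrier ?K" "y \<in> carrier ?K" for x y
      using that SM by (simp add: M.a_comm)
  qed (use SM S0 Sadd in \<open>simp_all add: M.a_assoc\<close>)
  have lm: "left_module R ?K"
    by (intro left_module.intro left_module_axioms.intro R.ring_axioms K)
      (use SM smult in \<open>auto simp: smult_l_distr smult_r_distr smult_assoc smult_one\<close>)
  have "internal_direct_sum (carrier G) ?K (\<lambda>g. \<M> g \<inter> S)"
  proof (rule internal_direct_sumI[OF K, where \<pi> = "\<lambda>g x. mod.cmp x g"])
    fix g assume g: "g \<in> carrier G"
    interpret K: abelian_group ?K by (rule K)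
    have neg: "\<ominus>\<^bsub>?K\<^esub> x \<in> \<M> g \<inter> S" if x: "x \<in> \<M> g \<inter> S" for x
    proof -
      have "\<ominus>\<^bsub>?K\<^esub> x = \<ominus>\<^bsub>M\<^esub> x"
        using x SM Sneg M.l_neg by (intro K.minus_equality) auto
      then show ?thesis using x Sneg mod.summand_neg[OF g] by simp
    qed
    note neg' = neg[unfolded a_inv_def, simplified]
    show "additive_subgroup (\<M> g \<inter> S) ?K"
      by (intro additive_subgroup.intro subgroup.intro)
        (use g neg' S0 Sadd mod.summand_zero mod.summand_add in auto)
  next
    fix x P
    assume x: "x \<in> carrier ?K" and 0: "P \<zero>\<^bsub>?K\<^esub>" and P: "\<And>i y. i \<in> carrier G \<Longrightarrow> y \<in> \<M> i \<inter> S \<Longrightarrow> P y"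
      and add: "\<And>y z. y \<in> carrier ?K \<Longrightarrow> z \<in> carrier ?K \<Longrightarrow> P y \<Longrightarrow> P z \<Longrightarrow> P (y \<oplus>\<^bsub>?K\<^esub> z)"
    have xM: "x \<in> carrier M" using x SM by simp
    have "finsum M (mod.cmp x) (mod.support x) \<in> S \<and> P (finsum M (mod.cmp x) (mod.support x))"
    proof (rule mod.finsum_closed_under[where P = "\<lambda>x. x \<in> S \<and> P x"])
      show "mod.cmp x g \<in> S \<and> P (mod.cmp x g)" if "g \<in> mod.support x" for g
        using that P comp x mod.component_in[OF xM] by auto
    qed (use xM mod.finite_support mod.component_carrier S0 0 Sadd add in auto)
    then show "P x" using mod.component_spec[OF xM] by simp
  qed (use SM comp mod.component_in mod.component_add mod.component_summand in auto)
  then show ?thesis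
    by (intro graded_left_module.intro graded_left_module_axioms.intro graded_ring_axioms lm)
      (use smult smult_degree deg_carrier in auto)
qed

end

text \<open>The inclusion of the kernel and the zero map have the same composite with
  \<open>i\<close>, so they agree. The kernel is graded because \<open>i\<close> commutes with
  taking components.\<close>

lemma gr_mono_inj:
  fixes M :: "('r, 'm) module"
  assumes M: "graded_left_module G R \<R> M \<M>" and N: "graded_left_module G R \<R> N \<N>"
    and i: "gr_mono G R \<R> M \<M> N \<N> i" and x: "x \<in> carrier M" "i x = \<zero>\<^bsub>N\<^esub>"
  shows "x = \<zero>\<^bsub>M\<^esub>"
proof -
  interpret M: graded_left_module G R \<R> M \<M> by (rule M)
  interpret N: graded_left_module G R \<R> N \<N> by (rule N)
  have "i \<in> gr_hom G R M \<M> N \<N>" using i by (simp add: gr_mono_def)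
  then have ihom: "i \<in> carrier M \<rightarrow> carrier N"
      "\<And>x y. x \<in> carrier M \<Longrightarrow> y \<in> carrier M \<Longrightarrow> i (x \<oplus>\<^bsub>M\<^esub> y) = i x \<oplus>\<^bsub>N\<^esub> i y"
      "\<And>a x. a \<in> carrier R \<Longrightarrow> x \<in> carrier M \<Longrightarrow> i (a \<odot>\<^bsub>M\<^esub> x) = a \<odot>\<^bsub>N\<^esub> i x"
      "\<And>g x. g \<in> carrier G \<Longrightarrow> x \<in> \<M> g \<Longrightarrow> i x \<in> \<N> g"
    unfolding gr_hom_def by (auto simp: image_subset_iff)
  have ic: "i x \<in> carrier N" if "x \<in> carrier M" for x using ihom(1) that by blast
  have i0: "i \<zero>\<^bsub>M\<^esub> = \<zero>\<^bsub>N\<^esub>"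
    using ihom(3)[of "\<zero>\<^bsub>R\<^esub>" "\<zero>\<^bsub>M\<^esub>"] ic[of "\<zero>\<^bsub>M\<^esub>"] by (simp add: M.smult_l_zero N.smult_l_zero)
  define S where "S = {x \<in> carrier M. i x = \<zero>\<^bsub>N\<^esub>}"
  have i_cmp: "N.mod.cmp (i x) g = i (M.mod.cmp x g)" if g: "g \<in> carrier G" and "x \<in> carrier M" for x g
    using that(2)
  proof (induction x rule: M.mod.component_induct)
    case zero
    then show ?case using g by (simp add: i0 N.mod.component_zero M.mod.component_zero)
  next
    case (summand k x)
    then show ?case using g ihom(4)[of k x] by (simp add: N.mod.component_summand M.mod.component_summand i0)
  next
    case (add x y)
    then show ?case
      using g ic by (simp add: ihom(2) N.mod.component_add M.mod.component_add M.mod.component_carrier)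
  qed
  let ?K = "M\<lparr>carrier := S\<rparr>"
  have K: "graded_left_module G R \<R> ?K (\<lambda>g. \<M> g \<inter> S)"
  proof (rule M.graded_submodule)
    show "subgroup S (add_monoid M)"
    proof (rule subgroup.intro)
      fix x assume "x \<in> S"
      then have x: "x \<in> carrier M" "i x = \<zero>\<^bsub>N\<^esub>" by (auto simp: S_def)
      then have "i (\<ominus>\<^bsub>M\<^esub> x) = \<zero>\<^bsub>N\<^esub>"
        using ihom(3)[of "\<ominus>\<^bsub>R\<^esub> \<one>\<^bsub>R\<^esub>" x] by (simp add: M.smult_minus_one N.smult_r_zero)
      then show "inv\<^bsub>add_monoid M\<^esub> x \<in> S" using x by (simp add: S_def a_inv_def[symmetric])
    qed (use i0 ihom(2) in \<open>auto simp: S_def\<close>)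
    show "a \<odot>\<^bsub>M\<^esub> x \<in> S" if "a \<in> carrier R" "x \<in> S" for a x
      using that ihom(3) by (simp add: S_def M.smult_closed N.smult_r_zero)
    show "M.mod.cmp x g \<in> S" if "g \<in> carrier G" "x \<in> S" for g x
      using that i_cmp[of g x] by (simp add: S_def M.mod.component_carrier N.mod.component_zero)
  qed
  have mono: "\<forall>x\<in>carrier K. u x = v x"
    if "graded_left_module G R \<R> K \<K>" "u \<in> gr_hom G R K \<K> M \<M>" "v \<in> gr_hom G R K \<K> M \<M>"
      "\<forall>x\<in>carrier K. i (u x) = i (v x)" for K :: "('r, 'm) module" and \<K> u v
    using i that unfolding gr_mono_def by blast
  have "\<forall>x\<in>carrier ?K. x = \<zero>\<^bsub>M\<^esub>"
  proof (rule mono[OF K])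
    show "(\<lambda>x. x) \<in> gr_hom G R ?K (\<lambda>g. \<M> g \<inter> S) M \<M>"
      by (auto simp: gr_hom_def S_def)
    show "(\<lambda>x. \<zero>\<^bsub>M\<^esub>) \<in> gr_hom G R ?K (\<lambda>g. \<M> g \<inter> S) M \<M>"
      by (auto simp: gr_hom_def S_def M.smult_r_zero M.mod.summand_zero)
    show "\<forall>x\<in>carrier ?K. i x = i \<zero>\<^bsub>M\<^esub>" using i0 by (simp add: S_def)
  qed
  then show ?thesis using x by (simp add: S_def)
qed

text \<open>Graph of a degree-preserving homomorphism from a graded submodule of \<open>N\<close> to the ring.\<close>

definition (in graded_left_module) hgraph :: "('g \<times> 'm \<times> 'r) set \<Rightarrow> bool" where
  "hgraph \<Delta> \<longleftrightarrow>
     (\<forall>g n r. (g, n, r) \<in> \<Delta> \<longrightarrow> g \<in> carrier G \<and> n \<in> \<M> g \<and> r \<in> \<R> g) \<and>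
     (\<forall>g\<in>carrier G. (g, \<zero>\<^bsub>M\<^esub>, \<zero>\<^bsub>R\<^esub>) \<in> \<Delta>) \<and>
     (\<forall>g n r n' r'. (g, n, r) \<in> \<Delta> \<longrightarrow> (g, n', r') \<in> \<Delta> \<longrightarrow> (g, n \<oplus>\<^bsub>M\<^esub> n', r \<oplus>\<^bsub>R\<^esub> r') \<in> \<Delta>) \<and>
     (\<forall>h\<in>carrier G. \<forall>a\<in>\<R> h. \<forall>g n r. (g, n, r) \<in> \<Delta> \<longrightarrow> (h \<otimes> g, a \<odot>\<^bsub>M\<^esub> n, a \<otimes>\<^bsub>R\<^esub> r) \<in> \<Delta>) \<and>
     (\<forall>g r. (g, \<zero>\<^bsub>M\<^esub>, r) \<in> \<Delta> \<longrightarrow> r = \<zero>\<^bsub>R\<^esub>)"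

context graded_left_module
begin

lemma hgraphI:
  assumes "\<And>g n r. (g, n, r) \<in> \<Delta> \<Longrightarrow> g \<in> carrier G \<and> n \<in> \<M> g \<and> r \<in> \<R> g"
    "\<And>g. g \<in> carrier G \<Longrightarrow> (g, \<zero>\<^bsub>M\<^esub>, \<zero>\<^bsub>R\<^esub>) \<in> \<Delta>"
    "\<And>g n r n' r'. (g, n, r) \<in> \<Delta> \<Longrightarrow> (g, n', r') \<in> \<Delta> \<Longrightarrow> (g, n \<oplus>\<^bsub>M\<^esub> n', r \<oplus>\<^bsub>R\<^esub> r') \<in> \<Delta>"
    "\<And>h a g n r. h \<in> carrier G \<Longrightarrow> a \<in> \<R> h \<Longrightarrow> (g, n, r) \<in> \<Delta> \<Longrightarrow> (h \<otimes> g, a \<odot>\<^bsub>M\<^esub> n, a \<otimes>\<^bsub>R\<^esub> r) \<in> \<Delta>"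
    "\<And>g r. (g, \<zero>\<^bsub>M\<^esub>, r) \<in> \<Delta> \<Longrightarrow> r = \<zero>\<^bsub>R\<^esub>"
  shows "hgraph \<Delta>"
  unfolding hgraph_def
proof (intro conjI allI impI ballI)
  show "g \<in> carrier G" "n \<in> \<M> g" "r \<in> \<R> g" if "(g, n, r) \<in> \<Delta>" for g n r
    using assms(1)[OF that] by auto
qed (rule assms(2-5); assumption)+

lemma hgraphD:
  assumes "hgraph \<Delta>"
  shows hgraph_deg: "(g, n, r) \<in> \<Delta> \<Longrightarrow> g \<in> carrier G" "(g, n, r) \<in> \<Delta> \<Longrightarrow> n \<in> \<M> g" "(g, n, r) \<in> \<Delta> \<Longrightarrow> r \<in> \<R> g"
    and hgraph_zero: "g \<in> carrier G \<Longrightarrow> (g, \<zero>\<^bsub>M\<^esub>, \<zero>\<^bsub>R\<^esub>) \<in> \<Delta>"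
    and hgraph_add: "(g, n, r) \<in> \<Delta> \<Longrightarrow> (g, n', r') \<in> \<Delta> \<Longrightarrow> (g, n \<oplus>\<^bsub>M\<^esub> n', r \<oplus>\<^bsub>R\<^esub> r') \<in> \<Delta>"
    and hgraph_smult: "h \<in> carrier G \<Longrightarrow> a \<in> \<R> h \<Longrightarrow> (g, n, r) \<in> \<Delta> \<Longrightarrow> (h \<otimes> g, a \<odot>\<^bsub>M\<^esub> n, a \<otimes>\<^bsub>R\<^esub> r) \<in> \<Delta>"
    and hgraph_single_zero: "(g, \<zero>\<^bsub>M\<^esub>, r) \<in> \<Delta> \<Longrightarrow> r = \<zero>\<^bsub>R\<^esub>"
  using assms unfolding hgraph_def by metis+

lemma hgraph_neg:
  assumes \<Delta>: "hgraph \<Delta>" and n: "(g, n, r) \<in> \<Delta>"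
  shows "(g, \<ominus>\<^bsub>M\<^esub> n, \<ominus>\<^bsub>R\<^esub> r) \<in> \<Delta>"
proof -
  note d = hgraph_deg[OF \<Delta> n]
  have "(\<one> \<otimes> g, \<ominus>\<^bsub>R\<^esub> \<one>\<^bsub>R\<^esub> \<odot>\<^bsub>M\<^esub> n, \<ominus>\<^bsub>R\<^esub> \<one>\<^bsub>R\<^esub> \<otimes>\<^bsub>R\<^esub> r) \<in> \<Delta>"
    using deg_one by (intro hgraph_smult[OF \<Delta>] n) (auto simp: dec.summand_neg)
  then show ?thesis
    using d by (simp add: smult_minus_one R.l_minus deg_carrier deg_carrier_module)
qed

lemma hgraph_single:
  assumes \<Delta>: "hgraph \<Delta>" and n: "(g, n, r) \<in> \<Delta>" "(g, n, r') \<in> \<Delta>"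
  shows "r = r'"
proof -
  note d = hgraph_deg[OF \<Delta> n(1)] hgraph_deg[OF \<Delta> n(2)]
  have c: "n \<in> carrier M" "r \<in> carrier R" "r' \<in> carrier R"
    using d deg_carrier deg_carrier_module by auto
  have "(g, n \<oplus>\<^bsub>M\<^esub> \<ominus>\<^bsub>M\<^esub> n, r \<oplus>\<^bsub>R\<^esub> \<ominus>\<^bsub>R\<^esub> r') \<in> \<Delta>"
    by (rule hgraph_add[OF \<Delta> n(1) hgraph_neg[OF \<Delta> n(2)]])
  then have "r \<ominus>\<^bsub>R\<^esub> r' = \<zero>\<^bsub>R\<^esub>"
    using c hgraph_single_zero[OF \<Delta>] by (simp add: M.r_neg R.minus_eq)
  then show ?thesis by (rule R.minus_eq_zeroD[OF c(2,3)])
qed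

text \<open>Sending \<open>r\<close> to the value of \<open>\<Delta>\<close> at \<open>r n\<close>,
  wherever it is defined, is a map of degree \<open>k\<close> from a graded left ideal to the ring,
  hence right multiplication by some \<open>c\<close>. Sending \<open>n\<close> to \<open>c\<close>
  is then compatible with \<open>\<Delta>\<close>.\<close>

lemma hgraph_extend:
  assumes baer: "baer G R \<R>" and \<Delta>: "hgraph \<Delta>" and k: "k \<in> carrier G" "n \<in> \<M> k"
  obtains \<Delta>' c where "hgraph \<Delta>'" "\<Delta> \<subseteq> \<Delta>'" "(k, n, c) \<in> \<Delta>'"
proof -
  have nc: "n \<in> carrier M" using k deg_carrier_module by blast
  have car: "m \<in> carrier M" "r \<in> carrier R" if "(g, m, r) \<in> \<Delta>" for g m r
    using hgraph_deg[OF \<Delta> that] deg_carrier deg_carrier_module by auto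
  define \<Gamma> where "\<Gamma> = {(h, r, y). h \<in> carrier G \<and> r \<in> \<R> h \<and> (h \<otimes> k, r \<odot>\<^bsub>M\<^esub> n, y) \<in> \<Delta>}"
  have "hlinear G R \<R> k \<Gamma>"
    unfolding hlinear_def
  proof (intro conjI allI impI ballI)
    fix g x y assume "(g, x, y) \<in> \<Gamma>"
    then show "g \<in> carrier G" "x \<in> \<R> g" "y \<in> \<R> (g \<otimes> k)" using hgraph_deg[OF \<Delta>] by (auto simp: \<Gamma>_def)
  next
    fix g assume "g \<in> carrier G"
    then show "(g, \<zero>\<^bsub>R\<^esub>, \<zero>\<^bsub>R\<^esub>) \<in> \<Gamma>"
      using nc k hgraph_zero[OF \<Delta>] by (simp add: \<Gamma>_def dec.summand_zero smult_l_zero)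
  next
    fix g x y x' y' assume "(g, x, y) \<in> \<Gamma>" "(g, x', y') \<in> \<Gamma>"
    then show "(g, x \<oplus>\<^bsub>R\<^esub> x', y \<oplus>\<^bsub>R\<^esub> y') \<in> \<Gamma>"
      using nc hgraph_add[OF \<Delta>, of "g \<otimes> k" "x \<odot>\<^bsub>M\<^esub> n" y "x' \<odot>\<^bsub>M\<^esub> n" y']
      by (auto simp: \<Gamma>_def dec.summand_add smult_l_distr deg_carrier)
  next
    fix h a g x y assume h: "h \<in> carrier G" "a \<in> \<R> h" and x: "(g, x, y) \<in> \<Gamma>"
    then have g: "g \<in> carrier G" "x \<in> \<R> g" and xy: "(g \<otimes> k, x \<odot>\<^bsub>M\<^esub> n, y) \<in> \<Delta>" by (auto simp: \<Gamma>_def)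
    from hgraph_smult[OF \<Delta> h xy] show "(h \<otimes> g, a \<otimes>\<^bsub>R\<^esub> x, a \<otimes>\<^bsub>R\<^esub> y) \<in> \<Gamma>"
      using h g k nc by (simp add: \<Gamma>_def G.m_assoc smult_assoc deg_carrier mult_degree)
  next
    fix g y assume "(g, \<zero>\<^bsub>R\<^esub>, y) \<in> \<Gamma>"
    then show "y = \<zero>\<^bsub>R\<^esub>" using nc hgraph_single_zero[OF \<Delta>] by (auto simp: \<Gamma>_def smult_l_zero)
  qed
  then obtain c where c: "c \<in> \<R> k" and \<Gamma>c: "\<forall>(h, r, y)\<in>\<Gamma>. y = r \<otimes>\<^bsub>R\<^esub> c"
    using baer k(1) unfolding baer_def by blast
  have cc: "c \<in> carrier R" using c k deg_carrier by blast
  define \<Delta>' where "\<Delta>' = {(h \<otimes> k, m \<oplus>\<^bsub>M\<^esub> r \<odot>\<^bsub>M\<^esub> n, y \<oplus>\<^bsub>R\<^esub> r \<otimes>\<^bsub>R\<^esub> c) | h r m y.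
      h \<in> carrier G \<and> r \<in> \<R> h \<and> (h \<otimes> k, m, y) \<in> \<Delta>}"
  have I: "(h \<otimes> k, m \<oplus>\<^bsub>M\<^esub> r \<odot>\<^bsub>M\<^esub> n, y \<oplus>\<^bsub>R\<^esub> r \<otimes>\<^bsub>R\<^esub> c) \<in> \<Delta>'"
    if "h \<in> carrier G" "r \<in> \<R> h" "(h \<otimes> k, m, y) \<in> \<Delta>" for h r m y
    using that by (auto simp: \<Delta>'_def)
  have elim: "\<exists>h r m' y'. h \<in> carrier G \<and> r \<in> \<R> h \<and> (h \<otimes> k, m', y') \<in> \<Delta> \<and> g = h \<otimes> k \<and>
      m = m' \<oplus>\<^bsub>M\<^esub> r \<odot>\<^bsub>M\<^esub> n \<and> y = y' \<oplus>\<^bsub>R\<^esub> r \<otimes>\<^bsub>R\<^esub> c" if "(g, m, y) \<in> \<Delta>'" for g m y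
    using that unfolding \<Delta>'_def by blast
  have sub: "\<Delta> \<subseteq> \<Delta>'"
  proof clarify
    fix g m y assume m: "(g, m, y) \<in> \<Delta>"
    note g = hgraph_deg(1)[OF \<Delta> m]
    have "g \<otimes> inv k \<otimes> k = g" using g k by (simp add: G.m_assoc)
    then show "(g, m, y) \<in> \<Delta>'"
      using I[of "g \<otimes> inv k" "\<zero>\<^bsub>R\<^esub>" m y] m g k cc nc car[OF m]
      by (simp add: dec.summand_zero smult_l_zero)
  qed
  have "hgraph \<Delta>'"
  proof (rule hgraphI)
    fix g m y assume "(g, m, y) \<in> \<Delta>'"
    from elim[OF this] obtain h r m' y' where *: "h \<in> carrier G" "r \<in> \<R> h" "(h \<otimes> k, m', y') \<in> \<Delta>"
      "g = h \<otimes> k" "m = m' \<oplus>\<^bsub>M\<^esub> r \<odot>\<^bsub>M\<^esub> n" "y = y' \<oplus>\<^bsub>R\<^esub> r \<otimes>\<^bsub>R\<^esub> c" by blast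
    have "r \<odot>\<^bsub>M\<^esub> n \<in> \<M> (h \<otimes> k)" "r \<otimes>\<^bsub>R\<^esub> c \<in> \<R> (h \<otimes> k)"
      using * k c smult_degree mult_degree by auto
    then show "g \<in> carrier G \<and> m \<in> \<M> g \<and> y \<in> \<R> g"
      using * k hgraph_deg[OF \<Delta> *(3)] by (simp add: mod.summand_add dec.summand_add)
  next
    show "(g, \<zero>\<^bsub>M\<^esub>, \<zero>\<^bsub>R\<^esub>) \<in> \<Delta>'" if "g \<in> carrier G" for g
      using sub hgraph_zero[OF \<Delta> that] by blast
  next
    fix g m1 y1 m2 y2 assume 1: "(g, m1, y1) \<in> \<Delta>'" and 2: "(g, m2, y2) \<in> \<Delta>'"
    from elim[OF 1] obtain h r m y where *: "h \<in> carrier G" "r \<in> \<R> h" "(h \<otimes> k, m, y) \<in> \<Delta>"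
      "g = h \<otimes> k" "m1 = m \<oplus>\<^bsub>M\<^esub> r \<odot>\<^bsub>M\<^esub> n" "y1 = y \<oplus>\<^bsub>R\<^esub> r \<otimes>\<^bsub>R\<^esub> c" by blast
    from elim[OF 2] obtain h' r' m' y' where **: "h' \<in> carrier G" "r' \<in> \<R> h'" "(h' \<otimes> k, m', y') \<in> \<Delta>"
      "g = h' \<otimes> k" "m2 = m' \<oplus>\<^bsub>M\<^esub> r' \<odot>\<^bsub>M\<^esub> n" "y2 = y' \<oplus>\<^bsub>R\<^esub> r' \<otimes>\<^bsub>R\<^esub> c" by blast
    have h: "h' = h" using * ** k by simp
    have rc: "r \<in> carrier R" "r' \<in> carrier R" using * ** deg_carrier by auto
    note mc = car[OF *(3)] car[OF **(3)]
    have "(h \<otimes> k, m \<oplus>\<^bsub>M\<^esub> m', y \<oplus>\<^bsub>R\<^esub> y') \<in> \<Delta>" using hgraph_add[OF \<Delta>] * ** h by blast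
    then have "(h \<otimes> k, (m \<oplus>\<^bsub>M\<^esub> m') \<oplus>\<^bsub>M\<^esub> (r \<oplus>\<^bsub>R\<^esub> r') \<odot>\<^bsub>M\<^esub> n, (y \<oplus>\<^bsub>R\<^esub> y') \<oplus>\<^bsub>R\<^esub> (r \<oplus>\<^bsub>R\<^esub> r') \<otimes>\<^bsub>R\<^esub> c) \<in> \<Delta>'"
      using * ** h by (intro I dec.summand_add) auto
    moreover have "(m \<oplus>\<^bsub>M\<^esub> m') \<oplus>\<^bsub>M\<^esub> (r \<oplus>\<^bsub>R\<^esub> r') \<odot>\<^bsub>M\<^esub> n = m1 \<oplus>\<^bsub>M\<^esub> m2"
      using * ** rc mc nc by (simp add: smult_l_distr smult_closed M.a_ac)
    moreover have "(y \<oplus>\<^bsub>R\<^esub> y') \<oplus>\<^bsub>R\<^esub> (r \<oplus>\<^bsub>R\<^esub> r') \<otimes>\<^bsub>R\<^esub> c = y1 \<oplus>\<^bsub>R\<^esub> y2"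
      using * ** rc mc cc by (simp add: R.l_distr R.a_ac)
    ultimately show "(g, m1 \<oplus>\<^bsub>M\<^esub> m2, y1 \<oplus>\<^bsub>R\<^esub> y2) \<in> \<Delta>'" using * by simp
  next
    fix h a g m1 y1 assume h: "h \<in> carrier G" "a \<in> \<R> h" and 1: "(g, m1, y1) \<in> \<Delta>'"
    from elim[OF 1] obtain l r m y where *: "l \<in> carrier G" "r \<in> \<R> l" "(l \<otimes> k, m, y) \<in> \<Delta>"
      "g = l \<otimes> k" "m1 = m \<oplus>\<^bsub>M\<^esub> r \<odot>\<^bsub>M\<^esub> n" "y1 = y \<oplus>\<^bsub>R\<^esub> r \<otimes>\<^bsub>R\<^esub> c" by blast
    have rc: "r \<in> carrier R" "a \<in> carrier R" using * h deg_carrier by auto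
    note mc = car[OF *(3)]
    have "(h \<otimes> l \<otimes> k, a \<odot>\<^bsub>M\<^esub> m, a \<otimes>\<^bsub>R\<^esub> y) \<in> \<Delta>"
      using hgraph_smult[OF \<Delta> h *(3)] h * k by (simp add: G.m_assoc)
    then have "(h \<otimes> l \<otimes> k, a \<odot>\<^bsub>M\<^esub> m \<oplus>\<^bsub>M\<^esub> (a \<otimes>\<^bsub>R\<^esub> r) \<odot>\<^bsub>M\<^esub> n, a \<otimes>\<^bsub>R\<^esub> y \<oplus>\<^bsub>R\<^esub> (a \<otimes>\<^bsub>R\<^esub> r) \<otimes>\<^bsub>R\<^esub> c) \<in> \<Delta>'"
      using h * by (intro I mult_degree) auto
    then show "(h \<otimes> g, a \<odot>\<^bsub>M\<^esub> m1, a \<otimes>\<^bsub>R\<^esub> y1) \<in> \<Delta>'"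
      using h * k rc mc nc cc
      by (simp add: G.m_assoc smult_r_distr smult_assoc smult_closed R.r_distr R.m_assoc)
  next
    \<comment> \<open>Well-definedness: a relation \<open>m + r n = 0\<close> places
      \<open>r n = - m\<close> in the domain of \<open>\<Delta>\<close>, where the value is
      \<open>r c\<close> by the choice of \<open>c\<close>.\<close>
    fix g y1 assume "(g, \<zero>\<^bsub>M\<^esub>, y1) \<in> \<Delta>'"
    from elim[OF this] obtain h r m y where *: "h \<in> carrier G" "r \<in> \<R> h" "(h \<otimes> k, m, y) \<in> \<Delta>"
      "g = h \<otimes> k" "\<zero>\<^bsub>M\<^esub> = m \<oplus>\<^bsub>M\<^esub> r \<odot>\<^bsub>M\<^esub> n" "y1 = y \<oplus>\<^bsub>R\<^esub> r \<otimes>\<^bsub>R\<^esub> c" by blast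
    have rc: "r \<in> carrier R" using * deg_carrier by auto
    note mc = car[OF *(3)]
    have "r \<odot>\<^bsub>M\<^esub> n = \<ominus>\<^bsub>M\<^esub> m"
      using *(5) mc rc nc by (metis M.a_comm M.minus_equality smult_closed)
    then have "(h, r, \<ominus>\<^bsub>R\<^esub> y) \<in> \<Gamma>"
      using hgraph_neg[OF \<Delta> *(3)] * by (simp add: \<Gamma>_def)
    then have "\<ominus>\<^bsub>R\<^esub> y = r \<otimes>\<^bsub>R\<^esub> c" using \<Gamma>c by blast
    then show "y1 = \<zero>\<^bsub>R\<^esub>" using *(6) mc by (simp add: R.r_neg flip: \<open>\<ominus>\<^bsub>R\<^esub> y = r \<otimes>\<^bsub>R\<^esub> c\<close>)
  qed
  moreover have "(k, n, c) \<in> \<Delta>'"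
    using I[OF G.one_closed deg_one, of "\<zero>\<^bsub>M\<^esub>" "\<zero>\<^bsub>R\<^esub>"] k nc cc hgraph_zero[OF \<Delta> k(1)]
    by (simp add: smult_one)
  ultimately show thesis using that sub by blast
qed

text \<open>Zorn's lemma: an extension that cannot be enlarged is defined on every homogeneous
  element, by \<open>hgraph_extend\<close>.\<close>

lemma hgraph_total:
  assumes baer: "baer G R \<R>" and \<Delta>0: "hgraph \<Delta>0"
  obtains \<Delta> where "hgraph \<Delta>" "\<Delta>0 \<subseteq> \<Delta>" "\<And>k n. k \<in> carrier G \<Longrightarrow> n \<in> \<M> k \<Longrightarrow> \<exists>c. (k, n, c) \<in> \<Delta>"
proof -
  let ?A = "{\<Delta>. hgraph \<Delta> \<and> \<Delta>0 \<subseteq> \<Delta>}"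
  have "\<exists>\<Delta>\<in>?A. \<forall>X\<in>?A. \<Delta> \<subseteq> X \<longrightarrow> X = \<Delta>"
  proof (rule subset_Zorn_nonempty)
    show "?A \<noteq> {}" using \<Delta>0 by blast
    fix C assume C: "C \<noteq> {}" "subset.chain ?A C"
    then have hC: "hgraph X" "\<Delta>0 \<subseteq> X" if "X \<in> C" for X using that by (auto simp: subset.chain_def)
    have "hgraph (\<Union>C)"
    proof (rule hgraphI)
      show "g \<in> carrier G \<and> n \<in> \<M> g \<and> r \<in> \<R> g" if "(g, n, r) \<in> \<Union>C" for g n r
        using that hgraph_deg[OF hC(1)] by blast
      show "(g, \<zero>\<^bsub>M\<^esub>, \<zero>\<^bsub>R\<^esub>) \<in> \<Union>C" if "g \<in> carrier G" for g
        using C(1) hgraph_zero[OF hC(1) that] by blast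
      show "(g, n \<oplus>\<^bsub>M\<^esub> n', r \<oplus>\<^bsub>R\<^esub> r') \<in> \<Union>C" if x: "(g, n, r) \<in> \<Union>C" and y: "(g, n', r') \<in> \<Union>C" for g n r n' r'
      proof -
        obtain X Y where X: "X \<in> C" "(g, n, r) \<in> X" and Y: "Y \<in> C" "(g, n', r') \<in> Y" using x y by blast
        then have "X \<subseteq> Y \<or> Y \<subseteq> X" using C(2) unfolding subset.chain_def by blast
        then show ?thesis
          using X Y hgraph_add[OF hC(1)[OF X(1)]] hgraph_add[OF hC(1)[OF Y(1)]] by blast
      qed
      show "(h \<otimes> g, a \<odot>\<^bsub>M\<^esub> n, a \<otimes>\<^bsub>R\<^esub> r) \<in> \<Union>C" if "h \<in> carrier G" "a \<in> \<R> h" "(g, n, r) \<in> \<Union>C" for h a g n r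
        using that(3) hgraph_smult[OF hC(1) that(1,2)] by blast
      show "r = \<zero>\<^bsub>R\<^esub>" if "(g, \<zero>\<^bsub>M\<^esub>, r) \<in> \<Union>C" for g r
        using that hgraph_single_zero[OF hC(1)] by blast
    qed
    moreover have "\<Delta>0 \<subseteq> \<Union>C" using C(1) hC(2) by blast
    ultimately show "\<Union>C \<in> ?A" by blast
  qed
  then obtain \<Delta> where "\<Delta> \<in> ?A" and max: "\<forall>X\<in>?A. \<Delta> \<subseteq> X \<longrightarrow> X = \<Delta>" by (rule bexE)
  then have \<Delta>: "hgraph \<Delta>" "\<Delta>0 \<subseteq> \<Delta>" by simp_all
  have "\<exists>c. (k, n, c) \<in> \<Delta>" if k: "k \<in> carrier G" "n \<in> \<M> k" for k n
  proof -
    obtain \<Delta>' c where \<Delta>': "hgraph \<Delta>'" "\<Delta> \<subseteq> \<Delta>'" "(k, n, c) \<in> \<Delta>'"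
      by (rule hgraph_extend[OF baer \<Delta>(1) k])
    have "\<Delta>' \<in> ?A" using \<Delta>(2) \<Delta>'(1,2) by simp
    then have "\<Delta>' = \<Delta>" using max \<Delta>'(2) by simp
    then show ?thesis using \<Delta>' by blast
  qed
  with \<Delta> show thesis using that by blast
qed

end

section \<open>Injectivity of the regular module\<close>

lemma regular_left_module_simps [simp]:
  "carrier (regular_left_module R) = carrier R" "\<zero>\<^bsub>regular_left_module R\<^esub> = \<zero>\<^bsub>R\<^esub>"
  "x \<oplus>\<^bsub>regular_left_module R\<^esub> y = x \<oplus>\<^bsub>R\<^esub> y" "a \<odot>\<^bsub>regular_left_module R\<^esub> x = a \<otimes>\<^bsub>R\<^esub> x"
  by (simp_all add: regular_left_module_def)

lemma (in ring) left_module_regular: "left_module R (regular_left_module R)"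
proof (intro left_module.intro left_module_axioms.intro)
  show "abelian_group (regular_left_module R)"
    by (rule abelian_groupI) (auto simp: a_ac intro: l_neg)
qed (auto simp: ring_axioms l_distr r_distr m_assoc)

context graded_ring
begin

lemma graded_left_module_regular: "graded_left_module G R \<R> (regular_left_module R) \<R>"
proof (intro graded_left_module.intro graded_left_module_axioms.intro)
  let ?T = "regular_left_module R"
  interpret T: left_module R ?T by (rule R.left_module_regular)
  show "internal_direct_sum (carrier G) ?T \<R>"
  proof (rule internal_direct_sumI[OF T.M.abelian_group_axioms, where \<pi> = "\<lambda>g x. dec.cmp x g"])
    fix g assume g: "g \<in> carrier G"
    have neg: "\<ominus>\<^bsub>?T\<^esub> x \<in> \<R> g" if x: "x \<in> \<R> g" for x
      using T.smult_minus_one[of x] x g dec.summand_neg[OF g x] by (simp add: deg_carrier R.l_minus)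
    show "additive_subgroup (\<R> g) ?T"
    proof (intro additive_subgroup.intro subgroup.intro)
      show "inv\<^bsub>add_monoid ?T\<^esub> x \<in> \<R> g" if "x \<in> \<R> g" for x
        using neg[OF that] by (simp add: a_inv_def)
    qed (use g dec.summand_zero dec.summand_add deg_carrier in auto)
  next
    fix x P
    assume x: "x \<in> carrier ?T" "P \<zero>\<^bsub>?T\<^esub>" and P: "\<And>i y. i \<in> carrier G \<Longrightarrow> y \<in> \<R> i \<Longrightarrow> P y"
      and add: "\<And>y z. y \<in> carrier ?T \<Longrightarrow> z \<in> carrier ?T \<Longrightarrow> P y \<Longrightarrow> P z \<Longrightarrow> P (y \<oplus>\<^bsub>?T\<^esub> z)"
    show "P x" by (rule dec.component_induct[of x P]) (use x P add in simp_all)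
  qed (use dec.component_in dec.component_add dec.component_summand in auto)
qed (auto simp: graded_ring_axioms R.left_module_regular mult_degree)

text \<open>A monomorphism is injective, so the pairs \<open>(i m, f m)\<close> with homogeneous
  \<open>m\<close> form a graph, which extends to all homogeneous elements of \<open>N\<close> and
  then additively to sums. The universe can be arbitrary because the construction stays inside
  \<open>N\<close>.\<close>

theorem gr_injective_if_baer:
  assumes baer: "baer G R \<R>"
  shows "gr_injective TYPE('n) G R \<R> (regular_left_module R) \<R>"
  unfolding gr_injective_def
proof (intro conjI allI impI, rule graded_left_module_regular, elim conjE)
  fix M :: "('r, 'n) module" and \<M> and N :: "('r, 'n) module" and \<N> i f
  assume M: "graded_left_module G R \<R> M \<M>" and N: "graded_left_module G R \<R> N \<N>"
    and i: "gr_mono G R \<R> M \<M> N \<N> i" and f: "f \<in> gr_hom G R M \<M> (regular_left_module R) \<R>"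
  interpret M: graded_left_module G R \<R> M \<M> by (rule M)
  interpret N: graded_left_module G R \<R> N \<N> by (rule N)
  have "i \<in> gr_hom G R M \<M> N \<N>" using i by (simp add: gr_mono_def)
  then have ihom: "i \<in> carrier M \<rightarrow> carrier N"
      "\<And>x y. x \<in> carrier M \<Longrightarrow> y \<in> carrier M \<Longrightarrow> i (x \<oplus>\<^bsub>M\<^esub> y) = i x \<oplus>\<^bsub>N\<^esub> i y"
      "\<And>a x. a \<in> carrier R \<Longrightarrow> x \<in> carrier M \<Longrightarrow> i (a \<odot>\<^bsub>M\<^esub> x) = a \<odot>\<^bsub>N\<^esub> i x"
      "\<And>g x. g \<in> carrier G \<Longrightarrow> x \<in> \<M> g \<Longrightarrow> i x \<in> \<N> g"
    unfolding gr_hom_def by (auto simp: image_subset_iff)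
  have fhom: "f \<in> carrier M \<rightarrow> carrier R"
      "\<And>x y. x \<in> carrier M \<Longrightarrow> y \<in> carrier M \<Longrightarrow> f (x \<oplus>\<^bsub>M\<^esub> y) = f x \<boxplus> f y"
      "\<And>a x. a \<in> carrier R \<Longrightarrow> x \<in> carrier M \<Longrightarrow> f (a \<odot>\<^bsub>M\<^esub> x) = a \<cdot> f x"
      "\<And>g x. g \<in> carrier G \<Longrightarrow> x \<in> \<M> g \<Longrightarrow> f x \<in> \<R> g"
    using f unfolding gr_hom_def by (auto simp: image_subset_iff)
  have ic: "i x \<in> carrier N" and fc: "f x \<in> carrier R" if "x \<in> carrier M" for x
    using ihom(1) fhom(1) that by auto
  have i0: "i \<zero>\<^bsub>M\<^esub> = \<zero>\<^bsub>N\<^esub>"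
    using ihom(3)[of "\<zero>\<^bsub>R\<^esub>" "\<zero>\<^bsub>M\<^esub>"] ic[of "\<zero>\<^bsub>M\<^esub>"] by (simp add: M.smult_l_zero N.smult_l_zero)
  have f0: "f \<zero>\<^bsub>M\<^esub> = \<zero>\<^bsub>R\<^esub>"
    using fhom(3)[of "\<zero>\<^bsub>R\<^esub>" "\<zero>\<^bsub>M\<^esub>"] fc[of "\<zero>\<^bsub>M\<^esub>"] by (simp add: M.smult_l_zero)
  define \<Delta>0 where "\<Delta>0 = {(g, i m, f m) | g m. g \<in> carrier G \<and> m \<in> \<M> g}"
  have mem0: "(g, i m, f m) \<in> \<Delta>0" if "g \<in> carrier G" "m \<in> \<M> g" for g m
    using that by (auto simp: \<Delta>0_def)
  have "N.hgraph \<Delta>0"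
  proof (rule N.hgraphI)
    show "g \<in> carrier G \<and> n \<in> \<N> g \<and> r \<in> \<R> g" if "(g, n, r) \<in> \<Delta>0" for g n r
      using that ihom(4) fhom(4) by (auto simp: \<Delta>0_def)
    show "(g, \<zero>\<^bsub>N\<^esub>, \<zero>\<^bsub>R\<^esub>) \<in> \<Delta>0" if "g \<in> carrier G" for g
      using mem0[OF that M.mod.summand_zero[OF that]] i0 f0 by simp
    show "(g, n \<oplus>\<^bsub>N\<^esub> n', r \<boxplus> r') \<in> \<Delta>0"
      if nr: "(g, n, r) \<in> \<Delta>0" and nr': "(g, n', r') \<in> \<Delta>0" for g n r n' r'
    proof -
      obtain m where m: "g \<in> carrier G" "m \<in> \<M> g" "n = i m" "r = f m" using nr by (auto simp: \<Delta>0_def)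
      obtain m' where m': "m' \<in> \<M> g" "n' = i m'" "r' = f m'" using nr' by (auto simp: \<Delta>0_def)
      show ?thesis
        using mem0[OF m(1) M.mod.summand_add[OF m(1,2) m'(1)]] m m' M.deg_carrier_module
        by (simp add: ihom(2) fhom(2))
    qed
    show "(h \<otimes> g, a \<odot>\<^bsub>N\<^esub> n, a \<cdot> r) \<in> \<Delta>0" if a: "h \<in> carrier G" "a \<in> \<R> h" and n: "(g, n, r) \<in> \<Delta>0" for h a g n r
    proof -
      obtain m where m: "g \<in> carrier G" "m \<in> \<M> g" "n = i m" "r = f m" using n by (auto simp: \<Delta>0_def)
      show ?thesis
        using mem0[OF G.m_closed[OF a(1) m(1)] M.smult_degree[OF a(1) m(1) a(2) m(2)]]
          m a M.deg_carrier_module deg_carrier by (simp add: ihom(3) fhom(3))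
    qed
    show "r = \<zero>\<^bsub>R\<^esub>" if r: "(g, \<zero>\<^bsub>N\<^esub>, r) \<in> \<Delta>0" for g r
    proof -
      obtain m where m: "g \<in> carrier G" "m \<in> \<M> g" "\<zero>\<^bsub>N\<^esub> = i m" "r = f m" using r by (auto simp: \<Delta>0_def)
      then have "m = \<zero>\<^bsub>M\<^esub>" using gr_mono_inj[OF M N i] M.deg_carrier_module by simp
      then show ?thesis using m f0 by simp
    qed
  qed
  then obtain \<Delta> where \<Delta>: "N.hgraph \<Delta>" "\<Delta>0 \<subseteq> \<Delta>"
    and total: "\<And>k n. k \<in> carrier G \<Longrightarrow> n \<in> \<N> k \<Longrightarrow> \<exists>c. (k, n, c) \<in> \<Delta>"
    by (rule N.hgraph_total[OF baer]) (rule that)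
  define \<psi> where "\<psi> k n = (SOME c. (k, n, c) \<in> \<Delta>)" for k n
  have \<psi>: "(k, n, \<psi> k n) \<in> \<Delta>" if "k \<in> carrier G" "n \<in> \<N> k" for k n
    unfolding \<psi>_def by (rule someI_ex[OF total[OF that]])
  have \<psi>_eq: "\<psi> k n = c" if "(k, n, c) \<in> \<Delta>" for k n c
    using N.hgraph_single[OF \<Delta>(1) \<psi> that] N.hgraph_deg[OF \<Delta>(1) that] by blast
  have \<psi>c: "\<psi> k n \<in> carrier R" if "k \<in> carrier G" "n \<in> \<N> k" for k n
    using N.hgraph_deg(3)[OF \<Delta>(1) \<psi>[OF that]] that deg_carrier by blast
  obtain h where h: "h \<in> carrier N \<rightarrow> carrier R"
    "\<And>x y. x \<in> carrier N \<Longrightarrow> y \<in> carrier N \<Longrightarrow> h (x \<oplus>\<^bsub>N\<^esub> y) = h x \<boxplus> h y"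
    "\<And>k n. k \<in> carrier G \<Longrightarrow> n \<in> \<N> k \<Longrightarrow> h n = \<psi> k n"
  proof (rule N.mod.extend_from_summands[where \<psi> = \<psi> and N = R])
    show "\<psi> k (x \<oplus>\<^bsub>N\<^esub> y) = \<psi> k x \<boxplus> \<psi> k y" if "k \<in> carrier G" "x \<in> \<N> k" "y \<in> \<N> k" for k x y
      using N.hgraph_add[OF \<Delta>(1) \<psi> \<psi>] that by (intro \<psi>_eq) blast
  qed (use \<psi>c R.abelian_group_axioms that in auto)
  have hlin: "h (a \<odot>\<^bsub>N\<^esub> x) = a \<odot>\<^bsub>regular_left_module R\<^esub> h x" if "a \<in> carrier R" "x \<in> carrier N" for a x
  proof (rule N.linear_if_homogeneous[OF R.left_module_regular _ _ _ that])
    fix k l a x assume k: "k \<in> carrier G" "l \<in> carrier G" "a \<in> \<R> k" "x \<in> \<N> l"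
    have "\<psi> (k \<otimes> l) (a \<odot>\<^bsub>N\<^esub> x) = a \<cdot> \<psi> l x"
      using N.hgraph_smult[OF \<Delta>(1) k(1,3) \<psi>[OF k(2,4)]] by (rule \<psi>_eq)
    then show "h (a \<odot>\<^bsub>N\<^esub> x) = a \<odot>\<^bsub>regular_left_module R\<^esub> h x"
      using h(3)[OF G.m_closed[OF k(1,2)] N.smult_degree[OF k]] h(3)[OF k(2,4)] by simp
  qed (use h in auto)
  have "h \<in> gr_hom G R N \<N> (regular_left_module R) \<R>"
    using h hlin N.hgraph_deg(3)[OF \<Delta>(1) \<psi>] by (auto simp: gr_hom_def)
  moreover have "h (i x) = f x" if "x \<in> carrier M" for x
    using that
  proof (induction x rule: M.mod.component_induct)
    case zero
    have h0: "h \<zero>\<^bsub>N\<^esub> \<in> carrier R" using h(1) N.M.zero_closed by blast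
    have "h (i \<zero>\<^bsub>M\<^esub>) = h (\<zero>\<^bsub>R\<^esub> \<odot>\<^bsub>N\<^esub> \<zero>\<^bsub>N\<^esub>)" by (simp add: i0 N.smult_l_zero)
    also have "\<dots> = \<zero>\<^bsub>R\<^esub> \<cdot> h \<zero>\<^bsub>N\<^esub>" using hlin[of "\<zero>\<^bsub>R\<^esub>" "\<zero>\<^bsub>N\<^esub>"] by simp
    also have "\<dots> = \<zero>\<^bsub>R\<^esub>" using h0 by simp
    finally show ?case by (simp add: f0)
  next
    case (summand g m)
    then show ?case using h(3) ihom(4) \<psi>_eq mem0 \<Delta>(2) by (metis subsetD)
  next
    case (add x y)
    then show ?case using ic by (simp add: ihom(2) fhom(2) h(2))
  qed
  ultimately show "\<exists>h\<in>gr_hom G R N \<N> (regular_left_module R) \<R>. \<forall>x\<in>carrier M. h (i x) = f x" by blast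
qed

text \<open>The left ideal \<open>U\<close> as a module over the universe \<open>'r + 'm\<close>, with its grading shifted by \<open>d\<close>.\<close>

definition ideal_module :: "('g \<times> 'r) set \<Rightarrow> ('r, 'r + 'm) module" where
  "ideal_module U = \<lparr>carrier = Inl ` span U, mult = (\<lambda>x y. x), one = Inl \<zero>\<^bsub>R\<^esub>, zero = Inl \<zero>\<^bsub>R\<^esub>,
     add = (\<lambda>x y. Inl (projl x \<boxplus> projl y)), smult = (\<lambda>a x. Inl (a \<cdot> projl x))\<rparr>"

definition ideal_grading :: "'g \<Rightarrow> ('g \<times> 'r) set \<Rightarrow> 'g \<Rightarrow> ('r + 'm) set" where
  "ideal_grading d U g = {Inl x | x. (g \<otimes> inv d, x) \<in> U}"

lemma ideal_module_simps [simp]: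
  "carrier (ideal_module U) = Inl ` span U" "\<zero>\<^bsub>ideal_module U\<^esub> = Inl \<zero>\<^bsub>R\<^esub>"
  "x \<oplus>\<^bsub>ideal_module U\<^esub> y = Inl (projl x \<boxplus> projl y)" "a \<odot>\<^bsub>ideal_module U\<^esub> x = Inl (a \<cdot> projl x)"
  by (simp_all add: ideal_module_def)

lemma graded_left_module_ideal:
  assumes U: "lid U" and d: "d \<in> carrier G"
  shows "graded_left_module G R \<R> (ideal_module U :: ('r, 'r + 'm) module) (ideal_grading d U)"
proof -
  let ?T = "ideal_module U :: ('r, 'r + 'm) module" and ?C = "ideal_grading d U :: 'g \<Rightarrow> ('r + 'm) set"
  interpret I: left_ideal "span U" R by (rule left_ideal_span[OF U])
  note Uc = span_carrier[of _ U]
  have T: "abelian_group ?T"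
  proof (rule abelian_groupI)
    fix x assume "x \<in> carrier ?T"
    then obtain x0 where x0: "x0 \<in> span U" "x = Inl x0" by auto
    then show "\<exists>y\<in>carrier ?T. y \<oplus>\<^bsub>?T\<^esub> x = \<zero>\<^bsub>?T\<^esub>"
      using I.a_inv_closed[OF x0(1)] Uc by (intro bexI[of _ "Inl (\<ominus>\<^bsub>R\<^esub> x0)"]) (auto simp: R.l_neg)
  qed (use span_add[OF U] span_zero[OF U] Uc in \<open>auto simp: R.a_ac\<close>)
  interpret T: abelian_group ?T by (rule T)
  have lm: "left_module R ?T"
    by (intro left_module.intro left_module_axioms.intro R.ring_axioms T)
      (use span_mult[OF U] Uc in \<open>auto simp: R.l_distr R.r_distr R.m_assoc\<close>)
  have deg: "g \<otimes> inv d \<in> carrier G" if "g \<in> carrier G" for g using that d by simp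
  have C_sub: "x \<in> span U" if "g \<in> carrier G" "(g \<otimes> inv d, x) \<in> U" for g x
    using that span_homogeneous[OF U] lid_deg[OF U] by blast
  have "internal_direct_sum (carrier G) ?T ?C"
  \<comment> \<open>In the shifted grading the component of degree \<open>g\<close> is the original
    component of degree \<open>g \<otimes> inv d\<close>.\<close>
  proof (rule internal_direct_sumI[OF T, where \<pi> = "\<lambda>g x. Inl (dec.cmp (projl x) (g \<otimes> inv d))"])
    fix g assume g: "g \<in> carrier G"
    have neg: "\<ominus>\<^bsub>?T\<^esub> x \<in> ?C g" if x: "x \<in> ?C g" for x
    proof -
      obtain x0 where x0: "(g \<otimes> inv d, x0) \<in> U" "x = Inl x0" using x by (auto simp: ideal_grading_def)
      have "x0 \<in> span U" by (rule C_sub[OF g x0(1)])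
      then have "\<ominus>\<^bsub>?T\<^esub> x = Inl (\<ominus>\<^bsub>R\<^esub> x0)"
        using x0 I.a_inv_closed Uc by (intro T.minus_equality) (auto simp: R.l_neg)
      then show ?thesis using lid_neg[OF U x0(1)] by (simp add: ideal_grading_def)
    qed
    show "additive_subgroup (?C g) ?T"
    proof (intro additive_subgroup.intro subgroup.intro)
      show "inv\<^bsub>add_monoid ?T\<^esub> x \<in> ?C g" if "x \<in> ?C g" for x
        using neg[OF that] by (simp add: a_inv_def)
    qed (use g C_sub lid_zero[OF U deg] lid_add[OF U] in \<open>auto simp: ideal_grading_def\<close>)
  next
    fix g x assume "g \<in> carrier G" "x \<in> ?C g"
    then show "Inl (dec.cmp (projl x) (g \<otimes> inv d)) = x"
      using d lid_deg[OF U] dec.component_summand[of "g \<otimes> inv d" _ "g \<otimes> inv d"]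
      by (auto simp: ideal_grading_def)
  next
    fix g h x assume "g \<in> carrier G" "h \<in> carrier G" "g \<noteq> h" "x \<in> ?C h"
    then show "Inl (dec.cmp (projl x) (g \<otimes> inv d)) = \<zero>\<^bsub>?T\<^esub>"
      using d lid_deg[OF U] dec.component_summand[of "h \<otimes> inv d" _ "g \<otimes> inv d"]
      by (auto simp: ideal_grading_def)
  next
    fix x P
    assume x: "x \<in> carrier ?T" and 0: "P \<zero>\<^bsub>?T\<^esub>" and P: "\<And>i y. i \<in> carrier G \<Longrightarrow> y \<in> ?C i \<Longrightarrow> P y"
      and add: "\<And>y z. y \<in> carrier ?T \<Longrightarrow> z \<in> carrier ?T \<Longrightarrow> P y \<Longrightarrow> P z \<Longrightarrow> P (y \<oplus>\<^bsub>?T\<^esub> z)"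
    obtain x0 where x0: "x0 \<in> span U" "x = Inl x0" using x by auto
    let ?s = "finsum R (dec.cmp x0) (dec.support x0)"
    have "?s \<in> span U \<and> P (Inl ?s)"
    proof (rule dec.finsum_closed_under[where P = "\<lambda>y. y \<in> span U \<and> P (Inl y)"])
      fix k assume k: "k \<in> dec.support x0"
      then have kG: "k \<in> carrier G" by blast
      have U0: "(k, dec.cmp x0 k) \<in> U" using x0(1) kG unfolding gspan_def by blast
      have "k \<otimes> d \<otimes> inv d = k" using kG d by (simp add: G.m_assoc)
      then have "Inl (dec.cmp x0 k) \<in> ?C (k \<otimes> d)" using U0 by (simp add: ideal_grading_def)
      then have "P (Inl (dec.cmp x0 k))" by (rule P[OF G.m_closed[OF kG d]])
      moreover have "dec.cmp x0 k \<in> span U" using U0 span_homogeneous[OF U lid_deg[OF U U0]] by simp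
      ultimately show "dec.cmp x0 k \<in> span U \<and> P (Inl (dec.cmp x0 k))" by simp
    next
      fix y z assume "y \<in> span U \<and> P (Inl y)" "z \<in> span U \<and> P (Inl z)"
      then show "y \<boxplus> z \<in> span U \<and> P (Inl (y \<boxplus> z))"
        using add[of "Inl y" "Inl z"] span_add[OF U] by simp
    qed (use 0 span_zero[OF U] Uc[OF x0(1)] dec.finite_support dec.component_carrier in auto)
    then show "P x" using dec.component_spec[OF Uc[OF x0(1)]] x0 by simp
  next
    fix g x assume g: "g \<in> carrier G" and "x \<in> carrier ?T"
    then obtain x0 where x0: "x0 \<in> span U" "x = Inl x0" by auto
    then have "(g \<otimes> inv d, dec.cmp x0 (g \<otimes> inv d)) \<in> U" using deg[OF g] unfolding gspan_def by blast
    then show "Inl (dec.cmp (projl x) (g \<otimes> inv d)) \<in> ?C g" using x0 by (simp add: ideal_grading_def)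
  next
    fix g x y assume g: "g \<in> carrier G" and "x \<in> carrier ?T" "y \<in> carrier ?T"
    then obtain x0 y0 where "x0 \<in> span U" "x = Inl x0" "y0 \<in> span U" "y = Inl y0" by auto
    then show "Inl (dec.cmp (projl (x \<oplus>\<^bsub>?T\<^esub> y)) (g \<otimes> inv d)) =
        Inl (dec.cmp (projl x) (g \<otimes> inv d)) \<oplus>\<^bsub>?T\<^esub> Inl (dec.cmp (projl y) (g \<otimes> inv d))"
      using Uc deg[OF g] by (simp add: dec.component_add)
  qed
  moreover have "a \<odot>\<^bsub>?T\<^esub> x \<in> ?C (g \<otimes> h)"
    if g: "g \<in> carrier G" "h \<in> carrier G" "a \<in> \<R> g" and x: "x \<in> ?C h" for g h a x
  proof -
    obtain x0 where "(h \<otimes> inv d, x0) \<in> U" "x = Inl x0" using x by (auto simp: ideal_grading_def)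
    then show ?thesis
      using lid_mult[OF U g(1,3)] g d by (auto simp: ideal_grading_def G.m_assoc)
  qed
  ultimately show ?thesis
    by (intro graded_left_module.intro graded_left_module_axioms.intro graded_ring_axioms lm)
qed

text \<open>Shifting the grading by \<open>d\<close> turns a map of degree \<open>d\<close> into a
  morphism. Its extension to the shifted regular module is determined by the image \<open>c\<close>
  of 1, which now has degree \<open>d\<close>.\<close>

theorem baer_if_graded_left_injective:
  assumes inj: "graded_left_injective TYPE('m) G R \<R>"
  shows "baer G R \<R>"
  unfolding baer_def
proof (intro ballI allI impI)
  fix d \<Gamma> assume d: "d \<in> carrier G" and \<Gamma>: "hlinear G R \<R> d \<Gamma>"
  have dd: "g \<otimes> inv d \<otimes> d = g" "g \<otimes> d \<otimes> inv d = g" if "g \<in> carrier G" for g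
    using that d by (simp_all add: G.m_assoc)
  define U where "U = {(g, x). \<exists>y. (g, x, y) \<in> \<Gamma>}"
  have U: "lid U"
  proof (rule lidI)
    show "(g, x) \<in> U \<Longrightarrow> g \<in> carrier G \<and> x \<in> \<R> g" for g x
      using hlinear_deg[OF \<Gamma>] unfolding U_def by blast
    show "g \<in> carrier G \<Longrightarrow> (g, \<zero>\<^bsub>R\<^esub>) \<in> U" for g
      using hlinear_zero[OF \<Gamma>] unfolding U_def by blast
    show "(g, x) \<in> U \<Longrightarrow> (g, y) \<in> U \<Longrightarrow> (g, x \<boxplus> y) \<in> U" for g x y
      using hlinear_add[OF \<Gamma>] unfolding U_def by blast
    show "h \<in> carrier G \<Longrightarrow> r \<in> \<R> h \<Longrightarrow> (g, x) \<in> U \<Longrightarrow> (h \<otimes> g, r \<cdot> x) \<in> U" for h r g x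
      using hlinear_mult[OF \<Gamma>] unfolding U_def by blast
  qed
  let ?M = "ideal_module U :: ('r, 'r + 'm) module" and ?\<M> = "ideal_grading d U :: 'g \<Rightarrow> ('r + 'm) set"
  let ?N = "ideal_module E :: ('r, 'r + 'm) module" and ?\<N> = "ideal_grading d E :: 'g \<Rightarrow> ('r + 'm) set"
  have M: "graded_left_module G R \<R> ?M ?\<M>" by (rule graded_left_module_ideal[OF U d])
  have N: "graded_left_module G R \<R> ?N ?\<N>" by (rule graded_left_module_ideal[OF lid_E d])
  interpret M: graded_left_module G R \<R> ?M ?\<M> by (rule M)
  have UE: "span U \<subseteq> span E" using lid_subset[OF U] span_subset_iff[OF U lid_E] by blast
  have "(\<lambda>x. x) \<in> gr_hom G R ?M ?\<M> ?N ?\<N>"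
    using UE lid_subset[OF U] by (auto simp: gr_hom_def ideal_grading_def)
  then have i: "gr_mono G R \<R> ?M ?\<M> ?N ?\<N> (\<lambda>x. x)" by (simp add: gr_mono_def)
  define \<psi> where "\<psi> g x = (SOME y. (g \<otimes> inv d, projl x, y) \<in> \<Gamma>)" for g and x :: "'r + 'm"
  have \<psi>: "(g \<otimes> inv d, projl x, \<psi> g x) \<in> \<Gamma>" if "x \<in> ?\<M> g" for g x
  proof -
    have "\<exists>y. (g \<otimes> inv d, projl x, y) \<in> \<Gamma>" using that by (auto simp: ideal_grading_def U_def)
    then show ?thesis unfolding \<psi>_def by (rule someI_ex)
  qed
  have \<psi>_deg: "\<psi> g x \<in> \<R> g" if "g \<in> carrier G" "x \<in> ?\<M> g" for g x
    using hlinear_deg(3)[OF \<Gamma> \<psi>[OF that(2)]] dd that by simp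
  have \<psi>_eq: "\<psi> g x = y" if "x \<in> ?\<M> g" "(g \<otimes> inv d, projl x, y) \<in> \<Gamma>" for g x y
    by (rule hlinear_single[OF d \<Gamma> \<psi>[OF that(1)] that(2)])
  obtain f where f: "f \<in> carrier ?M \<rightarrow> carrier R"
    "\<And>x y. x \<in> carrier ?M \<Longrightarrow> y \<in> carrier ?M \<Longrightarrow> f (x \<oplus>\<^bsub>?M\<^esub> y) = f x \<boxplus> f y"
    "\<And>g x. g \<in> carrier G \<Longrightarrow> x \<in> ?\<M> g \<Longrightarrow> f x = \<psi> g x"
  proof (rule M.mod.extend_from_summands[where \<psi> = \<psi> and N = R])
    show "\<psi> g (x \<oplus>\<^bsub>?M\<^esub> y) = \<psi> g x \<boxplus> \<psi> g y" if "g \<in> carrier G" "x \<in> ?\<M> g" "y \<in> ?\<M> g" for g x y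
      using hlinear_add[OF \<Gamma> \<psi>[OF that(2)] \<psi>[OF that(3)]] M.mod.summand_add[OF that]
      by (intro \<psi>_eq) auto
    show "\<psi> g x \<in> carrier R" if "g \<in> carrier G" "x \<in> ?\<M> g" for g x
      using \<psi>_deg[OF that] that deg_carrier by blast
  qed (use R.abelian_group_axioms that in auto)
  have flin: "f (a \<odot>\<^bsub>?M\<^esub> x) = a \<odot>\<^bsub>regular_left_module R\<^esub> f x" if "a \<in> carrier R" "x \<in> carrier ?M" for a x
  proof (rule M.linear_if_homogeneous[OF R.left_module_regular _ _ _ that])
    fix k l a x assume k: "k \<in> carrier G" "l \<in> carrier G" "a \<in> \<R> k" "x \<in> ?\<M> l"
    have "(k \<otimes> (l \<otimes> inv d), a \<cdot> projl x, a \<cdot> \<psi> l x) \<in> \<Gamma>" by (rule hlinear_mult[OF \<Gamma> k(1,3) \<psi>[OF k(4)]])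
    then have "\<psi> (k \<otimes> l) (a \<odot>\<^bsub>?M\<^esub> x) = a \<cdot> \<psi> l x"
      using M.smult_degree[OF k] k d by (intro \<psi>_eq) (auto simp: G.m_assoc)
    then show "f (a \<odot>\<^bsub>?M\<^esub> x) = a \<odot>\<^bsub>regular_left_module R\<^esub> f x"
      using f(3)[OF G.m_closed[OF k(1,2)] M.smult_degree[OF k]] f(3)[OF k(2,4)] by simp
  qed (use f in auto)
  have "f \<in> gr_hom G R ?M ?\<M> (regular_left_module R) \<R>"
    unfolding gr_hom_def
  proof (intro CollectI conjI ballI)
    show "f \<in> carrier ?M \<rightarrow> carrier (regular_left_module R)" using f(1) by simp
    show "f (x \<oplus>\<^bsub>?M\<^esub> y) = f x \<oplus>\<^bsub>regular_left_module R\<^esub> f y"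
      if "x \<in> carrier ?M" "y \<in> carrier ?M" for x y
      unfolding regular_left_module_simps by (rule f(2)[OF that])
    show "f ` ?\<M> g \<subseteq> \<R> g" if "g \<in> carrier G" for g
      using that f(3) \<psi>_deg by auto
  qed (rule flin)
  with inj M N i obtain h where h: "h \<in> gr_hom G R ?N ?\<N> (regular_left_module R) \<R>"
    and hf: "\<forall>x\<in>carrier ?M. h x = f x"
    unfolding graded_left_injective_def gr_injective_def by blast
  define c where "c = h (Inl \<one>\<^bsub>R\<^esub>)"
  have "Inl \<one>\<^bsub>R\<^esub> \<in> ?\<N> d" using deg_one d by (auto simp: ideal_grading_def)
  then have c: "c \<in> \<R> d" using h d unfolding gr_hom_def c_def by blast
  have "y = x \<cdot> c" if xy: "(g, x, y) \<in> \<Gamma>" for g x y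
  proof -
    note deg = hlinear_deg[OF \<Gamma> xy]
    have xU: "(g, x) \<in> U" using xy by (auto simp: U_def)
    have xc: "x \<in> carrier R" using deg deg_carrier by blast
    have x\<M>: "Inl x \<in> ?\<M> (g \<otimes> d)" using xU dd deg by (simp add: ideal_grading_def)
    have "f (Inl x) = y"
      using f(3)[OF _ x\<M>] \<psi>_eq[OF x\<M>] xy deg d dd by simp
    moreover have "h (Inl x) = f (Inl x)"
      using hf xU span_homogeneous[OF U deg(1,2)] by simp
    moreover have "h (Inl x) = x \<cdot> c"
    proof -
      have "\<one>\<^bsub>R\<^esub> \<in> span E" using span_homogeneous[OF lid_E G.one_closed deg_one] deg_one by simp
      moreover have "\<forall>a\<in>carrier R. \<forall>z\<in>carrier ?N. h (a \<odot>\<^bsub>?N\<^esub> z) = a \<odot>\<^bsub>regular_left_module R\<^esub> h z"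
        using h unfolding gr_hom_def by blast
      ultimately have "h (x \<odot>\<^bsub>?N\<^esub> Inl \<one>\<^bsub>R\<^esub>) = x \<odot>\<^bsub>regular_left_module R\<^esub> h (Inl \<one>\<^bsub>R\<^esub>)"
        using xc by (metis ideal_module_simps(1) imageI)
      then show ?thesis using xc by (simp add: c_def)
    qed
    ultimately show ?thesis by simp
  qed
  then show "\<exists>c\<in>\<R> d. \<forall>(g, x, y)\<in>\<Gamma>. y = x \<cdot> c" using c by blast
qed

lemma graded_left_injective_iff_baer: "graded_left_injective TYPE('m) G R \<R> \<longleftrightarrow> baer G R \<R>"
  using baer_if_graded_left_injective gr_injective_if_baer
  unfolding graded_left_injective_def by blast

section \<open>Graded quasi-Frobenius rings\<close>

text \<open>Minimal idempotents make the ring left Artinian, which gives the double annihilator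
  condition for right ideals. Right ideals are then determined by their left annihilators, for which
  the descending chain condition holds.\<close>

lemma right_Noetherian_if_left_Noetherian:
  assumes baer: "baer G R \<R>" and acc: "satisfies_ACC (Collect lid)"
  shows "satisfies_ACC (Collect rid)"
proof -
  have "\<exists>e. lmin Q e" if "prime Q" for Q
    using right_minimal_exists[OF that has_right_minimal_if_left_Noetherian[OF baer acc that]]
      right_minimal_imp_left_minimal[OF that] by metis
  then have "satisfies_DCC (Collect lid)" by (rule left_Artinian_if_left_Noetherian[OF acc])
  then show ?thesis
    by (rule DCC_imp_ACC[of _ _ annl annr])
      (simp_all add: lid_annl rid_subset ann_antimono
        double_annihilator_right_if_left_Artinian[OF baer \<open>satisfies_DCC (Collect lid)\<close>])
qed

lemma baer_right_Noetherian:
  assumes "baer G R \<R>" "satisfies_ACC (Collect rid)"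
  shows "satisfies_DCC (Collect lid)" "satisfies_DCC (Collect rid)" "satisfies_ACC (Collect lid)"
    "\<forall>A. rid A \<longrightarrow> annr (annl A) = A" "\<forall>U. lid U \<longrightarrow> annl (annr U) = U"
  using left_Artinian[OF assms has_right_minimal_if_right_Noetherian[OF assms]]
    right_Artinian[OF assms has_right_minimal_if_right_Noetherian[OF assms]]
    left_Noetherian[OF assms has_right_minimal_if_right_Noetherian[OF assms]]
    annr_annl[OF assms has_right_minimal_if_right_Noetherian[OF assms]]
    annl_annr[OF assms has_right_minimal_if_right_Noetherian[OF assms]]
  by blast+

end

theorem theorem5p2:
  fixes G :: "('g, 'x) monoid_scheme" and R :: "('r, 'y) ring_scheme" and \<R> :: "'g \<Rightarrow> 'r set"
  assumes "graded_ring G R \<R>"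
  shows
    "(graded_left_Artinian G R \<R> \<and> graded_right_Artinian G R \<R> \<and>
        double_annihilator_right G R \<R> \<and> double_annihilator_left G R \<R>
      \<longleftrightarrow> graded_left_Noetherian G R \<R> \<and>
        double_annihilator_right G R \<R> \<and> double_annihilator_left G R \<R>) \<and>
     (graded_left_Noetherian G R \<R> \<and>
        double_annihilator_right G R \<R> \<and> double_annihilator_left G R \<R>
      \<longleftrightarrow> graded_left_Noetherian G R \<R> \<and> graded_left_injective TYPE('m) G R \<R>) \<and>
     (graded_left_Noetherian G R \<R> \<and> graded_left_injective TYPE('m) G R \<R>
      \<longleftrightarrow> graded_right_Noetherian G R \<R> \<and> graded_left_injective TYPE('m) G R \<R>)"
proof -
  interpret graded_ring G R \<R> by (rule assms)
  have inj: "graded_left_injective TYPE('m) G R \<R> \<longleftrightarrow> baer G R \<R>"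
    by (rule graded_left_injective_iff_baer)
  \<comment> \<open>Right annihilators embed the left ideals, with reversed order, into the right
    ideals; this passes from Artinian on the right to Noetherian on the left.\<close>
  have "satisfies_ACC (Collect lid)"
    if "satisfies_DCC (Collect rid)" "\<forall>U. lid U \<longrightarrow> annl (annr U) = U"
    by (rule DCC_imp_ACC[OF that(1), of _ annr annl])
      (simp_all add: that(2) rid_annr lid_subset ann_antimono)
  moreover have "baer G R \<R>"
    if "satisfies_ACC (Collect lid)" "\<forall>A. rid A \<longrightarrow> annr (annl A) = A" "\<forall>U. lid U \<longrightarrow> annl (annr U) = U"
    using baer_if_double_annihilators that by blast
  \<comment> \<open>Double annihilators with the left chain condition give the Baer condition; with
    it, left Noetherian implies right Noetherian, and right Noetherian implies all other
    conditions.\<close>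
  ultimately show ?thesis
    unfolding graded_left_chain_conditions graded_right_chain_conditions inj
      double_annihilator_right_iff double_annihilator_left_iff
    using right_Noetherian_if_left_Noetherian baer_right_Noetherian by blast
qed

end
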